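(* Let $\alpha\in(-\infty,-\gamma)$. Then, as $t\to\infty$, $$\mathbb P(M_t\le\sqrt2\alpha t)\sim\frac{\Phi(\alpha)}{\sqrt{4\pi}}t^{-\frac12}e^{-(1+\alpha^2)t}.$$ Moreover, conditioned on $\{M_t\le\sqrt2\alpha t\}$, as $t\to\infty$, $$\left(t-t\wedge\tau,\ X_\emptyset(t\wedge\tau)-\sqrt2\alpha t,\ M_t-\sqrt2\alpha t\right)\Longrightarrow(\xi_\alpha,-\chi_\alpha,-E_\alpha),$$ where $\xi_\alpha$ has law $$\frac{1}{-\alpha\Phi(\alpha)}\delta_0(ds)+\frac{\sqrt2}{\Phi(\alpha)}\left(\int_{\mathbb R}e^{\sqrt2\alpha z+(1-\alpha^2)s}u(z,s)^2\,dz\right)\mathbf 1_{\{s>0\}}\,ds,$$ $E_\alpha$ is an exponential random variable with parameter $-\sqrt2\alpha$, and the joint distribution of $(\xi_\alpha,\chi_\alpha,E_\alpha)$ is given, for any $x_1,x_3\in\mathbb R_+$ and $x_2\in\mathbb R$, by $$\mathbb P(\xi_\alpha\le x_1,\chi_\alpha\le x_2,E_\alpha\ge x_3)=\frac{1}{\Phi(\alpha)}\left(\mathbf 1_{\{x_3<x_2\}}\int_{x_3}^{x_2}\sqrt2e^{\sqrt2\alpha z}\,dz+\sqrt2\int_0^{x_1}ds\int_{-\infty}^{x_2-x_3}e^{\sqrt2\alpha(x_3+z)+(1-\alpha^2)s}u(z,s)^2\,dz\right).$$ Further, jointly with the preceding convergence (and still conditionally on $\{M_t\le\sqrt2\alpha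 t\}$), $$\mathcal E_t(\alpha)\Longrightarrow\mathcal E_\infty(\alpha):=\delta_{-\chi_\alpha}\mathbf 1_{\{\xi_\alpha=0\}}+\mathbf 1_{\{\xi_\alpha>0\}}\sum_{x\in\mathcal B_1\cup\mathcal B_2}\delta_{x-\chi_\alpha},$$ where, given $(\xi_\alpha,\chi_\alpha)$, $\mathcal B_1$ and $\mathcal B_2$ are i.i.d. copies of $\sum_{u\in N(\xi_\alpha)}\delta_{X_u(\xi_\alpha)}$ conditioned on $\{M_{\xi_\alpha}\le\chi_\alpha\}$ (the branching Brownian motion being independent of $(\xi_\alpha,\chi_\alpha)$). (In the joint limit, $E_\alpha=-\max\mathcal E_\infty(\alpha)$.)
   Context: Standard binary branching Brownian motion on $\mathbb R$: at time $0$ there is one particle $\emptyset$ at the origin, moving as a standard Brownian motion; after an independent exponential time of parameter $1$ it dies and gives birth to $2$ children at its current position, which move and reproduce independently in the same way. $N(t)$ is the set of particles alive at time $t$; for $u\in N(t)$ and $s\le t$, $X_u(s)$ is the position at time $s$ of $u$ or of its ancestor alive at time $s$. $M_t:=\max\{X_u(t):u\in N(t)\}$ and $u(z,t):=\mathbb P(M_t\le z)$. $\tau:=\inf\{t\ge0:\#N(t)\ge2\}$ is the first branching time and $X_\emptyset(s)$, $s\le\tau$, is the position of the initial particle at time $s$. $\gamma:=\sqrt2-1$. For $\alpha<-\gamma$, $$\Phi(\alpha):=-\frac1\alpha+\sqrt2\int_0^\infty ds\int_{\mathbb R}dy\,e^{(1-\alpha^2)s+\sqrt2\alpha y}u(y,s)^2\in(0,\infty).$$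 $\mathcal E_t(\alpha):=\sum_{u\in N(t)}\delta_{X_u(t)-\sqrt2\alpha t}$. The maximum of a point process is the position of its largest atom; $\mathcal B_1\cup\mathcal B_2$ is taken with multiplicity; point processes carry the vague topology; $\Longrightarrow$ is convergence in distribution; $f(t)\sim g(t)$ means $f(t)/g(t)\to1$; $\mathbb R_+=[0,\infty)$. *)

theory Defs
  imports "HOL-Probability.Probability" "HOL-Library.Landau_Symbols"
begin

section \<open>Point measures on the line and the vague topology\<close>

typedef point_measure =
  "{\<mu> :: real measure. sets \<mu> = sets borel \<and> (\<forall>K. compact K \<longrightarrow> (\<exists>n. emeasure \<mu> K = of_nat n))}"
  morphisms measure_of_pm Abs_point_measure
  by (intro exI[of _ "null_measure borel"]) (auto intro: exI[of _ "0::nat"])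

setup_lifting type_definition_point_measure

lemma emeasure_distr_count_space:
  assumes "finite S" "A \<in> sets borel"
  shows "emeasure (distr (count_space S) borel f) A = of_nat (card {u \<in> S. f u \<in> A})"
proof -
  have "f -` A \<inter> S = {u \<in> S. f u \<in> A}"
    by auto
  then have "emeasure (distr (count_space S) borel f) A = emeasure (count_space S) {u \<in> S. f u \<in> A}"
    using assms by (simp add: emeasure_distr)
  then show ?thesis
    using assms by (simp add: emeasure_count_space_finite)
qed

text \<open>The configuration of the points \<open>f u\<close>, \<open>u \<in> S\<close>, counted with multiplicity. For infinite
  \<open>S\<close>, which only arises on the null event that the branching process has exploded, it is empty by
  convention.\<close>

lift_definition pm_of :: "'a set \<Rightarrow> ('a \<Rightarrow> real) \<Rightarrow> point_measure"
  is "\<lambda>S f. distr (count_space (if finite S then S else {})) borel f"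
proof (intro conjI allI impI)
  fix S :: "'a set" and f :: "'a \<Rightarrow> real" and K :: "real set"
  assume "compact K"
  then have "K \<in> sets borel"
    by (simp add: borel_closed compact_imp_closed)
  then show "\<exists>n. emeasure (distr (count_space (if finite S then S else {})) borel f) K = of_nat n"
    by (auto simp: emeasure_distr_count_space intro: exI[of _ 0])
qed simp

lift_definition pm_dirac :: "real \<Rightarrow> point_measure" is "\<lambda>x. return borel x"
proof (intro conjI allI impI)
  fix x :: real and K :: "real set"
  assume "compact K"
  then have "K \<in> sets borel"
    by (simp add: borel_closed compact_imp_closed)
  then have "emeasure (return borel x) K = of_nat (if x \<in> K then 1 else 0)"
    by (simp add: indicator_def)
  then show "\<exists>n. emeasure (return borel x) K = of_nat n" ..
qed simp

lift_definition pm_shift :: "real \<Rightarrow> point_measure \<Rightarrow> point_measure"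
  is "\<lambda>c \<mu>. distr \<mu> borel (\<lambda>x. x + c)"
proof (intro conjI allI impI, goal_cases)
  case (2 c \<mu> K)
  have K: "K \<in> sets borel"
    using 2 by (simp add: borel_closed compact_imp_closed)
  have s: "sets \<mu> = sets borel" and sp: "space \<mu> = UNIV"
    using 2 sets_eq_imp_space_eq[of \<mu> borel] by auto
  have "(\<lambda>x. x + c) -` K = (\<lambda>y. - c + y) ` K"
    by (auto simp: image_iff algebra_simps intro!: bexI)
  then have "compact ((\<lambda>x. x + c) -` K)"
    using 2 by (simp only: compact_translation)
  moreover have "emeasure (distr \<mu> borel (\<lambda>x. x + c)) K = emeasure \<mu> ((\<lambda>x. x + c) -` K)"
    using K s sp by (subst emeasure_distr) (auto simp: measurable_cong_sets[OF s refl])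
  ultimately show ?case
    using 2 by auto
qed simp

instantiation point_measure :: plus
begin

lift_definition plus_point_measure :: "point_measure \<Rightarrow> point_measure \<Rightarrow> point_measure"
  is "\<lambda>\<mu> \<nu>. measure_of UNIV (sets borel) (\<lambda>A. emeasure \<mu> A + emeasure \<nu> A)"
proof (intro conjI allI impI, goal_cases)
  case (1 \<mu> \<nu>)
  show ?case
    using sets.sigma_sets_eq[of "borel :: real measure"] by (simp add: sets_measure_of_conv)
next
  case (2 \<mu> \<nu> K)
  have K: "K \<in> sets borel"
    using 2 by (simp add: borel_closed compact_imp_closed)
  have s: "sets \<mu> = sets borel" "sets \<nu> = sets borel"
    using 2 by auto
  have "emeasure (measure_of UNIV (sets borel) (\<lambda>A. emeasure \<mu> A + emeasure \<nu> A)) K =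
      emeasure \<mu> K + emeasure \<nu> K"
  proof (rule emeasure_measure_of_sigma)
    show "sigma_algebra UNIV (sets (borel :: real measure))"
      using sets.sigma_algebra_axioms[of "borel :: real measure"] by simp
    show "positive (sets borel) (\<lambda>A. emeasure \<mu> A + emeasure \<nu> A)"
      by (simp add: positive_def)
    show "countably_additive (sets borel) (\<lambda>A. emeasure \<mu> A + emeasure \<nu> A)"
      unfolding countably_additive_def
      by (auto simp: s suminf_add[symmetric] intro!: arg_cong2[where f = plus] suminf_emeasure)
  qed (rule K)
  moreover obtain m n where "emeasure \<mu> K = of_nat m" "emeasure \<nu> K = of_nat n"
    using 2 by blast
  ultimately have "emeasure (measure_of UNIV (sets borel) (\<lambda>A. emeasure \<mu> A + emeasure \<nu> A)) K =
      of_nat (m + n)"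
    by simp
  then show ?case ..
qed

instance ..

end

definition pm_max :: "point_measure \<Rightarrow> real" where
  "pm_max \<mu> = (GREATEST x. emeasure (measure_of_pm \<mu>) {x} > 0)"

text \<open>The vague topology: the coarsest one that makes integration against every continuous compactly
  supported function continuous.\<close>

instantiation point_measure :: topological_space
begin

definition open_point_measure :: "point_measure set \<Rightarrow> bool" where
  "open_point_measure = generate_topology
     {{\<mu>. (\<integral>x. f x \<partial>measure_of_pm \<mu>) \<in> U} | (f :: real \<Rightarrow> real) U.
        continuous_on UNIV f \<and> compact (closure {x. f x \<noteq> 0}) \<and> open U}"

instance
  by standard (auto simp: open_point_measure_def intro: generate_topology.intros)

end


section \<open>Convergence in distribution\<close>

text \<open>The probability spaces \<open>P i\<close> carrying the random elements \<open>X i\<close> may vary with \<open>i\<close>.\<close>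

definition converges_in_distribution ::
    "('i \<Rightarrow> 'a measure) \<Rightarrow> ('i \<Rightarrow> 'a \<Rightarrow> 'c::topological_space) \<Rightarrow> 'b measure \<Rightarrow> ('b \<Rightarrow> 'c)
      \<Rightarrow> 'i filter \<Rightarrow> bool" where
  "converges_in_distribution P X Q Y F \<longleftrightarrow>
     (\<forall>\<^sub>F i in F. prob_space (P i) \<and> X i \<in> P i \<rightarrow>\<^sub>M borel) \<and>
     prob_space Q \<and> Y \<in> Q \<rightarrow>\<^sub>M borel \<and>
     (\<forall>f :: 'c \<Rightarrow> real. continuous_on UNIV f \<and> bounded (range f) \<longrightarrow>
        ((\<lambda>i. \<integral>\<omega>. f (X i \<omega>) \<partial>P i) \<longlongrightarrow> (\<integral>\<omega>. f (Y \<omega>) \<partial>Q)) F)"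


section \<open>Branching Brownian motion\<close>

locale brownian_motion = prob_space M for M :: "'w measure" +
  fixes W :: "real \<Rightarrow> 'w \<Rightarrow> real"
  assumes measurable_W: "0 \<le> t \<Longrightarrow> W t \<in> borel_measurable M"
    and W_0: "\<omega> \<in> space M \<Longrightarrow> W 0 \<omega> = 0"
    and continuous_W: "\<omega> \<in> space M \<Longrightarrow> continuous_on {0..} (\<lambda>t. W t \<omega>)"
    and normal_increments: "0 \<le> s \<Longrightarrow> s < t \<Longrightarrow>
      distributed M lborel (\<lambda>\<omega>. W t \<omega> - W s \<omega>) (normal_density 0 (sqrt (t - s)))"
    and indep_increments: "0 \<le> ts 0 \<Longrightarrow> strict_mono (ts :: nat \<Rightarrow> real) \<Longrightarrow>
      indep_vars (\<lambda>_. borel) (\<lambda>i \<omega>. W (ts (Suc i)) \<omega> - W (ts i) \<omega>) {..<n}"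

text \<open>Particles are labelled by the nodes of the binary tree: \<open>[]\<close> is the initial particle, and the
  children of \<open>u\<close> are \<open>u @ [False]\<close> and \<open>u @ [True]\<close>. The particle \<open>u\<close> has lifetime \<open>L u\<close>, and
  \<open>B u r\<close> is its displacement from its place of birth when it has age \<open>r\<close>. All the \<open>B u\<close>, regarded
  as random elements of path space, and all the \<open>L u\<close> are jointly independent; this is stated for
  the generated sigma-algebras because \<open>indep_vars\<close> needs a common value type. Almost surely
  positive lifetimes are taken to be positive everywhere.\<close>

locale branching_brownian_motion = prob_space M for M :: "'w measure" +
  fixes L :: "bool list \<Rightarrow> 'w \<Rightarrow> real" and B :: "bool list \<Rightarrow> real \<Rightarrow> 'w \<Rightarrow> real"
  assumes lifetime_pos: "\<omega> \<in> space M \<Longrightarrow> 0 < L u \<omega>"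
    and lifetime_exponential: "distributed M lborel (L u) (exponential_density 1)"
    and displacement_brownian: "brownian_motion M (B u)"
    and indep_displacements_lifetimes:
      "indep_sets
         (case_sum
           (\<lambda>u. sets (vimage_algebra (space M) (\<lambda>\<omega>. \<lambda>r\<in>{0..}. B u r \<omega>) (Pi\<^sub>M {0..} (\<lambda>_. borel))))
           (\<lambda>u. sets (vimage_algebra (space M) (L u) borel)))
         (UNIV :: (bool list + bool list) set)"

definition birth_time :: "(bool list \<Rightarrow> 'w \<Rightarrow> real) \<Rightarrow> bool list \<Rightarrow> 'w \<Rightarrow> real" where
  "birth_time L u \<omega> = (\<Sum>i<length u. L (take i u) \<omega>)"

definition alive :: "(bool list \<Rightarrow> 'w \<Rightarrow> real) \<Rightarrow> real \<Rightarrow> 'w \<Rightarrow> bool list set" where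
  "alive L t \<omega> = {u. birth_time L u \<omega> \<le> t \<and> t < birth_time L u \<omega> + L u \<omega>}"

text \<open>The position at time \<open>t\<close> of \<open>u\<close> itself, meaningful from its birth up to and including its
  death (where it is the birthplace of its children).\<close>

definition position ::
    "(bool list \<Rightarrow> 'w \<Rightarrow> real) \<Rightarrow> (bool list \<Rightarrow> real \<Rightarrow> 'w \<Rightarrow> real) \<Rightarrow> bool list \<Rightarrow> real \<Rightarrow> 'w \<Rightarrow> real" where
  "position L B u t \<omega> =
     (\<Sum>i<length u. B (take i u) (L (take i u) \<omega>) \<omega>) + B u (t - birth_time L u \<omega>) \<omega>"

text \<open>Almost surely the set of living particles is finite and nonempty; on the exceptional null
  event the maximum is an irrelevant constant whenever the set of positions is infinite or empty.\<close>

definition max_position ::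
    "(bool list \<Rightarrow> 'w \<Rightarrow> real) \<Rightarrow> (bool list \<Rightarrow> real \<Rightarrow> 'w \<Rightarrow> real) \<Rightarrow> real \<Rightarrow> 'w \<Rightarrow> real" where
  "max_position L B t \<omega> = Max ((\<lambda>u. position L B u t \<omega>) ` alive L t \<omega>)"

definition first_branching_time :: "(bool list \<Rightarrow> 'w \<Rightarrow> real) \<Rightarrow> 'w \<Rightarrow> real" where
  "first_branching_time L \<omega> = Inf {t. 0 \<le> t \<and> 2 \<le> card (alive L t \<omega>)}"

definition max_below ::
    "'w measure \<Rightarrow> (bool list \<Rightarrow> 'w \<Rightarrow> real) \<Rightarrow> (bool list \<Rightarrow> real \<Rightarrow> 'w \<Rightarrow> real) \<Rightarrow> real \<Rightarrow> real \<Rightarrow> 'w set"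
  where "max_below M L B z t = {\<omega> \<in> space M. max_position L B t \<omega> \<le> z}"

definition max_cdf ::
    "'w measure \<Rightarrow> (bool list \<Rightarrow> 'w \<Rightarrow> real) \<Rightarrow> (bool list \<Rightarrow> real \<Rightarrow> 'w \<Rightarrow> real) \<Rightarrow> real \<Rightarrow> real \<Rightarrow> real"
  where "max_cdf M L B z t = measure M (max_below M L B z t)"

definition given_max_below ::
    "'w measure \<Rightarrow> (bool list \<Rightarrow> 'w \<Rightarrow> real) \<Rightarrow> (bool list \<Rightarrow> real \<Rightarrow> 'w \<Rightarrow> real) \<Rightarrow> real \<Rightarrow> real \<Rightarrow> 'w measure"
  where "given_max_below M L B z t = uniform_measure M (max_below M L B z t)"

text \<open>The law of the point process of positions at time \<open>s\<close>, conditioned on the maximum being at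
  most \<open>x\<close>.\<close>

definition conditioned_law ::
    "'w measure \<Rightarrow> (bool list \<Rightarrow> 'w \<Rightarrow> real) \<Rightarrow> (bool list \<Rightarrow> real \<Rightarrow> 'w \<Rightarrow> real) \<Rightarrow> real \<Rightarrow> real
      \<Rightarrow> point_measure measure"
  where "conditioned_law M L B s x =
    distr (given_max_below M L B x s) borel
      (\<lambda>\<omega>. pm_of (alive L s \<omega>) (\<lambda>u. position L B u s \<omega>))"

definition \<gamma> :: real where "\<gamma> = sqrt 2 - 1"

text \<open>The integral converges for \<open>\<alpha> < - \<gamma>\<close>. The value of \<open>\<Phi>\<close> is not
  meaningful when it diverges.\<close>

definition \<Phi> ::
    "'w measure \<Rightarrow> (bool list \<Rightarrow> 'w \<Rightarrow> real) \<Rightarrow> (bool list \<Rightarrow> real \<Rightarrow> 'w \<Rightarrow> real) \<Rightarrow> real \<Rightarrow> real"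
  where "\<Phi> M L B \<alpha> = - (1 / \<alpha>) + sqrt 2 *
    (LINT s:{0..}|lborel. (LINT y|lborel.
       exp ((1 - \<alpha>\<^sup>2) * s + sqrt 2 * \<alpha> * y) * (max_cdf M L B y s)\<^sup>2))"

definition extremal_process ::
    "(bool list \<Rightarrow> 'w \<Rightarrow> real) \<Rightarrow> (bool list \<Rightarrow> real \<Rightarrow> 'w \<Rightarrow> real) \<Rightarrow> real \<Rightarrow> real \<Rightarrow> 'w \<Rightarrow> point_measure"
  where "extremal_process L B \<alpha> t \<omega> =
    pm_of (alive L t \<omega>) (\<lambda>u. position L B u t \<omega> - sqrt 2 * \<alpha> * t)"

definition limit_process :: "real \<Rightarrow> real \<Rightarrow> point_measure \<Rightarrow> point_measure \<Rightarrow> point_measure" where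
  "limit_process xi chi B1 B2 = (if xi = 0 then pm_dirac (- chi) else pm_shift (- chi) (B1 + B2))"

text \<open>Given \<open>(xi, chi)\<close>, the random elements \<open>B1\<close> and \<open>B2\<close> are independent with common law
  \<open>K xi chi\<close>.\<close>

definition conditionally_iid_pair ::
    "'p measure \<Rightarrow> ('p \<Rightarrow> real) \<Rightarrow> ('p \<Rightarrow> real) \<Rightarrow> (real \<Rightarrow> real \<Rightarrow> 'c::topological_space measure)
      \<Rightarrow> ('p \<Rightarrow> 'c) \<Rightarrow> ('p \<Rightarrow> 'c) \<Rightarrow> bool" where
  "conditionally_iid_pair P xi chi K B1 B2 \<longleftrightarrow>
     B1 \<in> P \<rightarrow>\<^sub>M borel \<and> B2 \<in> P \<rightarrow>\<^sub>M borel \<and>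
     (\<forall>C\<in>sets borel. \<forall>D\<in>sets borel. AE \<omega> in P.
        real_cond_exp P (vimage_algebra (space P) (\<lambda>\<omega>. (xi \<omega>, chi \<omega>)) borel)
          (indicator {\<omega> \<in> space P. B1 \<omega> \<in> C \<and> B2 \<omega> \<in> D}) \<omega> =
        measure (K (xi \<omega>) (chi \<omega>)) C * measure (K (xi \<omega>) (chi \<omega>)) D)"

end

theory Submission
  imports Defs "HOL-Real_Asymp.Real_Asymp"
begin

text \<open>Write \<open>c = sqrt 2 * \<alpha> * t\<close> and split at the first branching event. With \<open>s = t - min t \<tau>\<close> the time
  left and \<open>c - y\<close> the position of the root at time \<open>t - s\<close>, the event \<open>M\<^sub>t \<le> c\<close> says that the
  maxima of two independent copies at time \<open>s\<close> are at most \<open>y\<close>. Times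
  \<open>sqrt (2 * pi * t) * exp ((1 + \<alpha>\<^sup>2) * t)\<close>, the density of \<open>(s, y)\<close> tends to
  \<open>exp ((1 - \<alpha>\<^sup>2) * s + sqrt 2 * \<alpha> * y)\<close>, and everything that is observed is a function of
  \<open>(s, y)\<close> and the two copies. So all claims follow by passing to the limit under one integral.

  The passage to the limit needs \<open>\<integral> exp ((1 - \<alpha>\<^sup>2) * s + sqrt 2 * \<alpha> * y) * u(y, s)\<^sup>2 dy\<close> to decay
  exponentially in \<open>s\<close>. Up to a constant this is \<open>exp ((1 - \<alpha>\<^sup>2) * s)\<close> times the moment
  \<open>E exp (- 2 * k * max M\<^sub>s M'\<^sub>s)\<close> with \<open>2 * k = - sqrt 2 * \<alpha>\<close>, which is at most
  \<open>(E exp (- k * M\<^sub>s))\<^sup>2\<close> since a maximum dominates the average. The same inequality in the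
  branching equation bounds \<open>E exp (- 2 * k * M\<^sub>s)\<close> by \<open>E exp (- k * M\<^sub>s)\<close>. The doubling starts
  from small \<open>k\<close>, where \<open>E exp (- k * M\<^sub>s)\<close> decays at every rate \<open>k * c'\<close> with \<open>c' < sqrt 2\<close>
  because \<open>M\<^sub>s\<close> has speed \<open>sqrt 2\<close>. The condition \<open>\<alpha> < - \<gamma>\<close> is what makes the resulting rate
  sufficient.\<close>

section \<open>Point measures\<close>

text \<open>With \<open>k = - \<alpha> / sqrt 2\<close>, remaining time \<open>s\<close> has total
  weight at most a constant times \<open>exp ((1 - \<alpha>^2) * s)\<close> times the square of
  \<open>exp_moment k s\<close>, so a growth rate \<open>b < k^2 - 1/2\<close> of that moment is
  wanted. Two mechanisms limit it. A root that never branches contributes the rate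
  \<open>k^2 / 2 - 1\<close>, which is always below \<open>k^2 - 1/2\<close>. A maximum moving at
  its typical speed contributes \<open>- sqrt 2 * k\<close>, which is below \<open>k^2 - 1/2\<close>
  iff \<open>\<alpha>^2 - 2 * \<alpha> - 1 > 0\<close>; for negative \<alpha> this says
  \<open>\<alpha> < 1 - sqrt 2 = - \<gamma>\<close>. The lower bound on the speed needs no second
  moments: the integral equation for the tail of the maximum admits a barrier growing at rate
  \<open>1 - d\<close>, which beats the Gaussian cost \<open>c^2 / 2\<close> of moving at speed
  \<open>c < sqrt 2\<close>. Paths are reduced to their values at dyadic times. A sample is then a
  countable family of reals, its Borel sigma-algebra is the product one, and both independence and
  self-similarity of the tree become statements about product measures. Almost every sample is
  \<open>regular\<close>; on the rest, default values keep the identities for the limit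
  exact.\<close>

lemma sets_measure_of_pm [measurable_cong, simp]: "sets (measure_of_pm \<mu>) = sets borel"
  using measure_of_pm[of \<mu>] by simp

text \<open>The vague topology is generated by preimages of open sets under integration against test
  functions, and preimages commute with unions and intersections.\<close>

lemma continuous_on_point_measureI:
  fixes g :: "'a::topological_space \<Rightarrow> point_measure"
  assumes "\<And>f :: real \<Rightarrow> real. continuous_on UNIV f \<Longrightarrow> compact (closure {x. f x \<noteq> 0}) \<Longrightarrow>
    continuous_on UNIV (\<lambda>x. \<integral>y. f y \<partial>measure_of_pm (g x))"
  shows "continuous_on UNIV g"
proof -
  have "open (g -` A)" if "open A" for A
    using that unfolding open_point_measure_def
  proof (induction rule: generate_topology.induct)
    case (Basis s)
    then obtain f :: "real \<Rightarrow> real" and U where s: "s = {\<mu>. (\<integral>x. f x \<partial>measure_of_pm \<mu>) \<in> U}"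
      and f: "continuous_on UNIV f" "compact (closure {x. f x \<noteq> 0})" and U: "open U"
      by auto
    have "open ((\<lambda>x. \<integral>y. f y \<partial>measure_of_pm (g x)) -` U)"
      using open_vimage[OF U assms[OF f]] .
    then show ?case
      by (simp add: s vimage_def)
  qed (auto simp: vimage_Union)
  then show ?thesis
    by (simp add: continuous_on_open_vimage)
qed

lemma measure_of_pm_of: "finite S \<Longrightarrow> measure_of_pm (pm_of S f) = distr (count_space S) borel f"
  by (simp add: pm_of.rep_eq)

lemma pm_of_cong: "(\<And>u. u \<in> S \<Longrightarrow> f u = g u) \<Longrightarrow> pm_of S f = pm_of S g"
  by (rule measure_of_pm_inject[THEN iffD1]) (auto simp: pm_of.rep_eq intro!: distr_cong)

lemma pm_of_infinite: "infinite S \<Longrightarrow> pm_of S f = pm_of {} g"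
  by (rule measure_of_pm_inject[THEN iffD1], rule measure_eqI)
     (auto simp: pm_of.rep_eq emeasure_distr_count_space)

lemma emeasure_pm_of:
  "finite S \<Longrightarrow> A \<in> sets borel \<Longrightarrow> emeasure (measure_of_pm (pm_of S f)) A = of_nat (card {u \<in> S. f u \<in> A})"
  by (simp add: measure_of_pm_of emeasure_distr_count_space)

lemma emeasure_plus_point_measure:
  assumes "A \<in> sets borel"
  shows "emeasure (measure_of_pm (\<mu> + \<nu>)) A = emeasure (measure_of_pm \<mu>) A + emeasure (measure_of_pm \<nu>) A"
  unfolding plus_point_measure.rep_eq
proof (rule emeasure_measure_of_sigma)
  show "sigma_algebra UNIV (sets (borel :: real measure))"
    using sets.sigma_algebra_axioms[of "borel :: real measure"] by simp
  show "positive (sets borel) (\<lambda>A. emeasure (measure_of_pm \<mu>) A + emeasure (measure_of_pm \<nu>) A)"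
    by (simp add: positive_def)
  show "countably_additive (sets borel) (\<lambda>A. emeasure (measure_of_pm \<mu>) A + emeasure (measure_of_pm \<nu>) A)"
    unfolding countably_additive_def
    by (auto simp: suminf_add[symmetric] intro!: arg_cong2[where f = plus] suminf_emeasure)
qed fact

lemma emeasure_pm_shift:
  "A \<in> sets borel \<Longrightarrow>
    emeasure (measure_of_pm (pm_shift c \<mu>)) A = emeasure (measure_of_pm \<mu>) ((\<lambda>x. x + c) -` A)"
  by (subst pm_shift.rep_eq, subst emeasure_distr)
     (auto simp: measurable_cong_sets[OF sets_measure_of_pm refl] sets_eq_imp_space_eq[OF sets_measure_of_pm])

text \<open>Prefixing the labels by \<open>False\<close> and \<open>True\<close> makes the two label
  sets disjoint, so a superposition keeps its multiplicities and is again a \<open>pm_of\<close>.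
  The new labels are those of the two subtrees below a root.\<close>

lemma pm_shift_pm_of_plus:
  fixes S1 S2 :: "bool list set"
  assumes "finite S1" "finite S2"
  shows "pm_shift c (pm_of S1 f1 + pm_of S2 f2) =
    pm_of (Cons False ` S1 \<union> Cons True ` S2) (\<lambda>u. (if hd u then f2 (tl u) else f1 (tl u)) + c)"
    (is "?L = pm_of ?S ?f")
proof (rule measure_of_pm_inject[THEN iffD1], rule measure_eqI)
  show "sets (measure_of_pm ?L) = sets (measure_of_pm (pm_of ?S ?f))"
    by simp
  fix A assume "A \<in> sets (measure_of_pm ?L)"
  then have A: "A \<in> sets borel"
    by simp
  have A': "(\<lambda>x. x + c) -` A \<in> sets borel"
    using measurable_sets_borel[of "\<lambda>x::real. x + c" borel A] A by simp
  have *: "{u \<in> ?S. ?f u \<in> A} = Cons False ` {u \<in> S1. f1 u + c \<in> A} \<union> Cons True ` {u \<in> S2. f2 u + c \<in> A}"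
    by auto
  have "card {u \<in> ?S. ?f u \<in> A} = card {u \<in> S1. f1 u + c \<in> A} + card {u \<in> S2. f2 u + c \<in> A}"
    unfolding * using assms by (subst card_Un_disjoint) (auto simp: card_image)
  then show "emeasure (measure_of_pm ?L) A = emeasure (measure_of_pm (pm_of ?S ?f)) A"
    using assms A A' by (simp add: emeasure_pm_shift emeasure_plus_point_measure emeasure_pm_of)
qed

lemma pm_max_pm_of:
  assumes "finite S" "S \<noteq> {}"
  shows "pm_max (pm_of S f) = Max (f ` S)"
proof -
  have *: "0 < emeasure (measure_of_pm (pm_of S f)) {x} \<longleftrightarrow> x \<in> f ` S" for x
    using assms by (auto simp: emeasure_pm_of card_gt_0_iff)
  show ?thesis
    unfolding pm_max_def * using assms by (intro Greatest_equality) auto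
qed

lemma pm_dirac_eq_pm_of: "pm_dirac x = pm_of {u} (\<lambda>_. x)"
proof (rule measure_of_pm_inject[THEN iffD1], rule measure_eqI)
  fix A assume "A \<in> sets (measure_of_pm (pm_dirac x))"
  then have "A \<in> sets borel"
    by simp
  moreover have "{v. v = u \<and> x \<in> A} = (if x \<in> A then {u} else {})"
    by auto
  ultimately show "emeasure (measure_of_pm (pm_dirac x)) A = emeasure (measure_of_pm (pm_of {u} (\<lambda>_. x))) A"
    by (simp add: emeasure_pm_of pm_dirac.rep_eq)
qed simp

lemma pm_max_pm_dirac: "pm_max (pm_dirac x) = x"
  by (subst pm_dirac_eq_pm_of[of _ undefined]) (simp add: pm_max_pm_of)

text \<open>For a fixed finite label set, a test function integrates to a finite sum of its values
  at the positions. All Borel measurability of point processes below rests on this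
  continuity.\<close>

lemma continuous_on_pm_of:
  fixes S :: "'u set"
  assumes "finite S"
  shows "continuous_on UNIV (\<lambda>x. pm_of S x)"
proof (rule continuous_on_point_measureI)
  fix f :: "real \<Rightarrow> real" assume f: "continuous_on UNIV f"
  then have [measurable]: "f \<in> borel_measurable borel"
    by (rule borel_measurable_continuous_onI)
  have "(\<integral>y. f y \<partial>measure_of_pm (pm_of S x)) = (\<Sum>u\<in>S. f (x u))" for x
    using assms by (simp add: measure_of_pm_of integral_distr lebesgue_integral_count_space_finite)
  moreover have "continuous_on UNIV (\<lambda>x::'u \<Rightarrow> real. \<Sum>u\<in>S. f (x u))"
    by (intro continuous_on_sum continuous_on_compose2[OF f] continuous_on_product_coordinates) auto
  ultimately show "continuous_on UNIV (\<lambda>x. \<integral>y. f y \<partial>measure_of_pm (pm_of S x))"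
    by simp
qed

text \<open>The vague topology is not known to be second countable here, so the Borel sigma-algebra of a
  product with \<open>point_measure\<close> is not accessible through its factors. On each of the countably many
  events \<open>S = S0\<close> the map factors continuously through a second countable space instead.\<close>

lemma measurable_Pair_pm_of:
  fixes S :: "'n \<Rightarrow> 'u::countable set" and g :: "'n \<Rightarrow> 'b::second_countable_topology"
  assumes S: "\<And>S0. finite S0 \<Longrightarrow> {\<omega> \<in> space N. S \<omega> = S0} \<in> sets N"
    and g: "g \<in> N \<rightarrow>\<^sub>M borel"
    and x: "\<And>u. (\<lambda>\<omega>. if u \<in> S \<omega> then x \<omega> u else 0) \<in> borel_measurable N"
  shows "(\<lambda>\<omega>. (g \<omega>, pm_of (S \<omega>) (x \<omega>))) \<in> N \<rightarrow>\<^sub>M borel"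
proof -
  \<comment> \<open>Positions outside \<open>S \<omega>\<close> carry no information and need not be
    measurable; setting them to 0 gives a measurable map into the countable product space.\<close>
  define x' where "x' \<omega> u = (if u \<in> S \<omega> then x \<omega> u else 0)" for \<omega> u
  have x': "x' \<in> N \<rightarrow>\<^sub>M borel"
    unfolding x'_def[abs_def] by (intro measurable_coordinatewise_then_product x)
  have eq: "pm_of (S \<omega>) (x \<omega>) = pm_of (S \<omega>) (x' \<omega>)" for \<omega>
    by (rule pm_of_cong) (simp add: x'_def)
  \<comment> \<open>All infinite label sets share one piece, because \<open>pm_of\<close> is the
    empty configuration on each of them.\<close>
  let ?C = "insert {\<omega>. infinite (S \<omega>)} ((\<lambda>S0. {\<omega>. S \<omega> = S0}) ` {S0. finite S0})"
  have comp: "(\<lambda>\<omega>. (g \<omega>, pm_of S0 (x' \<omega>))) \<in> N \<rightarrow>\<^sub>M borel" if "finite S0" for S0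
  proof -
    have "(\<lambda>(a, z). (a, pm_of S0 z)) \<circ> (\<lambda>\<omega>. (g \<omega>, x' \<omega>)) \<in> N \<rightarrow>\<^sub>M borel"
    proof (rule measurable_comp[OF borel_measurable_Pair[OF g x']])
      have "continuous_on UNIV (\<lambda>p :: 'b \<times> ('u \<Rightarrow> real). (fst p, pm_of S0 (snd p)))"
        by (intro continuous_intros continuous_on_compose2[OF continuous_on_pm_of[OF that]]) auto
      then show "(\<lambda>(a, z). (a, pm_of S0 z)) \<in> (borel :: ('b \<times> ('u \<Rightarrow> real)) measure) \<rightarrow>\<^sub>M borel"
        by (simp add: borel_measurable_continuous_onI case_prod_beta')
    qed
    then show ?thesis
      by (simp add: comp_def)
  qed
  have fin: "{\<omega> \<in> space N. finite (S \<omega>)} \<in> sets N"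
  proof -
    have "{\<omega> \<in> space N. finite (S \<omega>)} = (\<Union>S0\<in>{S0. finite S0}. {\<omega> \<in> space N. S \<omega> = S0})"
      by auto
    also have "\<dots> \<in> sets N"
      using S by (intro sets.countable_UN' countable_Collect_finite) auto
    finally show ?thesis .
  qed
  have "{\<omega> \<in> space N. infinite (S \<omega>)} = space N - {\<omega> \<in> space N. finite (S \<omega>)}"
    by auto
  with fin have inf: "{\<omega> \<in> space N. infinite (S \<omega>)} \<in> sets N"
    by auto
  show ?thesis
  proof (rule measurable_piecewise_restrict[of ?C])
    show "countable ?C"
      by (simp add: countable_Collect_finite)
    show "space N \<subseteq> \<Union> ?C"
      by auto
    fix \<Omega> assume \<Omega>: "\<Omega> \<in> ?C"
    show "\<Omega> \<inter> space N \<in> sets N"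
      using \<Omega> S inf by (auto simp: Int_def conj_commute)
    consider "\<Omega> = {\<omega>. infinite (S \<omega>)}" | S0 where "\<Omega> = {\<omega>. S \<omega> = S0}" "finite S0"
      using \<Omega> by auto
    then show "(\<lambda>\<omega>. (g \<omega>, pm_of (S \<omega>) (x \<omega>))) \<in> restrict_space N \<Omega> \<rightarrow>\<^sub>M borel"
    proof cases
      case 1
      have "(\<lambda>\<omega>. (g \<omega>, pm_of ({}::'u set) (x' \<omega>))) \<in> restrict_space N \<Omega> \<rightarrow>\<^sub>M borel"
        by (intro measurable_restrict_space1 comp) simp
      then show ?thesis
        by (subst measurable_cong) (auto simp: space_restrict_space 1 intro: pm_of_infinite)
    next
      case 2
      have "(\<lambda>\<omega>. (g \<omega>, pm_of S0 (x' \<omega>))) \<in> restrict_space N \<Omega> \<rightarrow>\<^sub>M borel"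
        by (intro measurable_restrict_space1 comp 2)
      then show ?thesis
        by (subst measurable_cong) (auto simp: space_restrict_space 2 eq)
    qed
  qed
qed

section \<open>The canonical space of branching Brownian motion\<close>

lemma measurable_eq_set:
  fixes S :: "'n \<Rightarrow> 'u::countable set"
  assumes "\<And>u. {\<omega> \<in> space N. u \<in> S \<omega>} \<in> sets N"
  shows "{\<omega> \<in> space N. S \<omega> = S0} \<in> sets N"
proof -
  have "{\<omega> \<in> space N. S \<omega> = S0} = {\<omega> \<in> space N. \<forall>u. u \<in> S \<omega> \<longleftrightarrow> u \<in> S0}"
    by auto
  also have "\<dots> \<in> sets N"
    using assms by (intro sets.sets_Collect_countable_All) (auto simp: sets.sets_Collect_neg)
  finally show ?thesis .
qed

text \<open>\<open>Max\<close> falls back to the same default on infinite sets as on the empty set,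
  so the maximal position is measurable on the exceptional event too.\<close>

lemma Max_image_infinite: "infinite A \<Longrightarrow> Max A = (Max {} :: 'a::linorder)"
  by (simp add: Max.infinite Max.eq_fold')

lemma borel_measurable_Max_image:
  fixes S :: "'n \<Rightarrow> 'u::countable set" and x :: "'n \<Rightarrow> 'u \<Rightarrow> real"
  assumes S: "\<And>u. {\<omega> \<in> space N. u \<in> S \<omega>} \<in> sets N"
    and x: "\<And>u. (\<lambda>\<omega>. if u \<in> S \<omega> then x \<omega> u else 0) \<in> borel_measurable N"
  shows "(\<lambda>\<omega>. Max (x \<omega> ` S \<omega>)) \<in> borel_measurable N"
proof -
  define x' where "x' \<omega> u = (if u \<in> S \<omega> then x \<omega> u else 0)" for \<omega> u
  have [measurable]: "(\<lambda>\<omega>. x' \<omega> u) \<in> borel_measurable N" for u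
    unfolding x'_def by (rule x)
  have [measurable]: "Measurable.pred N (\<lambda>\<omega>. u \<in> S \<omega>)" for u
    using S[of u] by (simp add: pred_def)
  have eq: "x \<omega> ` S \<omega> = x' \<omega> ` S \<omega>" for \<omega>
    by (auto simp: x'_def)
  define c where "c = (Max {} :: real)"
  \<comment> \<open>Finiteness of the set of positions, written with quantifiers over lists of
    labels only. These are countable, hence the predicate is measurable. The image is tested and not
    \<open>S \<omega>\<close>, since \<open>Max\<close> depends on the image alone.\<close>
  define fin where "fin \<omega> \<longleftrightarrow> (\<exists>us. (\<forall>u. u \<in> set us \<longrightarrow> u \<in> S \<omega>) \<and>
    (\<forall>u. u \<in> S \<omega> \<longrightarrow> (\<exists>v. v \<in> set us \<and> x' \<omega> u = x' \<omega> v)))" for \<omega>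
  have fin: "fin \<omega> \<longleftrightarrow> finite (x' \<omega> ` S \<omega>)" for \<omega>
  proof
    assume "fin \<omega>"
    then obtain us where "\<And>u. u \<in> S \<omega> \<Longrightarrow> \<exists>v. v \<in> set us \<and> x' \<omega> u = x' \<omega> v"
      unfolding fin_def by auto
    then have "x' \<omega> ` S \<omega> \<subseteq> x' \<omega> ` set us"
      by fastforce
    then show "finite (x' \<omega> ` S \<omega>)"
      by (meson finite_imageI finite_subset finite_set)
  next
    assume "finite (x' \<omega> ` S \<omega>)"
    then obtain F where F: "F \<subseteq> S \<omega>" "finite F" "x' \<omega> ` S \<omega> = x' \<omega> ` F"
      by (meson finite_subset_image subset_refl)
    obtain us where "set us = F"
      using finite_list[OF F(2)] by auto
    with F show "fin \<omega>"
      unfolding fin_def by (intro exI[of _ us]) (auto simp: image_iff set_eq_iff)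
  qed
  have [measurable]: "Measurable.pred N fin"
    unfolding fin_def[abs_def] by measurable
  have "Max (x \<omega> ` S \<omega>) \<le> a \<longleftrightarrow>
      (if fin \<omega> \<and> (\<exists>u. u \<in> S \<omega>) then \<forall>u. u \<in> S \<omega> \<longrightarrow> x' \<omega> u \<le> a else c \<le> a)" for \<omega> a
  proof (cases "fin \<omega> \<and> (\<exists>u. u \<in> S \<omega>)")
    case True
    then have "Max (x' \<omega> ` S \<omega>) \<le> a \<longleftrightarrow> (\<forall>z\<in>x' \<omega> ` S \<omega>. z \<le> a)"
      by (intro Max_le_iff) (auto simp: fin)
    with True show ?thesis
      by (auto simp: eq)
  next
    case False
    then have "Max (x' \<omega> ` S \<omega>) = c"
      by (cases "S \<omega> = {}") (auto simp: fin c_def Max_image_infinite)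
    with False show ?thesis
      by (simp only: eq if_False)
  qed
  then show ?thesis
    unfolding borel_measurable_iff_le by simp
qed

type_synonym tree_data = "bool list + bool list \<Rightarrow> nat \<Rightarrow> real"

definition dyadic :: "nat \<Rightarrow> real" where
  "dyadic n = real (fst (prod_decode n)) / 2 ^ snd (prod_decode n)"

text \<open>A sample of the whole process is stored as a countable family of real numbers: component
  \<open>Inl u\<close> is the path of \<open>u\<close> at the dyadic times, component \<open>Inr u\<close> repeats the lifetime of \<open>u\<close>.\<close>

definition lifetime :: "bool list \<Rightarrow> tree_data \<Rightarrow> real" where
  "lifetime u y = y (Inr u) 0"

text \<open>A continuous path is recovered at \<open>r\<close> from its values at the dyadic points
  just below \<open>r\<close>. Using \<open>lim\<close> makes this a total and measurable function
  of arbitrary data.\<close>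

definition displacement :: "bool list \<Rightarrow> real \<Rightarrow> tree_data \<Rightarrow> real" where
  "displacement u r y = lim (\<lambda>m. y (Inl u) (prod_encode (nat \<lfloor>r * 2 ^ m\<rfloor>, m)))"

definition tree_data_of ::
    "(bool list \<Rightarrow> 'w \<Rightarrow> real) \<Rightarrow> (bool list \<Rightarrow> real \<Rightarrow> 'w \<Rightarrow> real) \<Rightarrow> 'w \<Rightarrow> tree_data" where
  "tree_data_of L B \<omega> = case_sum (\<lambda>u n. B u (dyadic n) \<omega>) (\<lambda>u n. L u \<omega>)"

definition subtree :: "bool \<Rightarrow> tree_data \<Rightarrow> tree_data" where
  "subtree b y i = y (map_sum (Cons b) (Cons b) i)"

abbreviation alive\<^sub>0 :: "real \<Rightarrow> tree_data \<Rightarrow> bool list set" where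
  "alive\<^sub>0 \<equiv> alive lifetime"

abbreviation position\<^sub>0 :: "bool list \<Rightarrow> real \<Rightarrow> tree_data \<Rightarrow> real" where
  "position\<^sub>0 \<equiv> position lifetime displacement"

abbreviation max\<^sub>0 :: "real \<Rightarrow> tree_data \<Rightarrow> real" where
  "max\<^sub>0 \<equiv> max_position lifetime displacement"

abbreviation particles :: "real \<Rightarrow> tree_data \<Rightarrow> point_measure" where
  "particles s y \<equiv> pm_of (alive\<^sub>0 s y) (\<lambda>u. position\<^sub>0 u s y)"

lemma measurable_component2:
  assumes "g \<in> N \<rightarrow>\<^sub>M (borel :: ('i::countable \<Rightarrow> 'j::countable \<Rightarrow> real) measure)"
  shows "(\<lambda>x. g x i n) \<in> borel_measurable N"
  using measurable_product_then_coordinatewise[OF measurable_product_then_coordinatewise[OF assms]] .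

lemma measurable_lifetime [measurable (raw)]:
  "g \<in> N \<rightarrow>\<^sub>M borel \<Longrightarrow> (\<lambda>x. lifetime u (g x)) \<in> borel_measurable N"
  unfolding lifetime_def by (rule measurable_component2)

lemma measurable_displacement [measurable (raw)]:
  assumes [measurable]: "f \<in> borel_measurable N" and g: "g \<in> N \<rightarrow>\<^sub>M borel"
  shows "(\<lambda>x. displacement u (f x) (g x)) \<in> borel_measurable N"
proof -
  have "(\<lambda>x. g x (Inl u) (prod_encode (nat \<lfloor>f x * 2 ^ m\<rfloor>, m))) \<in> borel_measurable N" for m
  proof (rule measurable_compose_countable[of "\<lambda>n x. g x (Inl u) n"])
    have "(\<lambda>x. nat \<lfloor>f x * 2 ^ m\<rfloor>) \<in> N \<rightarrow>\<^sub>M count_space UNIV"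
      by measurable
    then show "(\<lambda>x. prod_encode (nat \<lfloor>f x * 2 ^ m\<rfloor>, m)) \<in> N \<rightarrow>\<^sub>M count_space UNIV"
      by (rule measurable_compose) simp
  qed (rule measurable_component2[OF g])
  then show ?thesis
    unfolding displacement_def by (rule borel_measurable_lim_metric)
qed

lemma measurable_subtree [measurable (raw)]:
  assumes "g \<in> N \<rightarrow>\<^sub>M borel"
  shows "(\<lambda>x. subtree b (g x)) \<in> N \<rightarrow>\<^sub>M borel"
  unfolding subtree_def[abs_def]
  by (rule measurable_coordinatewise_then_product, rule measurable_coordinatewise_then_product,
      rule measurable_component2, fact)

lemma measurable_birth_time [measurable (raw)]:
  "g \<in> N \<rightarrow>\<^sub>M borel \<Longrightarrow> (\<lambda>x. birth_time lifetime u (g x)) \<in> borel_measurable N"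
  unfolding birth_time_def by measurable

lemma measurable_alive [measurable (raw)]:
  assumes [measurable]: "f \<in> borel_measurable N" "g \<in> N \<rightarrow>\<^sub>M borel"
  shows "Measurable.pred N (\<lambda>x. u \<in> alive\<^sub>0 (f x) (g x))"
  unfolding alive_def mem_Collect_eq by measurable

lemma measurable_position [measurable (raw)]:
  assumes [measurable]: "f \<in> borel_measurable N" "g \<in> N \<rightarrow>\<^sub>M borel"
  shows "(\<lambda>x. position\<^sub>0 u (f x) (g x)) \<in> borel_measurable N"
  unfolding position_def by measurable

lemma measurable_max_position [measurable (raw)]:
  assumes [measurable]: "f \<in> borel_measurable N" "g \<in> N \<rightarrow>\<^sub>M borel"
  shows "(\<lambda>x. max\<^sub>0 (f x) (g x)) \<in> borel_measurable N"
  unfolding max_position_def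
proof (rule borel_measurable_Max_image)
  show "{\<omega> \<in> space N. u \<in> alive\<^sub>0 (f \<omega>) (g \<omega>)} \<in> sets N" for u
    using measurable_alive[OF assms, of u] by (simp add: pred_def)
qed measurable

lemma measurable_Pair_particles:
  fixes h :: "'n \<Rightarrow> 'b::second_countable_topology"
  assumes [measurable]: "f \<in> borel_measurable N" "g \<in> N \<rightarrow>\<^sub>M borel" and h: "h \<in> N \<rightarrow>\<^sub>M borel"
  shows "(\<lambda>x. (h x, particles (f x) (g x))) \<in> N \<rightarrow>\<^sub>M borel"
proof (rule measurable_Pair_pm_of[OF measurable_eq_set h])
  show "{\<omega> \<in> space N. u \<in> alive\<^sub>0 (f \<omega>) (g \<omega>)} \<in> sets N" for u
    using measurable_alive[OF assms(1,2), of u] by (simp add: pred_def)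
qed measurable

lemma measurable_particles:
  assumes [measurable]: "f \<in> borel_measurable N" "g \<in> N \<rightarrow>\<^sub>M borel"
  shows "(\<lambda>x. particles (f x) (g x)) \<in> N \<rightarrow>\<^sub>M borel"
proof -
  have "snd \<circ> (\<lambda>x. (0::real, particles (f x) (g x))) \<in> N \<rightarrow>\<^sub>M borel"
    by (rule measurable_comp[OF measurable_Pair_particles])
       (auto intro!: borel_measurable_continuous_onI continuous_on_snd continuous_on_id)
  then show ?thesis
    by (simp add: comp_def)
qed

section \<open>Decomposition of the tree at its root\<close>

lemma lifetime_subtree: "lifetime u (subtree b y) = lifetime (b # u) y"
  by (simp add: lifetime_def subtree_def)

lemma displacement_subtree: "displacement u r (subtree b y) = displacement (b # u) r y"
  by (simp add: displacement_def subtree_def)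

lemma birth_time_Nil: "birth_time L [] \<omega> = 0"
  by (simp add: birth_time_def)

lemma birth_time_Cons: "birth_time lifetime (b # u) y = lifetime [] y + birth_time lifetime u (subtree b y)"
  unfolding birth_time_def by (simp add: sum.lessThan_Suc_shift lifetime_subtree del: sum.lessThan_Suc)

lemma position_Cons:
  "position\<^sub>0 (b # u) t y =
    displacement [] (lifetime [] y) y + position\<^sub>0 u (t - lifetime [] y) (subtree b y)"
  unfolding position_def
  by (simp add: sum.lessThan_Suc_shift lifetime_subtree displacement_subtree birth_time_Cons algebra_simps
      del: sum.lessThan_Suc)

lemma position_Nil: "position L B [] t \<omega> = B [] t \<omega>"
  by (simp add: position_def birth_time_Nil)

lemma Nil_in_alive_iff: "[] \<in> alive L t \<omega> \<longleftrightarrow> 0 \<le> t \<and> t < L [] \<omega>"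
  by (simp add: alive_def birth_time_Nil)

lemma Cons_in_alive_iff: "b # u \<in> alive\<^sub>0 t y \<longleftrightarrow> u \<in> alive\<^sub>0 (t - lifetime [] y) (subtree b y)"
  by (auto simp: alive_def birth_time_Cons lifetime_subtree)

lemma birth_time_nonneg: "(\<And>u. 0 \<le> L u \<omega>) \<Longrightarrow> 0 \<le> birth_time L u \<omega>"
  by (simp add: birth_time_def sum_nonneg)

lemma alive_neg: "(\<And>u. 0 \<le> L u \<omega>) \<Longrightarrow> t < 0 \<Longrightarrow> alive L t \<omega> = {}"
  using birth_time_nonneg[of L \<omega>] by (auto simp: alive_def) (meson dual_order.trans linorder_not_le)

text \<open>A descendant of the root is seen by its subtree at the negative time
  \<open>t - lifetime [] y\<close>, when nothing is alive.\<close>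

lemma alive_before_branching:
  assumes "\<And>u. 0 \<le> lifetime u y" "0 \<le> t" "t < lifetime [] y"
  shows "alive\<^sub>0 t y = {[]}"
proof -
  have "u \<in> alive\<^sub>0 t y \<longleftrightarrow> u = []" for u
    using assms alive_neg[of lifetime "subtree b y" for b]
    by (cases u) (auto simp: Nil_in_alive_iff Cons_in_alive_iff lifetime_subtree)
  then show ?thesis
    by auto
qed

lemma alive_after_branching:
  assumes "lifetime [] y \<le> t"
  shows "alive\<^sub>0 t y = Cons False ` alive\<^sub>0 (t - lifetime [] y) (subtree False y) \<union>
    Cons True ` alive\<^sub>0 (t - lifetime [] y) (subtree True y)"
proof -
  have "u \<in> alive\<^sub>0 t y \<longleftrightarrow> u \<in> Cons False ` alive\<^sub>0 (t - lifetime [] y) (subtree False y) \<union>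
    Cons True ` alive\<^sub>0 (t - lifetime [] y) (subtree True y)" for u
  proof (cases u)
    case (Cons b v)
    then show ?thesis
      by (cases b) (auto simp: Cons_in_alive_iff)
  qed (use assms in \<open>auto simp: Nil_in_alive_iff\<close>)
  then show ?thesis
    by auto
qed

text \<open>The last condition makes a non-branching particle sit at the origin at time \<open>0\<close>.\<close>

definition regular :: "tree_data \<Rightarrow> bool" where
  "regular y \<longleftrightarrow> (\<forall>u. 0 < lifetime u y) \<and> (\<forall>n::nat. finite {u. birth_time lifetime u y \<le> real n}) \<and>
    displacement [] 0 y = 0"

lemma regular_lifetime_pos: "regular y \<Longrightarrow> 0 < lifetime u y"
  by (simp add: regular_def)

lemma finite_alive_regular:
  assumes "regular y"
  shows "finite (alive\<^sub>0 t y)"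
proof -
  obtain n :: nat where "t \<le> real n"
    using real_arch_simple by auto
  then have "alive\<^sub>0 t y \<subseteq> {u. birth_time lifetime u y \<le> real n}"
    by (auto simp: alive_def)
  then show ?thesis
    using assms finite_subset unfolding regular_def by blast
qed

text \<open>A particle of maximal depth among those born by time \<open>t\<close> has not branched yet.\<close>

lemma alive_nonempty_regular:
  assumes "regular y" "0 \<le> t"
  shows "alive\<^sub>0 t y \<noteq> {}"
proof -
  obtain n :: nat where n: "t \<le> real n"
    using real_arch_simple by auto
  let ?S = "{u. birth_time lifetime u y \<le> t}"
  have "?S \<subseteq> {u. birth_time lifetime u y \<le> real n}"
    using n by auto
  then have "finite ?S"
    using assms finite_subset unfolding regular_def by blast
  moreover have "[] \<in> ?S"
    using assms by (simp add: birth_time_Nil)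
  ultimately have "Max (length ` ?S) \<in> length ` ?S"
    by (intro Max_in) auto
  then obtain u where "u \<in> ?S" "length u = Max (length ` ?S)"
    by auto
  with \<open>finite ?S\<close> have u: "u \<in> ?S" "\<And>v. v \<in> ?S \<Longrightarrow> length v \<le> length u"
    by auto
  have "birth_time lifetime (u @ [True]) y = birth_time lifetime u y + lifetime u y"
    by (simp add: birth_time_def)
  moreover have "u @ [True] \<notin> ?S"
    using u(2)[of "u @ [True]"] by auto
  ultimately have "u \<in> alive\<^sub>0 t y"
    using u(1) by (auto simp: alive_def)
  then show ?thesis
    by auto
qed

lemma measurable_regular [measurable]: "Measurable.pred borel regular"
proof -
  \<comment> \<open>A set of labels is finite iff some list covers it; this leaves only countable
    quantifiers.\<close>
  have *: "finite A \<longleftrightarrow> (\<exists>us. \<forall>u. u \<in> A \<longrightarrow> u \<in> set us)" for A :: "bool list set"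
    by (metis List.finite_set finite_list finite_subset subsetI)
  show ?thesis
    unfolding regular_def * mem_Collect_eq by measurable
qed

lemma max_position_eq_position:
  assumes "regular y" "0 \<le> t" "t < lifetime [] y"
  shows "max\<^sub>0 t y = displacement [] t y" "particles t y = pm_dirac (displacement [] t y)"
proof -
  have "alive\<^sub>0 t y = {[]}"
    using assms by (intro alive_before_branching) (auto simp: regular_lifetime_pos less_imp_le)
  moreover have "pm_of {[]} (\<lambda>u. position\<^sub>0 u t y) = pm_of {[] :: bool list} (\<lambda>_. displacement [] t y)"
    by (rule pm_of_cong) (simp add: position_Nil)
  ultimately show "max\<^sub>0 t y = displacement [] t y" "particles t y = pm_dirac (displacement [] t y)"
    by (simp_all add: max_position_def position_Nil pm_dirac_eq_pm_of[of _ "[] :: bool list"])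
qed

lemma max_position_zero: "regular y \<Longrightarrow> max\<^sub>0 0 y = 0" "regular y \<Longrightarrow> particles 0 y = pm_dirac 0"
  using max_position_eq_position[of y 0] by (auto simp: regular_def)

text \<open>The children start from the place where the root dies, so both subtrees are translated
  by \<open>x\<close>. Regularity of the subtrees makes their particle sets finite and nonempty,
  which lets \<open>Max\<close> split over the union and commute with the translation.\<close>

lemma max_position_after_branching:
  fixes y
  defines "s t \<equiv> t - lifetime [] y" and "x \<equiv> displacement [] (lifetime [] y) y"
  assumes reg: "regular (subtree False y)" "regular (subtree True y)" and t: "lifetime [] y \<le> t"
  shows "max\<^sub>0 t y = x + max (max\<^sub>0 (s t) (subtree False y)) (max\<^sub>0 (s t) (subtree True y))"
    and "pm_of (alive\<^sub>0 t y) (\<lambda>u. position\<^sub>0 u t y - c) =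
      pm_shift (x - c) (particles (s t) (subtree False y) + particles (s t) (subtree True y))"
proof -
  let ?S = "\<lambda>b. alive\<^sub>0 (s t) (subtree b y)"
  let ?p = "\<lambda>b u. position\<^sub>0 u (s t) (subtree b y)"
  have S: "alive\<^sub>0 t y = Cons False ` ?S False \<union> Cons True ` ?S True"
    unfolding s_def using t by (rule alive_after_branching)
  have p: "position\<^sub>0 (b # u) t y = x + ?p b u" for b u
    by (simp add: position_Cons s_def x_def)
  have reg': "regular (subtree b y)" for b
    using reg by (cases b) auto
  have fin: "finite (?S b)" "?S b \<noteq> {}" for b
    using finite_alive_regular[OF reg'] alive_nonempty_regular[OF reg', of "s t"] t by (auto simp: s_def)
  have im: "(\<lambda>u. position\<^sub>0 u t y) ` alive\<^sub>0 t y = (\<lambda>z. x + z) ` (?p False ` ?S False \<union> ?p True ` ?S True)"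
    unfolding S image_Un image_image p ..
  have "max\<^sub>0 t y = Max ((\<lambda>z. x + z) ` (?p False ` ?S False \<union> ?p True ` ?S True))"
    unfolding max_position_def im ..
  also have "\<dots> = x + Max (?p False ` ?S False \<union> ?p True ` ?S True)"
    using fin by (intro mono_Max_commute[symmetric]) (auto simp: mono_def)
  also have "\<dots> = x + max (Max (?p False ` ?S False)) (Max (?p True ` ?S True))"
    using fin by (subst Max_Un) auto
  finally show "max\<^sub>0 t y = x + max (max\<^sub>0 (s t) (subtree False y)) (max\<^sub>0 (s t) (subtree True y))"
    unfolding max_position_def .
  have "pm_shift (x - c) (particles (s t) (subtree False y) + particles (s t) (subtree True y)) =
      pm_of (alive\<^sub>0 t y) (\<lambda>u. (if hd u then ?p True (tl u) else ?p False (tl u)) + (x - c))"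
    unfolding S by (rule pm_shift_pm_of_plus[OF fin(1) fin(1)])
  also have "\<dots> = pm_of (alive\<^sub>0 t y) (\<lambda>u. position\<^sub>0 u t y - c)"
    unfolding S by (rule pm_of_cong) (auto simp: p)
  finally show "pm_of (alive\<^sub>0 t y) (\<lambda>u. position\<^sub>0 u t y - c) =
      pm_shift (x - c) (particles (s t) (subtree False y) + particles (s t) (subtree True y))" ..
qed

section \<open>The law of the canonical data\<close>

lemma dyadic_encode: "dyadic (prod_encode (k, m)) = real k / 2 ^ m"
  by (simp add: dyadic_def)

lemma dyadic_nonneg: "0 \<le> dyadic n"
  by (simp add: dyadic_def)

lemma floor_dyadic_tendsto:
  fixes r :: real
  assumes "0 \<le> r"
  shows "(\<lambda>m. real (nat \<lfloor>r * 2 ^ m\<rfloor>) / 2 ^ m) \<longlonglongrightarrow> r"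
proof (rule tendsto_sandwich)
  have *: "real (nat \<lfloor>r * 2 ^ m\<rfloor>) \<le> r * 2 ^ m" "r * 2 ^ m - 1 \<le> real (nat \<lfloor>r * 2 ^ m\<rfloor>)" for m
    using assms by (simp_all add: of_nat_nat zero_le_mult_iff)
  have "r - (1 / 2) ^ m \<le> real (nat \<lfloor>r * 2 ^ m\<rfloor>) / 2 ^ m" for m
    using divide_right_mono[OF *(2)[of m], of "2 ^ m"] by (simp add: diff_divide_distrib power_one_over inverse_eq_divide)
  then show "\<forall>\<^sub>F m in sequentially. r - (1 / 2) ^ m \<le> real (nat \<lfloor>r * 2 ^ m\<rfloor>) / 2 ^ m"
    by simp
  show "\<forall>\<^sub>F m in sequentially. real (nat \<lfloor>r * 2 ^ m\<rfloor>) / 2 ^ m \<le> r"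
    using *(1) by (simp add: field_simps)
  have "(\<lambda>m. r - (1 / 2) ^ m) \<longlonglongrightarrow> r - 0"
    by (intro tendsto_intros LIMSEQ_power_zero) simp
  then show "(\<lambda>m. r - (1 / 2) ^ m) \<longlonglongrightarrow> r"
    by simp
qed simp

section \<open>Uniqueness of the law of Brownian motion at dyadic times\<close>

context brownian_motion
begin

lemma distr_increments:
  assumes ts: "0 \<le> ts 0" "strict_mono (ts :: nat \<Rightarrow> real)" and "0 < K"
  shows "distr M (Pi\<^sub>M {..<K} (\<lambda>_. borel)) (\<lambda>\<omega>. \<lambda>i\<in>{..<K}. W (ts (Suc i)) \<omega> - W (ts i) \<omega>) =
    Pi\<^sub>M {..<K} (\<lambda>i. density lborel (normal_density 0 (sqrt (ts (Suc i) - ts i))))"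
proof -
  have ts_nn: "0 \<le> ts i" "ts i < ts (Suc i)" for i
    using ts(1) strict_monoD[OF ts(2), of i "Suc i"] strict_mono_less_eq[OF ts(2), of 0 i] by auto
  have rv: "(\<lambda>\<omega>. W (ts (Suc i)) \<omega> - W (ts i) \<omega>) \<in> borel_measurable M" for i
    using ts_nn by (intro borel_measurable_diff measurable_W) auto
  have "distr M borel (\<lambda>\<omega>. W (ts (Suc i)) \<omega> - W (ts i) \<omega>) =
      density lborel (normal_density 0 (sqrt (ts (Suc i) - ts i)))" for i
    using distributed_distr_eq_density[OF normal_increments[OF ts_nn(1,2)[of i]]]
    by (simp cong: distr_cong)
  moreover have "distr M (Pi\<^sub>M {..<K} (\<lambda>_. borel)) (\<lambda>\<omega>. \<lambda>i\<in>{..<K}. W (ts (Suc i)) \<omega> - W (ts i) \<omega>) =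
      (Pi\<^sub>M {..<K} (\<lambda>i. distr M borel (\<lambda>\<omega>. W (ts (Suc i)) \<omega> - W (ts i) \<omega>)))"
    using indep_increments[OF ts, of K] \<open>0 < K\<close> rv
    by (subst indep_vars_iff_distr_eq_PiM'[symmetric]) auto
  ultimately show ?thesis
    by simp
qed

lemma measurable_dyadic_path: "(\<lambda>\<omega> n. W (dyadic n) \<omega>) \<in> M \<rightarrow>\<^sub>M borel"
  by (intro measurable_coordinatewise_then_product measurable_W dyadic_nonneg)

text \<open>On a common grid the path is a partial sum of its independent Gaussian increments. The
  right-hand side does not mention \<open>W\<close>, so any two Brownian motions give a cylinder the
  same probability.\<close>

lemma emeasure_dyadic_cylinder:
  fixes A :: "nat \<Rightarrow> real set"
  assumes K: "0 < K" "\<And>n. n \<in> J \<Longrightarrow> k n \<le> K" and k: "\<And>n. n \<in> J \<Longrightarrow> dyadic n = real (k n) / 2 ^ m"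
    and J: "finite J" and A: "\<And>n. n \<in> J \<Longrightarrow> A n \<in> sets borel"
  shows "emeasure (distr M borel (\<lambda>\<omega> n. W (dyadic n) \<omega>)) {p. \<forall>n\<in>J. p n \<in> A n} =
    emeasure (Pi\<^sub>M {..<K} (\<lambda>i. density lborel (normal_density 0 (sqrt (real (Suc i) / 2 ^ m - real i / 2 ^ m)))))
       {x \<in> space (Pi\<^sub>M {..<K} (\<lambda>_. borel)). \<forall>n\<in>J. (\<Sum>i<k n. x i) \<in> A n}" (is "?L = emeasure _ ?H")
proof -
  define ts where "ts i = real i / 2 ^ m" for i
  have ts: "0 \<le> ts 0" "strict_mono ts"
    by (auto simp: ts_def strict_mono_def divide_strict_right_mono)
  let ?D = "\<lambda>\<omega>. \<lambda>i\<in>{..<K}. W (ts (Suc i)) \<omega> - W (ts i) \<omega>"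
  have sum_D: "(\<Sum>i<k n. ?D \<omega> i) = W (dyadic n) \<omega>" if "\<omega> \<in> space M" "n \<in> J" for \<omega> n
  proof -
    have "(\<Sum>i<k n. ?D \<omega> i) = (\<Sum>i<k n. W (ts (Suc i)) \<omega> - W (ts i) \<omega>)"
      using K(2)[OF that(2)] by (intro sum.cong) auto
    also have "\<dots> = W (ts (k n)) \<omega> - W (ts 0) \<omega>"
      by (rule sum_lessThan_telescope)
    finally show ?thesis
      using that W_0 by (simp add: ts_def k)
  qed
  have [measurable]: "(\<lambda>x. \<Sum>i<k n. x i) \<in> borel_measurable (Pi\<^sub>M {..<K} (\<lambda>_. borel :: real measure))"
    if "n \<in> J" for n
    using K(2)[OF that] by (intro borel_measurable_sum measurable_component_singleton) auto
  have H: "?H \<in> sets (Pi\<^sub>M {..<K} (\<lambda>_. borel))"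
  proof (rule sets.sets_Collect_finite_All[OF _ J])
    show "{x \<in> space (Pi\<^sub>M {..<K} (\<lambda>_. borel)). (\<Sum>i<k n. x i) \<in> A n} \<in> sets (Pi\<^sub>M {..<K} (\<lambda>_. borel))"
      if "n \<in> J" for n
      using A[OF that] that by measurable
  qed
  have D: "?D \<in> M \<rightarrow>\<^sub>M Pi\<^sub>M {..<K} (\<lambda>_. borel)"
    by (intro measurable_restrict borel_measurable_diff measurable_W) (auto simp: ts_def)
  have "{p. \<forall>n\<in>J. p n \<in> A n} = (\<Inter>n\<in>J. (\<lambda>p. p n) -` A n)"
    by auto
  also have "\<dots> \<in> sets borel"
  proof (cases "J = {}")
    case True
    then show ?thesis
      by simp
  next
    case False
    show ?thesis
    proof (rule sets.finite_INT[OF J False])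
      show "(\<lambda>p. p n) -` A n \<in> sets borel" if "n \<in> J" for n
        using measurable_product_coordinates A[OF that] by (rule measurable_sets_borel)
    qed
  qed
  finally have "?L = emeasure M ((\<lambda>\<omega> n. W (dyadic n) \<omega>) -` {p. \<forall>n\<in>J. p n \<in> A n} \<inter> space M)"
    by (intro emeasure_distr measurable_dyadic_path)
  also have "(\<lambda>\<omega> n. W (dyadic n) \<omega>) -` {p. \<forall>n\<in>J. p n \<in> A n} \<inter> space M = ?D -` ?H \<inter> space M"
    using sum_D measurable_space[OF D] by auto
  also have "emeasure M \<dots> = emeasure (distr M (Pi\<^sub>M {..<K} (\<lambda>_. borel)) ?D) ?H"
    by (rule emeasure_distr[symmetric, OF D H])
  finally show ?thesis
    unfolding distr_increments[OF ts K(1)] by (simp add: ts_def)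
qed

end

text \<open>Finitely many dyadic times lie on a common grid, where the path is the partial sum of its
  independent increments.\<close>

lemma dyadic_grid:
  assumes "finite J"
  obtains m K and k :: "nat \<Rightarrow> nat" where "0 < K" "\<And>n. n \<in> J \<Longrightarrow> k n \<le> K"
    "\<And>n. n \<in> J \<Longrightarrow> dyadic n = real (k n) / 2 ^ m"
proof -
  define m where "m = Max (insert 0 ((\<lambda>n. snd (prod_decode n)) ` J))"
  define k where "k n = fst (prod_decode n) * 2 ^ (m - snd (prod_decode n))" for n
  have "snd (prod_decode n) \<le> m" if "n \<in> J" for n
    unfolding m_def using assms that by (intro Max_ge) auto
  then have "(2::real) ^ (m - snd (prod_decode n)) = 2 ^ m / 2 ^ snd (prod_decode n)" if "n \<in> J" for n
    using that by (intro power_diff) auto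
  then have "dyadic n = real (k n) / 2 ^ m" if "n \<in> J" for n
    using that by (simp add: dyadic_def k_def)
  moreover have "k n \<le> Suc (\<Sum>n\<in>J. k n)" if "n \<in> J" for n
    using that assms member_le_sum[of n J k] by simp
  ultimately show ?thesis
    using that[of "Suc (\<Sum>n\<in>J. k n)" k m] by simp
qed

text \<open>Needed because the displacements \<open>B u\<close> are a priori different Brownian
  motions: equality of their laws is what makes a subtree a copy of the whole tree.\<close>

lemma brownian_dyadic_law_unique:
  assumes W: "brownian_motion M W" and W': "brownian_motion M' W'"
  shows "distr M borel (\<lambda>\<omega> n. W (dyadic n) \<omega>) = distr M' borel (\<lambda>\<omega> n. W' (dyadic n) \<omega>)"
    (is "?P = ?P'")
proof (rule measure_eqI_PiM_infinite[where I = UNIV and M = "\<lambda>_. borel"])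
  interpret W: brownian_motion M W by fact
  interpret W': brownian_motion M' W' by fact
  show "sets ?P = sets (Pi\<^sub>M UNIV (\<lambda>_. borel))" "sets ?P' = sets (Pi\<^sub>M UNIV (\<lambda>_. borel))"
    by (simp_all add: sets_PiM_equal_borel)
  show "finite_measure ?P"
    by (intro prob_space.finite_measure W.prob_space_distr W.measurable_dyadic_path)
  fix A :: "nat \<Rightarrow> real set" and J :: "nat set"
  assume J: "finite J" and A: "\<And>i. i \<in> J \<Longrightarrow> A i \<in> sets borel"
  have emb: "prod_emb UNIV (\<lambda>_. borel) J (Pi\<^sub>E J A) = {p. \<forall>n\<in>J. p n \<in> A n}"
    by (auto simp: prod_emb_def PiE_iff)
  obtain m K and k :: "nat \<Rightarrow> nat" where *: "0 < K" "\<And>n. n \<in> J \<Longrightarrow> k n \<le> K"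
      "\<And>n. n \<in> J \<Longrightarrow> dyadic n = real (k n) / 2 ^ m"
    using dyadic_grid[OF J] by metis
  show "emeasure ?P (prod_emb UNIV (\<lambda>_. borel) J (Pi\<^sub>E J A)) =
      emeasure ?P' (prod_emb UNIV (\<lambda>_. borel) J (Pi\<^sub>E J A))"
    unfolding emb
    by (rule trans[OF W.emeasure_dyadic_cylinder[OF * J A] W'.emeasure_dyadic_cylinder[OF * J A, symmetric]])
qed

section \<open>Passing from the process to its canonical data\<close>

context branching_brownian_motion
begin

lemma lifetime_tree_data: "lifetime u (tree_data_of L B \<omega>) = L u \<omega>"
  by (simp add: lifetime_def tree_data_of_def)

lemma displacement_tree_data:
  assumes "\<omega> \<in> space M" "0 \<le> r"
  shows "displacement u r (tree_data_of L B \<omega>) = B u r \<omega>"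
proof -
  have "(\<lambda>m. B u (real (nat \<lfloor>r * 2 ^ m\<rfloor>) / 2 ^ m) \<omega>) \<longlonglongrightarrow> B u r \<omega>"
    using continuous_on_tendsto_compose[OF brownian_motion.continuous_W[OF displacement_brownian assms(1)]
        floor_dyadic_tendsto[OF assms(2)]] assms by simp
  then show ?thesis
    unfolding displacement_def tree_data_of_def by (simp add: dyadic_encode limI)
qed

lemma birth_time_tree_data: "birth_time lifetime u (tree_data_of L B \<omega>) = birth_time L u \<omega>"
  by (simp add: birth_time_def lifetime_tree_data)

lemma alive_tree_data: "alive\<^sub>0 t (tree_data_of L B \<omega>) = alive L t \<omega>"
  by (simp add: alive_def lifetime_tree_data birth_time_tree_data)

text \<open>Restricted to living \<open>u\<close>, because the stored data determine a displacement
  only at nonnegative ages.\<close>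

lemma position_tree_data:
  assumes \<omega>: "\<omega> \<in> space M" and u: "u \<in> alive L t \<omega>"
  shows "position\<^sub>0 u t (tree_data_of L B \<omega>) = position L B u t \<omega>"
proof -
  have "0 \<le> t - birth_time L u \<omega>"
    using u by (simp add: alive_def)
  then show ?thesis
    using lifetime_pos[OF \<omega>] by (simp add: position_def lifetime_tree_data birth_time_tree_data
        displacement_tree_data[OF \<omega>] less_imp_le)
qed

lemma max_position_tree_data:
  assumes "\<omega> \<in> space M"
  shows "max\<^sub>0 t (tree_data_of L B \<omega>) = max_position L B t \<omega>"
  unfolding max_position_def alive_tree_data
  by (intro arg_cong[where f = Max] image_cong refl position_tree_data assms)

lemma pm_of_tree_data:
  assumes "\<omega> \<in> space M"
  shows "pm_of (alive\<^sub>0 t (tree_data_of L B \<omega>)) (\<lambda>u. position\<^sub>0 u t (tree_data_of L B \<omega>) - c) =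
    pm_of (alive L t \<omega>) (\<lambda>u. position L B u t \<omega> - c)"
  unfolding alive_tree_data by (intro pm_of_cong) (simp add: position_tree_data assms)

text \<open>Before the root dies it is alone. At the instant of its death both children are alive,
  since lifetimes are positive, so the infimum is attained there.\<close>

lemma first_branching_time_eq:
  assumes "\<omega> \<in> space M"
  shows "first_branching_time L \<omega> = L [] \<omega>"
proof -
  let ?y = "tree_data_of L B \<omega>"
  have L: "0 < lifetime u (subtree b ?y)" "0 < lifetime u ?y" for u b
    using lifetime_pos[OF assms] by (simp_all add: lifetime_subtree lifetime_tree_data)
  have before: "alive L t \<omega> = {[]}" if "0 \<le> t" "t < L [] \<omega>" for t
    using alive_before_branching[of ?y t] that L by (simp add: alive_tree_data lifetime_tree_data less_imp_le)
  have "alive\<^sub>0 0 (subtree b ?y) = {[]}" for b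
    using L by (intro alive_before_branching) (simp_all add: less_imp_le)
  then have at: "alive L (L [] \<omega>) \<omega> = {[False], [True]}"
    using alive_after_branching[of ?y "L [] \<omega>"] unfolding alive_tree_data lifetime_tree_data by auto
  show ?thesis
    unfolding first_branching_time_def
  proof (rule cInf_eq_minimum)
    show "L [] \<omega> \<in> {t. 0 \<le> t \<and> 2 \<le> card (alive L t \<omega>)}"
      using lifetime_pos[OF assms, of "[]"] by (simp add: at)
    show "L [] \<omega> \<le> t" if "t \<in> {t. 0 \<le> t \<and> 2 \<le> card (alive L t \<omega>)}" for t
      using before[of t] that by (cases "t < L [] \<omega>") auto
  qed
qed

lemma measurable_tree_data: "tree_data_of L B \<in> M \<rightarrow>\<^sub>M borel"
proof -
  have "(\<lambda>\<omega>. tree_data_of L B \<omega> i n) \<in> borel_measurable M" for i n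
    using brownian_motion.measurable_W[OF displacement_brownian dyadic_nonneg]
      distributed_measurable[OF lifetime_exponential]
    by (cases i) (auto simp: tree_data_of_def)
  then show ?thesis
    by (intro measurable_coordinatewise_then_product[of "tree_data_of L B"]
        measurable_coordinatewise_then_product[of "\<lambda>\<omega>. tree_data_of L B \<omega> i" for i])
qed

lemma indep_tree_data: "indep_vars (\<lambda>_. borel) (\<lambda>i \<omega>. tree_data_of L B \<omega> i) UNIV"
  unfolding indep_vars_def
proof (intro conjI ballI)
  show "random_variable borel (\<lambda>\<omega>. tree_data_of L B \<omega> i)" for i
    using measurable_tree_data by (rule measurable_product_then_coordinatewise)
  show "indep_sets (\<lambda>i. sigma_sets (space M)
      {(\<lambda>\<omega>. tree_data_of L B \<omega> i) -` A \<inter> space M |A. A \<in> sets borel}) UNIV"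
  proof (rule indep_sets_mono_sets[OF indep_displacements_lifetimes])
    fix i :: "bool list + bool list"
    \<comment> \<open>A measurable function of \<open>f\<close> generates a smaller sigma-algebra
      than \<open>f\<close>, so independence descends from whole paths and lifetimes to the stored
      sequences.\<close>
    have *: "sigma_sets (space M) {X -` A \<inter> space M |A. A \<in> sets borel} \<subseteq> sets (vimage_algebra (space M) f N)"
      if h: "h \<in> N \<rightarrow>\<^sub>M borel" and f: "f \<in> space M \<rightarrow> space N"
        and X: "\<And>\<omega>. \<omega> \<in> space M \<Longrightarrow> X \<omega> = h (f \<omega>)"
      for X :: "'w \<Rightarrow> nat \<Rightarrow> real" and f :: "'w \<Rightarrow> 'c" and h N
    proof -
      let ?V = "vimage_algebra (space M) f N"
      have "h \<circ> f \<in> ?V \<rightarrow>\<^sub>M borel"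
        by (rule measurable_comp[OF measurable_vimage_algebra1[OF f] h])
      then have "(h \<circ> f) -` A \<inter> space M \<in> sets ?V" if "A \<in> sets borel" for A
        using measurable_sets[OF _ that, of "h \<circ> f" ?V] by (simp add: space_vimage_algebra)
      moreover have "X -` A \<inter> space M = (h \<circ> f) -` A \<inter> space M" for A
        using X by auto
      ultimately have "{X -` A \<inter> space M |A. A \<in> sets borel} \<subseteq> sets ?V"
        by auto
      then show ?thesis
        using sets.sigma_sets_subset[of _ ?V] by (simp add: space_vimage_algebra)
    qed
    show "sigma_sets (space M) {(\<lambda>\<omega>. tree_data_of L B \<omega> i) -` A \<inter> space M |A. A \<in> sets borel} \<subseteq>
      case_sum
        (\<lambda>u. sets (vimage_algebra (space M) (\<lambda>\<omega>. \<lambda>r\<in>{0..}. B u r \<omega>) (Pi\<^sub>M {0..} (\<lambda>_. borel))))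
        (\<lambda>u. sets (vimage_algebra (space M) (L u) borel)) i"
    proof (cases i)
      case (Inl u)
      have "(\<lambda>p n. p (dyadic n)) \<in> Pi\<^sub>M {0..} (\<lambda>_. borel :: real measure) \<rightarrow>\<^sub>M borel"
        by (intro measurable_coordinatewise_then_product measurable_component_singleton)
           (simp add: dyadic_nonneg)
      then show ?thesis
        unfolding Inl sum.case by (rule *) (simp_all add: tree_data_of_def dyadic_nonneg space_PiM)
    next
      case (Inr u)
      have "(\<lambda>x n. x) \<in> (borel :: real measure) \<rightarrow>\<^sub>M (borel :: (nat \<Rightarrow> real) measure)"
        by (intro measurable_coordinatewise_then_product) simp
      then show ?thesis
        unfolding Inr sum.case by (rule *) (simp_all add: tree_data_of_def)
    qed
  qed
qed

end

section \<open>Independence of the root and its two subtrees\<close>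

definition tree_law ::
    "'w measure \<Rightarrow> (bool list \<Rightarrow> 'w \<Rightarrow> real) \<Rightarrow> (bool list \<Rightarrow> real \<Rightarrow> 'w \<Rightarrow> real) \<Rightarrow> tree_data measure" where
  "tree_law M L B = distr M borel (tree_data_of L B)"

lemma sets_tree_law [measurable_cong, simp]: "sets (tree_law M L B) = sets borel"
  by (simp add: tree_law_def)

lemma space_tree_law [simp]: "space (tree_law M L B) = UNIV"
  by (simp add: tree_law_def)

context branching_brownian_motion
begin

lemma prob_space_tree_law: "prob_space (tree_law M L B)"
  unfolding tree_law_def by (rule prob_space_distr[OF measurable_tree_data])

lemma measurable_lifetime_M [measurable]: "L u \<in> borel_measurable M"
  using distributed_measurable[OF lifetime_exponential] by simp

lemma displacement_distributed:
  assumes "0 < r"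
  shows "distributed M lborel (B u r) (normal_density 0 (sqrt r))"
proof -
  have "distributed M lborel (\<lambda>\<omega>. B u r \<omega> - B u 0 \<omega>) (normal_density 0 (sqrt (r - 0)))"
    using assms by (intro brownian_motion.normal_increments[OF displacement_brownian]) auto
  moreover have "B u r \<omega> - B u 0 \<omega> = B u r \<omega>" if "\<omega> \<in> space M" for \<omega>
    using brownian_motion.W_0[OF displacement_brownian that] by simp
  ultimately show ?thesis
    unfolding distributed_def by (simp cong: distr_cong measurable_cong)
qed

lemma measurable_tree_component: "(\<lambda>\<omega>. tree_data_of L B \<omega> i) \<in> M \<rightarrow>\<^sub>M borel"
  using measurable_tree_data by (rule measurable_product_then_coordinatewise)

lemma distr_tree_component:
  "distr M borel (\<lambda>\<omega>. tree_data_of L B \<omega> (map_sum (Cons b) (Cons b) i)) =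
    distr M borel (\<lambda>\<omega>. tree_data_of L B \<omega> i)"
proof (cases i)
  case (Inl u)
  then show ?thesis
    using brownian_dyadic_law_unique[OF displacement_brownian displacement_brownian, of "b # u" u]
    by (simp add: tree_data_of_def)
next
  case (Inr u)
  have m: "(\<lambda>x n. x) \<in> (borel :: real measure) \<rightarrow>\<^sub>M (borel :: (nat \<Rightarrow> real) measure)"
    by (intro measurable_coordinatewise_then_product) simp
  have "distr M borel (\<lambda>\<omega> (n::nat). L v \<omega>) = distr (density lborel (exponential_density 1)) borel (\<lambda>x n. x)" for v
  proof -
    have "distr M borel (\<lambda>\<omega> (n::nat). L v \<omega>) = distr (distr M lborel (L v)) borel (\<lambda>x n. x)"
      using m by (subst distr_distr) (simp_all add: comp_def)
    then show ?thesis
      by (simp add: distributed_distr_eq_density[OF lifetime_exponential])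
  qed
  then show ?thesis
    using Inr by (simp add: tree_data_of_def)
qed

lemma tree_law_PiM:
  "distr M (Pi\<^sub>M UNIV (\<lambda>_. borel)) (tree_data_of L B) =
    Pi\<^sub>M UNIV (\<lambda>i. distr M borel (\<lambda>\<omega>. tree_data_of L B \<omega> i))"
  using indep_vars_iff_distr_eq_PiM[where I = UNIV and M' = "\<lambda>_. borel" and X = "\<lambda>i \<omega>. tree_data_of L B \<omega> i"]
    indep_tree_data measurable_tree_component by (simp add: restrict_UNIV)

text \<open>The law of the data is a product measure. Passing to a subtree reindexes it along an
  injection, and corresponding coordinates have equal laws, so the product is unchanged.\<close>

lemma distr_subtree: "distr M borel (\<lambda>\<omega>. subtree b (tree_data_of L B \<omega>)) = tree_law M L B"
proof -
  let ?Y = "tree_data_of L B" and ?P = "Pi\<^sub>M UNIV (\<lambda>_. borel) :: tree_data measure"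
  let ?f = "map_sum (Cons b) (Cons b) :: bool list + bool list \<Rightarrow> bool list + bool list"
  let ?\<nu> = "\<lambda>i. distr M borel (\<lambda>\<omega>. ?Y \<omega> i)"
  have P: "sets ?P = sets borel"
    by (rule sets_PiM_equal_borel)
  have Y: "?Y \<in> M \<rightarrow>\<^sub>M ?P"
    using measurable_tree_data by (simp cong: measurable_cong_sets add: measurable_cong_sets[OF refl P])
  have sub: "subtree b \<in> ?P \<rightarrow>\<^sub>M ?P"
    using measurable_subtree[OF measurable_ident_sets[OF refl], of b]
    by (simp add: measurable_cong_sets[OF P P])
  have inj: "inj ?f"
    by (auto simp: inj_def map_sum_def split: sum.splits)
  have "distr M borel (\<lambda>\<omega>. subtree b (?Y \<omega>)) = distr M ?P (subtree b \<circ> ?Y)"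
    by (rule distr_cong) (simp_all add: P)
  also have "\<dots> = distr (Pi\<^sub>M UNIV ?\<nu>) ?P (subtree b)"
    unfolding tree_law_PiM[symmetric] by (rule distr_distr[symmetric, OF sub Y])
  also have "\<dots> = distr (Pi\<^sub>M UNIV ?\<nu>) (Pi\<^sub>M UNIV (\<lambda>i. ?\<nu> (?f i))) (\<lambda>\<omega>. \<lambda>n\<in>UNIV. \<omega> (?f n))"
    by (intro distr_cong refl sets_PiM_cong) (auto simp: subtree_def fun_eq_iff)
  also have "\<dots> = Pi\<^sub>M UNIV (\<lambda>i. ?\<nu> (?f i))"
    by (rule distr_PiM_reindex[OF _ inj]) (auto intro!: prob_space_distr measurable_tree_component)
  also have "\<dots> = Pi\<^sub>M UNIV ?\<nu>"
    by (simp only: distr_tree_component)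
  also have "\<dots> = distr M borel ?Y"
    unfolding tree_law_PiM[symmetric] by (rule distr_cong) (simp_all add: P)
  finally show ?thesis
    by (simp add: tree_law_def)
qed

text \<open>Independence of two disjoint blocks of coordinates, in a form that applies to
  \<open>f'\<close> and \<open>g'\<close> written in terms of the full data as long as they read
  only their own block.\<close>

lemma distr_Pair_restrict:
  assumes AB: "A \<inter> C = {}" and f: "f \<in> Pi\<^sub>M A (\<lambda>_. borel) \<rightarrow>\<^sub>M N1" and g: "g \<in> Pi\<^sub>M C (\<lambda>_. borel) \<rightarrow>\<^sub>M N2"
    and f': "\<And>\<omega>. \<omega> \<in> space M \<Longrightarrow> f' \<omega> = f (restrict (tree_data_of L B \<omega>) A)"
    and g': "\<And>\<omega>. \<omega> \<in> space M \<Longrightarrow> g' \<omega> = g (restrict (tree_data_of L B \<omega>) C)"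
  shows "distr M (N1 \<Otimes>\<^sub>M N2) (\<lambda>\<omega>. (f' \<omega>, g' \<omega>)) = distr M N1 f' \<Otimes>\<^sub>M distr M N2 g'"
proof -
  let ?Y = "tree_data_of L B"
  let ?X = "\<lambda>A \<omega>. restrict (?Y \<omega>) A" and ?P = "\<lambda>A. Pi\<^sub>M A (\<lambda>_. borel) :: tree_data measure"
  have ind: "indep_var (?P A) (?X A) (?P C) (?X C)"
    using indep_var_restrict[OF indep_tree_data AB] by simp
  note X = indep_var_rv1[OF ind] indep_var_rv2[OF ind]
  have fX: "f \<circ> ?X A \<in> M \<rightarrow>\<^sub>M N1" and gX: "g \<circ> ?X C \<in> M \<rightarrow>\<^sub>M N2"
    by (rule measurable_comp[OF X(1) f], rule measurable_comp[OF X(2) g])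
  have *: "distr M N1 f' = distr (distr M (?P A) (?X A)) N1 f" "distr M N2 g' = distr (distr M (?P C) (?X C)) N2 g"
    using f' g' by (subst distr_distr; (intro f g X)?; auto intro!: distr_cong)+
  have "distr M N1 f' \<Otimes>\<^sub>M distr M N2 g' =
      distr (distr M (?P A) (?X A) \<Otimes>\<^sub>M distr M (?P C) (?X C)) (N1 \<Otimes>\<^sub>M N2) (\<lambda>(x, y). (f x, g y))"
    unfolding *
  proof (rule pair_measure_distr)
    interpret C: prob_space "distr M N2 (g \<circ> ?X C)"
      by (rule prob_space_distr[OF gX])
    show "sigma_finite_measure (distr (distr M (?P C) (?X C)) N2 g)"
      unfolding distr_distr[OF g X(2)] by unfold_locales
  qed (use f g in auto)
  also have "distr M (?P A) (?X A) \<Otimes>\<^sub>M distr M (?P C) (?X C) = distr M (?P A \<Otimes>\<^sub>M ?P C) (\<lambda>\<omega>. (?X A \<omega>, ?X C \<omega>))"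
    using ind by (simp add: indep_var_distribution_eq)
  also have "distr \<dots> (N1 \<Otimes>\<^sub>M N2) (\<lambda>(x, y). (f x, g y)) =
      distr M (N1 \<Otimes>\<^sub>M N2) ((\<lambda>(x, y). (f x, g y)) \<circ> (\<lambda>\<omega>. (?X A \<omega>, ?X C \<omega>)))"
  proof (rule distr_distr)
    show "(\<lambda>(x, y). (f x, g y)) \<in> ?P A \<Otimes>\<^sub>M ?P C \<rightarrow>\<^sub>M N1 \<Otimes>\<^sub>M N2"
      unfolding case_prod_beta'
      by (intro measurable_Pair measurable_compose[OF measurable_fst f] measurable_compose[OF measurable_snd g])
  qed (intro measurable_Pair X)
  also have "\<dots> = distr M (N1 \<Otimes>\<^sub>M N2) (\<lambda>\<omega>. (f' \<omega>, g' \<omega>))"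
    using f' g' by (intro distr_cong) auto
  finally show ?thesis ..
qed

text \<open>The branching property at the root. The lifetime of the root, its path and the two
  subtrees occupy disjoint blocks of coordinates, and independence is split off one block at a
  time.\<close>

lemma joint_law:
  "distr M (borel \<Otimes>\<^sub>M (borel \<Otimes>\<^sub>M (borel \<Otimes>\<^sub>M borel)))
     (\<lambda>\<omega>. (L [] \<omega>, tree_data_of L B \<omega> (Inl []), subtree False (tree_data_of L B \<omega>), subtree True (tree_data_of L B \<omega>))) =
   density lborel (exponential_density 1) \<Otimes>\<^sub>M (distr M borel (\<lambda>\<omega>. tree_data_of L B \<omega> (Inl [])) \<Otimes>\<^sub>M
     (tree_law M L B \<Otimes>\<^sub>M tree_law M L B))"
proof -
  let ?Y = "tree_data_of L B"
  let ?S = "\<lambda>b. range (map_sum (Cons b) (Cons b)) :: (bool list + bool list) set"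
  let ?C = "insert (Inl []) (?S False \<union> ?S True)"
  have sub: "(\<lambda>p. subtree b p) \<in> Pi\<^sub>M A (\<lambda>_. borel) \<rightarrow>\<^sub>M borel" if "?S b \<subseteq> A" for b A
    unfolding subtree_def[abs_def]
  proof (rule measurable_coordinatewise_then_product)
    show "(\<lambda>p. p (map_sum (Cons b) (Cons b) i)) \<in> Pi\<^sub>M A (\<lambda>_. borel) \<rightarrow>\<^sub>M borel" for i
      using that by (intro measurable_component_singleton) auto
  qed
  have sub_restrict: "subtree b (restrict y A) = subtree b y" if "?S b \<subseteq> A" for b A y
    using that by (auto simp: subtree_def fun_eq_iff)
  have disj: "?S False \<inter> ?S True = {}" "{Inl []} \<inter> (?S False \<union> ?S True) = {}" "{Inr []} \<inter> ?C = {}"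
    by (auto simp: map_sum_def split: sum.splits)
  have "distr M (borel \<Otimes>\<^sub>M borel) (\<lambda>\<omega>. (subtree False (?Y \<omega>), subtree True (?Y \<omega>))) =
      tree_law M L B \<Otimes>\<^sub>M tree_law M L B"
    using distr_Pair_restrict[OF disj(1) sub[OF subset_refl] sub[OF subset_refl] sub_restrict[symmetric] sub_restrict[symmetric]]
    by (simp add: distr_subtree)
  moreover have "distr M (borel \<Otimes>\<^sub>M (borel \<Otimes>\<^sub>M borel)) (\<lambda>\<omega>. (?Y \<omega> (Inl []), (subtree False (?Y \<omega>), subtree True (?Y \<omega>)))) =
      distr M borel (\<lambda>\<omega>. ?Y \<omega> (Inl [])) \<Otimes>\<^sub>M distr M (borel \<Otimes>\<^sub>M borel) (\<lambda>\<omega>. (subtree False (?Y \<omega>), subtree True (?Y \<omega>)))"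
  proof (rule distr_Pair_restrict[OF disj(2), of "\<lambda>p. p (Inl [])" _ "\<lambda>p. (subtree False p, subtree True p)"])
    show "(\<lambda>p. p (Inl [])) \<in> Pi\<^sub>M {Inl []} (\<lambda>_. borel :: (nat \<Rightarrow> real) measure) \<rightarrow>\<^sub>M borel"
      by (rule measurable_component_singleton) simp
    show "(\<lambda>p. (subtree False p, subtree True p)) \<in> Pi\<^sub>M (?S False \<union> ?S True) (\<lambda>_. borel) \<rightarrow>\<^sub>M borel \<Otimes>\<^sub>M borel"
      by (intro measurable_Pair sub Un_upper1 Un_upper2)
    show "(subtree False (?Y \<omega>), subtree True (?Y \<omega>)) =
      (subtree False (restrict (?Y \<omega>) (?S False \<union> ?S True)), subtree True (restrict (?Y \<omega>) (?S False \<union> ?S True)))" for \<omega>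
      by (simp add: sub_restrict)
  qed simp
  moreover have "distr M (borel \<Otimes>\<^sub>M (borel \<Otimes>\<^sub>M (borel \<Otimes>\<^sub>M borel)))
      (\<lambda>\<omega>. (L [] \<omega>, (?Y \<omega> (Inl []), (subtree False (?Y \<omega>), subtree True (?Y \<omega>))))) =
    distr M borel (L []) \<Otimes>\<^sub>M distr M (borel \<Otimes>\<^sub>M (borel \<Otimes>\<^sub>M borel)) (\<lambda>\<omega>. (?Y \<omega> (Inl []), (subtree False (?Y \<omega>), subtree True (?Y \<omega>))))"
  proof (rule distr_Pair_restrict[OF disj(3), of "\<lambda>p. p (Inr []) 0" _ "\<lambda>p. (p (Inl []), (subtree False p, subtree True p))"])
    have "(\<lambda>p. p (Inr [])) \<in> Pi\<^sub>M {Inr []} (\<lambda>_. borel :: (nat \<Rightarrow> real) measure) \<rightarrow>\<^sub>M borel"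
      by (rule measurable_component_singleton) simp
    then show "(\<lambda>p. p (Inr []) 0) \<in> Pi\<^sub>M {Inr []} (\<lambda>_. borel :: (nat \<Rightarrow> real) measure) \<rightarrow>\<^sub>M borel"
      by (rule measurable_product_then_coordinatewise)
    have "?S False \<subseteq> ?C" "?S True \<subseteq> ?C"
      by auto
    note S = this
    show "(\<lambda>p. (p (Inl []), (subtree False p, subtree True p))) \<in> Pi\<^sub>M ?C (\<lambda>_. borel) \<rightarrow>\<^sub>M borel \<Otimes>\<^sub>M (borel \<Otimes>\<^sub>M borel)"
      by (intro measurable_Pair sub S measurable_component_singleton insertI1)
    fix \<omega>
    show "(?Y \<omega> (Inl []), (subtree False (?Y \<omega>), subtree True (?Y \<omega>))) =
       (restrict (?Y \<omega>) ?C (Inl []), (subtree False (restrict (?Y \<omega>) ?C), subtree True (restrict (?Y \<omega>) ?C)))"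
      by (simp add: sub_restrict[OF S(1)] sub_restrict[OF S(2)])
  qed (simp add: tree_data_of_def)
  moreover have "distr M borel (L []) = density lborel (exponential_density 1)"
    using distributed_distr_eq_density[OF lifetime_exponential, of "[]"] by (simp cong: distr_cong)
  ultimately show ?thesis
    by simp
qed

end

section \<open>Non-explosion\<close>

lemma nn_integral_exp_exponential:
  "(\<integral>\<^sup>+x. ennreal (exp (- 2 * x)) \<partial>density lborel (exponential_density 1)) = ennreal (1 / 3)"
proof -
  have 3: "(\<integral>\<^sup>+x. ennreal (exponential_density 3 x) \<partial>lborel) = 1"
    using prob_space.emeasure_space_1[OF prob_space_exponential_density[of 3]]
    by (simp add: emeasure_density)
  have "(\<integral>\<^sup>+x. ennreal (exp (- 2 * x)) \<partial>density lborel (exponential_density 1)) =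
      (\<integral>\<^sup>+x. ennreal (exponential_density 1 x) * ennreal (exp (- 2 * x)) \<partial>lborel)"
    by (subst nn_integral_density) auto
  also have "\<dots> = (\<integral>\<^sup>+x. ennreal (1 / 3) * ennreal (exponential_density 3 x) \<partial>lborel)"
    by (intro nn_integral_cong)
       (auto simp: exponential_density_def ennreal_mult[symmetric] exp_add[symmetric] simp del: ennreal_1)
  also have "\<dots> = ennreal (1 / 3)"
    by (subst nn_integral_cmult) (simp_all add: 3)
  finally show ?thesis .
qed

context branching_brownian_motion
begin

lemma distr_lifetime: "distr M borel (L u) = density lborel (exponential_density 1)"
  using distributed_distr_eq_density[OF lifetime_exponential, of u] by (simp cong: distr_cong)

lemma measurable_birth_time_M [measurable]: "birth_time L u \<in> borel_measurable M"
  unfolding birth_time_def[abs_def] by measurable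

text \<open>A Chernoff bound with exponent 2. The Laplace transform of the unit exponential law at 2
  is 1/3, which is small enough to beat the \<open>2 ^ k\<close> labels of depth
  \<open>k\<close>.\<close>

lemma prob_birth_time_le:
  "emeasure M {\<omega> \<in> space M. birth_time L u \<omega> \<le> T} \<le> ennreal (exp (2 * T) * (1 / 3) ^ length u)"
proof -
  let ?Y = "tree_data_of L B"
  let ?f = "\<lambda>i. Inr (take i u) :: bool list + bool list"
  let ?X = "\<lambda>j \<omega>. ennreal (exp (- 2 * ?Y \<omega> j 0))"
  have inj: "inj_on ?f {..<length u}"
    by (auto simp: inj_on_def take_eq_Nil dest!: arg_cong[where f = length])
  have ind: "indep_vars (\<lambda>_. borel) ?X (?f ` {..<length u})"
    using indep_vars_subset[OF indep_tree_data, of "?f ` {..<length u}"]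
  proof (intro indep_vars_compose2[where Y = "\<lambda>_ p. ennreal (exp (- 2 * p 0))"])
    have "(\<lambda>p::nat \<Rightarrow> real. p 0) \<in> borel_measurable borel"
      by (rule measurable_product_coordinates)
    then show "(\<lambda>p::nat \<Rightarrow> real. ennreal (exp (- 2 * p 0))) \<in> borel_measurable borel"
      by measurable
  qed simp
  have "emeasure M {\<omega> \<in> space M. birth_time L u \<omega> \<le> T} =
      (\<integral>\<^sup>+\<omega>. indicator {\<omega> \<in> space M. birth_time L u \<omega> \<le> T} \<omega> \<partial>M)"
    by (rule nn_integral_indicator[symmetric]) measurable
  also have "\<dots> \<le> (\<integral>\<^sup>+\<omega>. ennreal (exp (2 * T)) * (\<Prod>j\<in>?f ` {..<length u}. ?X j \<omega>) \<partial>M)"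
  proof (rule nn_integral_mono)
    fix \<omega>
    have "(\<Prod>j\<in>?f ` {..<length u}. ?X j \<omega>) = (\<Prod>i<length u. ennreal (exp (- 2 * L (take i u) \<omega>)))"
      by (subst prod.reindex[OF inj]) (simp add: tree_data_of_def)
    also have "\<dots> = ennreal (exp (- 2 * birth_time L u \<omega>))"
      by (simp add: prod_ennreal birth_time_def exp_sum[symmetric] sum_negf[symmetric] sum_distrib_left)
    finally have "ennreal (exp (2 * T)) * (\<Prod>j\<in>?f ` {..<length u}. ?X j \<omega>) =
        ennreal (exp (2 * (T - birth_time L u \<omega>)))"
      by (simp add: ennreal_mult[symmetric] exp_add[symmetric] algebra_simps)
    then show "indicator {\<omega> \<in> space M. birth_time L u \<omega> \<le> T} \<omega> \<le>
        ennreal (exp (2 * T)) * (\<Prod>j\<in>?f ` {..<length u}. ?X j \<omega>)"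
      by (auto simp: indicator_def ennreal_1[symmetric] simp del: ennreal_1 intro!: ennreal_leI)
  qed
  also have "\<dots> = ennreal (exp (2 * T)) * (\<integral>\<^sup>+\<omega>. (\<Prod>j\<in>?f ` {..<length u}. ?X j \<omega>) \<partial>M)"
    using ind by (intro nn_integral_cmult borel_measurable_prod_ennreal) (auto simp: indep_vars_def)
  also have "(\<integral>\<^sup>+\<omega>. (\<Prod>j\<in>?f ` {..<length u}. ?X j \<omega>) \<partial>M) = (\<Prod>j\<in>?f ` {..<length u}. \<integral>\<^sup>+\<omega>. ?X j \<omega> \<partial>M)"
    by (intro indep_vars_nn_integral ind) auto
  also have "\<dots> = (\<Prod>i<length u. \<integral>\<^sup>+x. ennreal (exp (- 2 * x)) \<partial>distr M borel (L (take i u)))"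
    by (subst prod.reindex[OF inj]) (simp add: tree_data_of_def nn_integral_distr)
  also have "\<dots> = ennreal ((1 / 3) ^ length u)"
    by (simp only: distr_lifetime nn_integral_exp_exponential prod_constant card_lessThan ennreal_power zero_le_divide_1_iff zero_le_numeral)
  finally show ?thesis
    by (simp add: ennreal_mult)
qed

text \<open>A union bound over one generation leaves \<open>(2 / 3) ^ k\<close>, which is summable.
  By Borel-Cantelli, almost surely all sufficiently deep generations are still unborn at time
  \<open>T\<close>.\<close>

lemma AE_finite_born: "AE \<omega> in M. finite {u. birth_time L u \<omega> \<le> T}"
proof -
  define A where "A k = {\<omega> \<in> space M. \<exists>u\<in>{u. length u = k}. birth_time L u \<omega> \<le> T}" for k
  have fin: "finite {u::bool list. length u = k}" and card: "card {u::bool list. length u = k} = 2 ^ k" for k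
    using finite_lists_length_eq[of "UNIV :: bool set" k] card_lists_length_eq[of "UNIV :: bool set" k]
    by (simp_all add: card_UNIV_bool)
  have A [measurable]: "A k \<in> sets M" for k
    unfolding A_def by measurable
  have "emeasure M (A k) \<le> ennreal (exp (2 * T) * (2 / 3) ^ k)" for k
  proof -
    have "A k = (\<Union>u\<in>{u. length u = k}. {\<omega> \<in> space M. birth_time L u \<omega> \<le> T})"
      by (auto simp: A_def)
    then have "emeasure M (A k) \<le> (\<Sum>u | length u = k. emeasure M {\<omega> \<in> space M. birth_time L u \<omega> \<le> T})"
      using fin by (auto intro!: emeasure_subadditive_finite)
    also have "\<dots> \<le> (\<Sum>u :: bool list | length u = k. ennreal (exp (2 * T) * (1 / 3) ^ k))"
      using prob_birth_time_le[of _ T] by (intro sum_mono) auto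
    also have "\<dots> = ennreal (exp (2 * T) * (2 / 3) ^ k)"
      by (simp add: card ennreal_of_nat_eq_real_of_nat ennreal_mult[symmetric] power_divide)
    finally show ?thesis .
  qed
  then have "measure M (A k) \<le> exp (2 * T) * (2 / 3) ^ k" for k
    by (simp add: measure_def enn2real_leI)
  moreover have "summable (\<lambda>k. exp (2 * T) * (2 / 3 :: real) ^ k)"
    by (intro summable_mult summable_geometric) simp
  ultimately have "summable (\<lambda>k. measure M (A k))"
    by (intro summable_comparison_test'[where N = 0 and f = "\<lambda>k. measure M (A k)"
          and g = "\<lambda>k. exp (2 * T) * (2 / 3) ^ k"]) auto
  then have "AE \<omega> in M. \<forall>\<^sub>F k in sequentially. \<omega> \<in> space M - A k"
    by (intro borel_cantelli_AE1) (auto simp: emeasure_eq_measure)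
  then show ?thesis
  proof eventually_elim
    case (elim \<omega>)
    then obtain n where n: "\<And>k. n \<le> k \<Longrightarrow> \<omega> \<in> space M - A k"
      by (auto simp: eventually_sequentially)
    have "length u < n" if "birth_time L u \<omega> \<le> T" for u
      using n[of "length u"] that unfolding A_def by (cases "length u < n") auto
    then have "{u. birth_time L u \<omega> \<le> T} \<subseteq> (\<Union>k<n. {u. length u = k})"
      by auto
    then show ?case
      using fin by (meson finite_UN finite_lessThan finite_subset)
  qed
qed

lemma AE_regular_tree_data: "AE \<omega> in M. regular (tree_data_of L B \<omega>)"
proof -
  have "AE \<omega> in M. \<forall>n::nat. finite {u. birth_time L u \<omega> \<le> real n}"
    by (simp add: AE_all_countable AE_finite_born)
  then show ?thesis
    using AE_space[of M]
  proof eventually_elim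
    case (elim \<omega>)
    then show ?case
      using lifetime_pos[OF elim(2)]
      by (simp add: regular_def lifetime_tree_data birth_time_tree_data displacement_tree_data
          brownian_motion.W_0[OF displacement_brownian])
  qed
qed

lemma AE_regular: "AE y in tree_law M L B. regular y"
  unfolding tree_law_def using AE_regular_tree_data
  by (subst AE_distr_iff[OF measurable_tree_data]) (auto simp flip: pred_def)

lemma AE_regular_subtree: "AE \<omega> in M. regular (subtree b (tree_data_of L B \<omega>))"
proof -
  have "AE y in distr M borel (\<lambda>\<omega>. subtree b (tree_data_of L B \<omega>)). regular y"
    unfolding distr_subtree by (rule AE_regular)
  then show ?thesis
    by (rule AE_distrD[rotated]) (intro measurable_subtree measurable_tree_data)
qed

end

section \<open>Law of the first branching event\<close>

lemma nn_integral_exp_tail: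
  fixes t :: real
  shows "(\<integral>\<^sup>+l. ennreal (exp (- l)) * indicator {t..} l \<partial>lborel) = ennreal (exp (- t))"
proof -
  have "(\<integral>\<^sup>+l. ennreal (exp (- l)) * indicator {t..} l \<partial>lborel) = ennreal (0 - (- exp (- t)))"
  proof (rule nn_integral_FTC_atLeast)
    show "((\<lambda>l. - exp (- l)) \<longlongrightarrow> (0::real)) at_top"
      by real_asymp
  qed (auto intro!: derivative_eq_intros)
  then show ?thesis
    by simp
qed

lemma measurable_normal_density [measurable (raw)]:
  assumes [measurable]: "f \<in> borel_measurable N" "g \<in> borel_measurable N" "h \<in> borel_measurable N"
  shows "(\<lambda>x. normal_density (f x) (g x) (h x)) \<in> borel_measurable N"
  unfolding normal_density_def by measurable

text \<open>A lifetime beyond \<open>t\<close> leaves no time to the children, hence the atom at 0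
  of mass \<open>exp (- t)\<close>; the rest is the substitution \<open>s = t - l\<close>.\<close>

lemma nn_integral_exponential_min:
  fixes H :: "real \<Rightarrow> ennreal"
  assumes t: "0 < t" and H [measurable]: "H \<in> borel_measurable borel"
  shows "(\<integral>\<^sup>+l. H (t - min t l) \<partial>density lborel (exponential_density 1)) =
    ennreal (exp (- t)) * H 0 + (\<integral>\<^sup>+s. indicator {0<..<t} s * ennreal (exp (- (t - s))) * H s \<partial>lborel)"
proof -
  let ?e = "\<lambda>l. ennreal (exp (- l))"
  have "(\<integral>\<^sup>+l. H (t - min t l) \<partial>density lborel (exponential_density 1)) =
      (\<integral>\<^sup>+l. ennreal (exponential_density 1 l) * H (t - min t l) \<partial>lborel)"
    by (rule nn_integral_density) measurable
  also have "\<dots> = (\<integral>\<^sup>+l. indicator {0<..<t} l * ?e l * H (t - l) + H 0 * (?e l * indicator {t..} l) \<partial>lborel)"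
    using AE_lborel_singleton[of 0]
    by (intro nn_integral_cong_AE, eventually_elim)
       (use t in \<open>auto simp: exponential_density_def indicator_def mult.commute\<close>)
  also have "\<dots> = (\<integral>\<^sup>+l. indicator {0<..<t} l * ?e l * H (t - l) \<partial>lborel) + H 0 * ?e t"
    by (subst nn_integral_add) (auto simp: nn_integral_cmult nn_integral_exp_tail)
  also have "(\<integral>\<^sup>+l. indicator {0<..<t} l * ?e l * H (t - l) \<partial>lborel) =
      (\<integral>\<^sup>+s. indicator {0<..<t} s * ?e (t - s) * H s \<partial>lborel)"
    by (subst nn_integral_real_affine[where c = "-1" and t = t])
       (auto intro!: nn_integral_cong simp: indicator_def)
  finally show ?thesis
    by (simp add: add.commute mult.commute)
qed

context branching_brownian_motion
begin

text \<open>The law of everything that is visible at time \<open>t\<close> from the first branching event, written in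
  terms of the time \<open>s\<close> that the two subtrees of the root have had to evolve.\<close>

lemma nn_integral_branching:
  fixes g :: "real \<times> real \<times> tree_data \<times> tree_data \<Rightarrow> ennreal"
  assumes t: "0 < t" and g [measurable]: "g \<in> borel_measurable (borel \<Otimes>\<^sub>M (borel \<Otimes>\<^sub>M (borel \<Otimes>\<^sub>M borel)))"
  defines "\<mu> \<equiv> tree_law M L B"
  defines "H s r \<equiv> \<integral>\<^sup>+x. ennreal (normal_density 0 (sqrt r) x) * (\<integral>\<^sup>+y1. (\<integral>\<^sup>+y2. g (s, x, y1, y2) \<partial>\<mu>) \<partial>\<mu>) \<partial>lborel"
  shows "(\<integral>\<^sup>+\<omega>. g (t - min t (L [] \<omega>), B [] (min t (L [] \<omega>)) \<omega>,
      subtree False (tree_data_of L B \<omega>), subtree True (tree_data_of L B \<omega>)) \<partial>M) =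
    ennreal (exp (- t)) * H 0 t + (\<integral>\<^sup>+s. indicator {0<..<t} s * ennreal (exp (- (t - s))) * H s (t - s) \<partial>lborel)"
proof -
  let ?Y = "tree_data_of L B"
  interpret \<mu>: prob_space \<mu>
    unfolding \<mu>_def by (rule prob_space_tree_law)
  have [measurable_cong]: "sets \<mu> = sets borel"
    by (simp add: \<mu>_def)
  define \<beta> where "\<beta> = distr M borel (\<lambda>\<omega>. ?Y \<omega> (Inl []))"
  interpret \<beta>: prob_space \<beta>
    unfolding \<beta>_def by (intro prob_space_distr measurable_tree_component)
  have [measurable_cong]: "sets \<beta> = sets borel"
    by (simp add: \<beta>_def)
  interpret \<lambda>: prob_space "density lborel (exponential_density 1)"
    by (rule prob_space_exponential_density) simp
  interpret MM: pair_prob_space \<mu> \<mu> ..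
  interpret BM: pair_prob_space \<beta> "\<mu> \<Otimes>\<^sub>M \<mu>" ..
  \<comment> \<open>The displacement of the root reads only the component \<open>Inl []\<close>, so
    it can be evaluated on the factor \<open>\<beta>\<close> of the product law.\<close>
  define path :: "real \<Rightarrow> (nat \<Rightarrow> real) \<Rightarrow> real" where "path r p = displacement [] r (\<lambda>_. p)" for r p
  have path: "displacement [] r y = path r (y (Inl []))" for r y
    by (simp add: path_def displacement_def)
  have [measurable]: "(\<lambda>x. path (f x) (h x)) \<in> borel_measurable N"
    if "f \<in> borel_measurable N" "h \<in> N \<rightarrow>\<^sub>M borel" for f h and N :: "'n measure"
    unfolding path_def
    by (intro measurable_displacement that measurable_coordinatewise_then_product[of "\<lambda>x _. h x"])
  have B: "B [] r \<omega> = path r (?Y \<omega> (Inl []))" if "\<omega> \<in> space M" "0 \<le> r" for r \<omega>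
    using displacement_tree_data[OF that, of "[]"] by (simp add: path)
  define G where "G s x = (\<integral>\<^sup>+y1. (\<integral>\<^sup>+y2. g (s, x, y1, y2) \<partial>\<mu>) \<partial>\<mu>)" for s x
  have G [measurable]: "(\<lambda>z. G (f z) (h z)) \<in> borel_measurable N"
    if [measurable]: "f \<in> borel_measurable N" "h \<in> borel_measurable N" for f h and N :: "'n measure"
    unfolding G_def by measurable
  let ?g = "\<lambda>(l, p, y1, y2). g (t - min t l, path (min t l) p, y1, y2)"
  have [measurable]: "?g \<in> borel_measurable (borel \<Otimes>\<^sub>M (borel \<Otimes>\<^sub>M (borel \<Otimes>\<^sub>M borel)))"
    by measurable
  note [measurable] = measurable_tree_data measurable_tree_component
  have "(\<integral>\<^sup>+\<omega>. g (t - min t (L [] \<omega>), B [] (min t (L [] \<omega>)) \<omega>, subtree False (?Y \<omega>), subtree True (?Y \<omega>)) \<partial>M) =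
      (\<integral>\<^sup>+\<omega>. ?g (L [] \<omega>, ?Y \<omega> (Inl []), subtree False (?Y \<omega>), subtree True (?Y \<omega>)) \<partial>M)"
    using t lifetime_pos by (intro nn_integral_cong) (simp add: B less_imp_le)
  also have "\<dots> = (\<integral>\<^sup>+z. ?g z \<partial>distr M (borel \<Otimes>\<^sub>M (borel \<Otimes>\<^sub>M (borel \<Otimes>\<^sub>M borel)))
     (\<lambda>\<omega>. (L [] \<omega>, ?Y \<omega> (Inl []), subtree False (?Y \<omega>), subtree True (?Y \<omega>))))"
    by (rule nn_integral_distr[symmetric]) measurable
  also have "\<dots> = (\<integral>\<^sup>+z. ?g z \<partial>(density lborel (exponential_density 1) \<Otimes>\<^sub>M (\<beta> \<Otimes>\<^sub>M (\<mu> \<Otimes>\<^sub>M \<mu>))))"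
    unfolding joint_law \<beta>_def \<mu>_def ..
  also have "\<dots> = (\<integral>\<^sup>+l. (\<integral>\<^sup>+p. G (t - min t l) (path (min t l) p) \<partial>\<beta>) \<partial>density lborel (exponential_density 1))"
    unfolding G_def
    by (simp add: BM.nn_integral_fst[symmetric] MM.nn_integral_fst[symmetric] \<mu>.nn_integral_fst[symmetric])
  also have "\<dots> = (\<integral>\<^sup>+l. H (t - min t l) (t - (t - min t l)) \<partial>density lborel (exponential_density 1))"
  proof (rule nn_integral_cong_AE)
    \<comment> \<open>A positive lifetime gives \<open>min t l > 0\<close>; only at positive times
      does the displacement have a normal density.\<close>
    have "AE l in density lborel (exponential_density 1). 0 < l"
      using AE_lborel_singleton[of 0] by (auto simp: AE_density exponential_density_def elim!: eventually_mono)
    then show "AE l in density lborel (exponential_density 1).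
        (\<integral>\<^sup>+p. G (t - min t l) (path (min t l) p) \<partial>\<beta>) = H (t - min t l) (t - (t - min t l))"
    proof eventually_elim
      case (elim l)
      define r where "r = min t l"
      have r: "0 < r"
        using elim t by (simp add: r_def)
      note D = displacement_distributed[OF r, of "[]"]
      have "(\<integral>\<^sup>+p. G (t - r) (path r p) \<partial>\<beta>) = (\<integral>\<^sup>+\<omega>. G (t - r) (path r (?Y \<omega> (Inl []))) \<partial>M)"
        unfolding \<beta>_def by (rule nn_integral_distr) measurable
      also have "\<dots> = (\<integral>\<^sup>+\<omega>. G (t - r) (B [] r \<omega>) \<partial>M)"
        using r by (intro nn_integral_cong) (simp add: B)
      also have "\<dots> = (\<integral>\<^sup>+x. ennreal (normal_density 0 (sqrt r) x) * G (t - r) x \<partial>lborel)"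
        by (rule distributed_nn_integral[OF D, symmetric]) measurable
      finally show ?case
        by (simp add: H_def G_def r_def)
    qed
  qed
  also have "\<dots> = ennreal (exp (- t)) * H 0 (t - 0) +
      (\<integral>\<^sup>+s. indicator {0<..<t} s * ennreal (exp (- (t - s))) * H s (t - s) \<partial>lborel)"
    by (rule nn_integral_exponential_min[OF t]) (unfold H_def G_def[symmetric], measurable)
  finally show ?thesis
    by simp
qed

end

section \<open>The speed of the maximum\<close>

text \<open>The transition semigroup of Brownian motion. The argument is \<open>z - x\<close>
  because a displacement \<open>x\<close> of the root lowers the level that the rest of the tree has
  to exceed. Values in \<open>ennreal\<close> make Fubini available without integrability
  conditions.\<close>

definition heat :: "real \<Rightarrow> (real \<Rightarrow> ennreal) \<Rightarrow> real \<Rightarrow> ennreal" where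
  "heat r f z = (\<integral>\<^sup>+x. ennreal (normal_density 0 (sqrt r) x) * f (z - x) \<partial>lborel)"

lemma measurable_heat [measurable (raw)]:
  assumes [measurable]: "(\<lambda>(x, w). f x w) \<in> borel_measurable (N \<Otimes>\<^sub>M borel)"
    "g \<in> borel_measurable N" "h \<in> borel_measurable N"
  shows "(\<lambda>x. heat (g x) (f x) (h x)) \<in> borel_measurable N"
  unfolding heat_def by measurable

lemma nn_integral_normal_density: "0 < \<sigma> \<Longrightarrow> (\<integral>\<^sup>+x. ennreal (normal_density \<mu> \<sigma> x) \<partial>lborel) = 1"
  using prob_space.emeasure_space_1[OF prob_space_normal_density[of \<sigma> \<mu>]] by (simp add: emeasure_density)

lemma heat_mono: "(\<And>w. f w \<le> g w) \<Longrightarrow> heat r f z \<le> heat r g z"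
  unfolding heat_def by (intro nn_integral_mono mult_left_mono) auto

lemma heat_cmult: "f \<in> borel_measurable borel \<Longrightarrow> heat r (\<lambda>w. a * f w) z = a * heat r f z"
  unfolding heat_def by (subst nn_integral_cmult[symmetric]) (auto intro!: nn_integral_cong simp: ac_simps)

lemma heat_const: "0 < r \<Longrightarrow> heat r (\<lambda>_. a) z = a"
  unfolding heat_def by (subst nn_integral_multc) (auto simp: nn_integral_normal_density)

lemma heat_add:
  "f \<in> borel_measurable borel \<Longrightarrow> g \<in> borel_measurable borel \<Longrightarrow>
    heat r (\<lambda>w. f w + g w) z = heat r f z + heat r g z"
  unfolding heat_def by (subst nn_integral_add[symmetric]) (auto simp: distrib_left)

lemma heat_nn_integral:
  assumes [measurable]: "(\<lambda>(s, w). f s w) \<in> borel_measurable (borel \<Otimes>\<^sub>M borel)"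
  shows "heat r (\<lambda>w. \<integral>\<^sup>+s. f s w \<partial>lborel) z = (\<integral>\<^sup>+s. heat r (f s) z \<partial>lborel)"
  unfolding heat_def
  by (subst lborel_pair.Fubini') (auto simp: nn_integral_cmult)

lemma heat_shift: "heat r (\<lambda>w. f (w - c)) z = heat r f (z - c)"
  unfolding heat_def by (simp add: algebra_simps)

lemma heat_semigroup:
  assumes r: "0 < r" "0 < q" and [measurable]: "f \<in> borel_measurable borel"
  shows "heat r (heat q f) z = heat (r + q) f z"
proof -
  let ?p = "\<lambda>r x. ennreal (normal_density 0 (sqrt r) x)"
  have "heat r (heat q f) z = (\<integral>\<^sup>+x. \<integral>\<^sup>+y. ?p r x * (?p q y * f (z - x - y)) \<partial>lborel \<partial>lborel)"
    unfolding heat_def by (intro nn_integral_cong nn_integral_cmult[symmetric]) measurable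
  also have "\<dots> = (\<integral>\<^sup>+x. \<integral>\<^sup>+w. ?p r x * (?p q (w - x) * f (z - w)) \<partial>lborel \<partial>lborel)"
  proof (rule nn_integral_cong)
    fix x :: real
    show "(\<integral>\<^sup>+y. ?p r x * (?p q y * f (z - x - y)) \<partial>lborel) =
        (\<integral>\<^sup>+w. ?p r x * (?p q (w - x) * f (z - w)) \<partial>lborel)"
      by (subst nn_integral_real_affine[where c = 1 and t = "- x"]) (auto simp: algebra_simps)
  qed
  also have "\<dots> = (\<integral>\<^sup>+w. \<integral>\<^sup>+x. ?p r x * (?p q (w - x) * f (z - w)) \<partial>lborel \<partial>lborel)"
    by (rule lborel_pair.Fubini') measurable
  also have "\<dots> = (\<integral>\<^sup>+w. (\<integral>\<^sup>+x. ennreal (normal_density 0 (sqrt q) (w - x) * normal_density 0 (sqrt r) x) \<partial>lborel) * f (z - w) \<partial>lborel)"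
    by (intro nn_integral_cong, subst nn_integral_multc[symmetric])
       (auto intro!: nn_integral_cong simp: ennreal_mult ac_simps)
  also have "\<dots> = heat (r + q) f z"
    using fun_cong[OF conv_normal_density_zero_mean[of "sqrt q" "sqrt r"]] r
    unfolding heat_def by (simp add: add.commute)
  finally show ?thesis .
qed

text \<open>The probability that a centred normal variable of variance \<open>r\<close> exceeds
  \<open>z\<close>, written through \<open>heat\<close> so that the semigroup property applies to
  it.\<close>

definition gauss_tail :: "real \<Rightarrow> real \<Rightarrow> ennreal" where
  "gauss_tail r = heat r (indicator {..<0})"

lemma measurable_gauss_tail [measurable (raw)]:
  assumes [measurable]: "g \<in> borel_measurable N" "h \<in> borel_measurable N"
  shows "(\<lambda>x. gauss_tail (g x) (h x)) \<in> borel_measurable N"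
  unfolding gauss_tail_def by measurable

lemma gauss_tail_eq: "gauss_tail r z = (\<integral>\<^sup>+x. ennreal (normal_density 0 (sqrt r) x) * indicator {z<..} x \<partial>lborel)"
  unfolding gauss_tail_def heat_def by (intro nn_integral_cong) (auto simp: indicator_def)

lemma gauss_tail_le_1: "0 < r \<Longrightarrow> gauss_tail r z \<le> 1"
  unfolding gauss_tail_def using heat_mono[of "indicator {..<0}" "\<lambda>_. 1" r z] heat_const[of r 1 z]
  by (auto simp: indicator_def)

lemma gauss_tail_antimono: "z \<le> z' \<Longrightarrow> gauss_tail r z' \<le> gauss_tail r z"
  unfolding gauss_tail_eq by (intro nn_integral_mono mult_left_mono) (auto simp: indicator_def)

lemma gauss_tail_0:
  assumes "0 < r"
  shows "gauss_tail r 0 = ennreal (1 / 2)"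
proof -
  let ?p = "\<lambda>x. ennreal (normal_density 0 (sqrt r) x)"
  have "1 = (\<integral>\<^sup>+x. ?p x \<partial>lborel)"
    using assms by (simp add: nn_integral_normal_density)
  also have "\<dots> = (\<integral>\<^sup>+x. ?p x * indicator {0<..} x + ?p x * indicator {..<0} x \<partial>lborel)"
    using AE_lborel_singleton[of 0] by (intro nn_integral_cong_AE) (auto simp: indicator_def elim!: eventually_mono)
  also have "\<dots> = gauss_tail r 0 + (\<integral>\<^sup>+x. ?p x * indicator {..<0} x \<partial>lborel)"
    unfolding gauss_tail_eq by (rule nn_integral_add) measurable
  also have "(\<integral>\<^sup>+x. ?p x * indicator {..<0} x \<partial>lborel) = gauss_tail r 0"
    unfolding gauss_tail_eq
    by (subst nn_integral_real_affine[where c = "-1" and t = 0])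
       (auto intro!: nn_integral_cong simp: indicator_def normal_density_def)
  finally have "2 * gauss_tail r 0 = 1"
    by (simp add: mult_2)
  moreover obtain a where a: "gauss_tail r 0 = ennreal a" "0 \<le> a"
    using gauss_tail_le_1[OF assms, of 0] by (cases "gauss_tail r 0") (auto simp: top_unique)
  ultimately have "ennreal (2 * a) = ennreal 1"
    by (simp add: ennreal_mult')
  then have "a = 1 / 2"
    using a(2) by (subst (asm) ennreal_inj) auto
  with a(1) show ?thesis
    by (simp only:)
qed

section \<open>Integral equation for the tail of the maximum\<close>

context branching_brownian_motion
begin

abbreviation "\<mu> \<equiv> tree_law M L B"

definition max_tail :: "real \<Rightarrow> real \<Rightarrow> real" where
  "max_tail z t = measure \<mu> {y. z < max\<^sub>0 t y}"

definition exp_moment :: "real \<Rightarrow> real \<Rightarrow> ennreal" where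
  "exp_moment \<kappa> t = (\<integral>\<^sup>+y. ennreal (exp (- \<kappa> * max\<^sub>0 t y)) \<partial>\<mu>)"

text \<open>One formula covers both cases: if the root is still alive at \<open>t\<close>, the
  subtrees are evaluated at time 0, where their maxima vanish by regularity.\<close>

lemma max_decomposition:
  assumes "0 < t"
  shows "AE \<omega> in M. max\<^sub>0 t (tree_data_of L B \<omega>) = B [] (min t (L [] \<omega>)) \<omega> +
    max (max\<^sub>0 (t - min t (L [] \<omega>)) (subtree False (tree_data_of L B \<omega>)))
        (max\<^sub>0 (t - min t (L [] \<omega>)) (subtree True (tree_data_of L B \<omega>)))"
  using AE_regular_tree_data AE_regular_subtree[of False] AE_regular_subtree[of True] AE_space[of M]
proof eventually_elim
  case (elim \<omega>)
  let ?y = "tree_data_of L B \<omega>"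
  show ?case
  proof (cases "t < L [] \<omega>")
    case True
    then show ?thesis
      using max_position_eq_position(1)[of ?y t] elim assms
      by (simp add: lifetime_tree_data displacement_tree_data max_position_zero)
  next
    case False
    then show ?thesis
      using max_position_after_branching(1)[of ?y t] elim lifetime_pos[of \<omega> "[]"]
      by (simp add: lifetime_tree_data displacement_tree_data less_imp_le min_def)
  qed
qed

lemma nn_integral_max_branching:
  fixes \<phi> :: "real \<Rightarrow> ennreal"
  assumes t: "0 < t" and [measurable]: "\<phi> \<in> borel_measurable borel"
  shows "(\<integral>\<^sup>+y. \<phi> (max\<^sub>0 t y) \<partial>\<mu>) =
    ennreal (exp (- t)) * (\<integral>\<^sup>+x. ennreal (normal_density 0 (sqrt t) x) * \<phi> x \<partial>lborel) +
    (\<integral>\<^sup>+s. indicator {0<..<t} s * ennreal (exp (- (t - s))) * (\<integral>\<^sup>+x. ennreal (normal_density 0 (sqrt (t - s)) x) *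
      (\<integral>\<^sup>+y1. (\<integral>\<^sup>+y2. \<phi> (x + max (max\<^sub>0 s y1) (max\<^sub>0 s y2)) \<partial>\<mu>) \<partial>\<mu>) \<partial>lborel) \<partial>lborel)"
proof -
  interpret \<mu>: prob_space \<mu>
    by (rule prob_space_tree_law)
  let ?Y = "tree_data_of L B"
  let ?g = "\<lambda>(s, x, y1, y2). \<phi> (x + max (max\<^sub>0 s y1) (max\<^sub>0 s y2))"
  note [measurable] = measurable_tree_data
  have [measurable]: "?g \<in> borel_measurable (borel \<Otimes>\<^sub>M (borel \<Otimes>\<^sub>M (borel \<Otimes>\<^sub>M borel)))"
    by measurable
  have G0: "(\<integral>\<^sup>+y1. (\<integral>\<^sup>+y2. ?g (0, x, y1, y2) \<partial>\<mu>) \<partial>\<mu>) = \<phi> x" for x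
  proof -
    have "(\<integral>\<^sup>+y1. (\<integral>\<^sup>+y2. ?g (0, x, y1, y2) \<partial>\<mu>) \<partial>\<mu>) = (\<integral>\<^sup>+y1. (\<integral>\<^sup>+y2. \<phi> x \<partial>\<mu>) \<partial>\<mu>)"
    proof (rule nn_integral_cong_AE)
      have "AE y1 in \<mu>. AE y2 in \<mu>. ?g (0, x, y1, y2) = \<phi> x"
        using AE_regular
      proof eventually_elim
        case (elim y1)
        show ?case
          using AE_regular by eventually_elim (simp add: max_position_zero elim)
      qed
      then show "AE y1 in \<mu>. (\<integral>\<^sup>+y2. ?g (0, x, y1, y2) \<partial>\<mu>) = (\<integral>\<^sup>+y2. \<phi> x \<partial>\<mu>)"
        by eventually_elim (rule nn_integral_cong_AE)
    qed
    then show ?thesis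
      by (simp add: \<mu>.emeasure_space_1[simplified])
  qed
  have "(\<integral>\<^sup>+y. \<phi> (max\<^sub>0 t y) \<partial>\<mu>) = (\<integral>\<^sup>+\<omega>. \<phi> (max\<^sub>0 t (?Y \<omega>)) \<partial>M)"
    unfolding tree_law_def by (rule nn_integral_distr) measurable
  also have "\<dots> = (\<integral>\<^sup>+\<omega>. ?g (t - min t (L [] \<omega>), B [] (min t (L [] \<omega>)) \<omega>,
      subtree False (?Y \<omega>), subtree True (?Y \<omega>)) \<partial>M)"
    using max_decomposition[OF t] by (intro nn_integral_cong_AE) (auto elim!: eventually_mono)
  also note nn_integral_branching[OF t \<open>?g \<in> _\<close>]
  finally show ?thesis
    unfolding prod.case G0[unfolded prod.case] .
qed

end

lemma nn_integral_exp_Ioo: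
  fixes a r :: real
  assumes "0 \<le> a" "0 \<le> r"
  shows "(\<integral>\<^sup>+s. indicator {0<..<r} s * ennreal (a * exp (a * s)) \<partial>lborel) = ennreal (exp (a * r) - 1)"
proof -
  have "(\<integral>\<^sup>+s. indicator {0<..<r} s * ennreal (a * exp (a * s)) \<partial>lborel) =
      (\<integral>\<^sup>+s. ennreal (a * exp (a * s)) * indicator {0..r} s \<partial>lborel)"
  proof (rule nn_integral_cong_AE)
    show "AE s in lborel. indicator {0<..<r} s * ennreal (a * exp (a * s)) =
        ennreal (a * exp (a * s)) * indicator {0..r} s"
      using AE_lborel_singleton[of 0] AE_lborel_singleton[of r]
      by eventually_elim (auto simp: indicator_def)
  qed
  also have "\<dots> = ennreal (exp (a * r) - exp (a * 0))"
    using assms by (intro nn_integral_FTC_Icc) (auto intro!: derivative_eq_intros)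
  finally show ?thesis
    by simp
qed

context branching_brownian_motion
begin

lemma max_tail_nonneg: "0 \<le> max_tail z t" and max_tail_le_1: "max_tail z t \<le> 1"
  using prob_space.prob_le_1[OF prob_space_tree_law] by (auto simp: max_tail_def)

lemma sets_max_tail [measurable]: "{y. z < max\<^sub>0 t y} \<in> sets borel" "{y. max\<^sub>0 t y \<le> z} \<in> sets borel"
  using measurable_max_position[of "\<lambda>_. t" borel "\<lambda>y. y"] by (auto intro: borel_measurable_less borel_measurable_le)

lemma nn_integral_max_tail: "(\<integral>\<^sup>+y. indicator {y. z < max\<^sub>0 t y} y \<partial>\<mu>) = ennreal (max_tail z t)"
proof -
  interpret \<mu>: prob_space \<mu>
    by (rule prob_space_tree_law)
  show ?thesis
    by (simp add: max_tail_def \<mu>.emeasure_eq_measure)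
qed

lemma measurable_max_tail [measurable (raw)]:
  assumes [measurable]: "f \<in> borel_measurable N" "g \<in> borel_measurable N"
  shows "(\<lambda>x. max_tail (f x) (g x)) \<in> borel_measurable N"
proof -
  interpret \<mu>: prob_space \<mu>
    by (rule prob_space_tree_law)
  have eq: "max_tail z t = enn2real (\<integral>\<^sup>+y. indicator {0<..} (max\<^sub>0 t y - z) \<partial>\<mu>)" for z t
    using nn_integral_max_tail[of z t] max_tail_nonneg[of z t] by (simp add: indicator_def)
  show ?thesis
    unfolding eq by measurable
qed

lemma max_tail_0: "max_tail z 0 = indicator {..<0} z"
proof -
  have "ennreal (max_tail z 0) = (\<integral>\<^sup>+y. indicator {..<0} z \<partial>\<mu>)"
    unfolding nn_integral_max_tail[symmetric] using AE_regular
    by (intro nn_integral_cong_AE) (auto elim!: eventually_mono simp: max_position_zero indicator_def)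
  also have "\<dots> = ennreal (indicator {..<0} z)"
    using prob_space.emeasure_space_1[OF prob_space_tree_law] by (simp add: indicator_def)
  finally show ?thesis
    using max_tail_nonneg by simp
qed

lemma nn_integral_max_tail_pair:
  "(\<integral>\<^sup>+y1. (\<integral>\<^sup>+y2. indicator {z<..} (max (max\<^sub>0 s y1) (max\<^sub>0 s y2)) \<partial>\<mu>) \<partial>\<mu>) =
    ennreal (1 - (1 - max_tail z s)\<^sup>2)"
proof -
  interpret \<mu>: prob_space \<mu>
    by (rule prob_space_tree_law)
  let ?v = "max_tail z s"
  note v = max_tail_nonneg[of z s] max_tail_le_1[of z s]
  have "(\<integral>\<^sup>+y2. indicator {z<..} (max (max\<^sub>0 s y1) (max\<^sub>0 s y2)) \<partial>\<mu>) =
      indicator {y. z < max\<^sub>0 s y} y1 + indicator (- {y. z < max\<^sub>0 s y}) y1 * ennreal ?v" for y1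
    using nn_integral_max_tail[of z s] \<mu>.emeasure_space_1
    by (cases "z < max\<^sub>0 s y1") (auto simp: indicator_def less_max_iff_disj)
  then have "(\<integral>\<^sup>+y1. (\<integral>\<^sup>+y2. indicator {z<..} (max (max\<^sub>0 s y1) (max\<^sub>0 s y2)) \<partial>\<mu>) \<partial>\<mu>) =
      (\<integral>\<^sup>+y1. indicator {y. z < max\<^sub>0 s y} y1 + indicator (- {y. z < max\<^sub>0 s y}) y1 * ennreal ?v \<partial>\<mu>)"
    by simp
  also have "\<dots> = ennreal ?v + emeasure \<mu> (- {y. z < max\<^sub>0 s y}) * ennreal ?v"
    by (subst nn_integral_add) (auto simp: nn_integral_max_tail[symmetric] nn_integral_multc)
  also have "emeasure \<mu> (- {y. z < max\<^sub>0 s y}) = ennreal (1 - ?v)"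
    using \<mu>.prob_compl[of "{y. z < max\<^sub>0 s y}"] by (simp add: \<mu>.emeasure_eq_measure max_tail_def Compl_eq_Diff_UNIV)
  also have "ennreal ?v + ennreal (1 - ?v) * ennreal ?v = ennreal (1 - (1 - ?v)\<^sup>2)"
    using v mult_left_le[OF v(2,1)] by (simp add: ennreal_mult[symmetric] ennreal_plus[symmetric] power2_eq_square algebra_simps del: ennreal_plus)
  finally show ?thesis .
qed

text \<open>The mild form of the Fisher-KPP equation \<open>v' = v'' / 2 + v - v^2\<close>. The rate
  of killing, 1, appears as \<open>exp (- (t - s))\<close>, and two independent copies contribute
  \<open>1 - (1 - v)^2 = 2 * v - v^2\<close>.\<close>

lemma max_tail_mild:
  assumes t: "0 < t"
  shows "ennreal (max_tail z t) = ennreal (exp (- t)) * gauss_tail t z +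
    (\<integral>\<^sup>+s. indicator {0<..<t} s * ennreal (exp (- (t - s))) *
      heat (t - s) (\<lambda>w. ennreal (1 - (1 - max_tail w s)\<^sup>2)) z \<partial>lborel)"
proof -
  have pair: "(\<integral>\<^sup>+y1. (\<integral>\<^sup>+y2. indicator {z<..} (x + max (max\<^sub>0 s y1) (max\<^sub>0 s y2)) \<partial>\<mu>) \<partial>\<mu>) =
    ennreal (1 - (1 - max_tail (z - x) s)\<^sup>2)" for x s
    unfolding nn_integral_max_tail_pair[symmetric] by (simp add: indicator_def algebra_simps)
  have "ennreal (max_tail z t) = (\<integral>\<^sup>+y. indicator {z<..} (max\<^sub>0 t y) \<partial>\<mu>)"
    unfolding nn_integral_max_tail[symmetric] by (intro nn_integral_cong) (simp add: indicator_def)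
  also have "\<dots> = ennreal (exp (- t)) * (\<integral>\<^sup>+x. ennreal (normal_density 0 (sqrt t) x) * indicator {z<..} x \<partial>lborel) +
    (\<integral>\<^sup>+s. indicator {0<..<t} s * ennreal (exp (- (t - s))) *
      (\<integral>\<^sup>+x. ennreal (normal_density 0 (sqrt (t - s)) x) * ennreal (1 - (1 - max_tail (z - x) s)\<^sup>2) \<partial>lborel) \<partial>lborel)"
    by (subst nn_integral_max_branching[OF t]) (simp_all add: pair)
  finally show ?thesis
    by (simp add: gauss_tail_eq heat_def)
qed

text \<open>The Markov property at time \<open>t\<close>, read off from the integral equation.\<close>

lemma max_tail_mild_from:
  assumes t: "0 \<le> t" and r: "0 < r"
  shows "ennreal (max_tail z (t + r)) = ennreal (exp (- r)) * heat r (\<lambda>w. ennreal (max_tail w t)) z +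
    (\<integral>\<^sup>+s. indicator {0<..<r} s * ennreal (exp (- (r - s))) *
      heat (r - s) (\<lambda>w. ennreal (1 - (1 - max_tail w (t + s))\<^sup>2)) z \<partial>lborel)"
proof (cases "t = 0")
  case True
  have "(\<lambda>w. ennreal (max_tail w 0)) = indicator {..<0}"
    by (auto simp: max_tail_0 indicator_def)
  with True show ?thesis
    using max_tail_mild[OF r, of z] by (simp add: gauss_tail_def)
next
  case False
  with t have t: "0 < t"
    by simp
  let ?F = "\<lambda>s w. ennreal (1 - (1 - max_tail w s)\<^sup>2)"
  let ?e = "\<lambda>s. ennreal (exp (- s))"
  have e_add: "?e (a + b) = ?e a * ?e b" for a b
    by (simp add: ennreal_mult[symmetric] exp_add[symmetric])
  let ?I = "\<lambda>s. ?e (t + r - s) * heat (t + r - s) (?F s) z"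
  have "ennreal (max_tail z (t + r)) = ?e (t + r) * gauss_tail (t + r) z +
    (\<integral>\<^sup>+s. indicator {0<..<t + r} s * ?I s \<partial>lborel)"
    using max_tail_mild[of "t + r" z] t r by (simp add: mult.assoc)
  also have "(\<integral>\<^sup>+s. indicator {0<..<t + r} s * ?I s \<partial>lborel) =
      (\<integral>\<^sup>+s. indicator {0<..<t} s * ?I s + indicator {t<..<t + r} s * ?I s \<partial>lborel)"
    by (intro nn_integral_cong_AE eventually_mono[OF AE_lborel_singleton[of t]])
       (use t r in \<open>auto simp: indicator_def\<close>)
  also have "\<dots> = (\<integral>\<^sup>+s. indicator {0<..<t} s * ?I s \<partial>lborel) + (\<integral>\<^sup>+s. indicator {t<..<t + r} s * ?I s \<partial>lborel)"
    by (rule nn_integral_add) measurable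
  also have "(\<integral>\<^sup>+s. indicator {t<..<t + r} s * ?I s \<partial>lborel) =
      (\<integral>\<^sup>+s. indicator {0<..<r} s * ?e (r - s) * heat (r - s) (?F (t + s)) z \<partial>lborel)"
    by (subst nn_integral_real_affine[where c = 1 and t = t])
       (auto intro!: nn_integral_cong simp: indicator_def)
  \<comment> \<open>Pull \<open>heat r\<close> through the time integral. The semigroup property
    then turns the evolution up to time \<open>t\<close> into the evolution up to
    \<open>t + r\<close>, so the whole history before \<open>t\<close> is
    \<open>max_tail w t\<close> evolved by \<open>heat r\<close>.\<close>
  also have "(\<integral>\<^sup>+s. indicator {0<..<t} s * ?I s \<partial>lborel) =
      ?e r * heat r (\<lambda>w. \<integral>\<^sup>+s. indicator {0<..<t} s * ?e (t - s) * heat (t - s) (?F s) w \<partial>lborel) z"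
  proof -
    have "?e r * heat r (\<lambda>w. \<integral>\<^sup>+s. indicator {0<..<t} s * ?e (t - s) * heat (t - s) (?F s) w \<partial>lborel) z =
      ?e r * (\<integral>\<^sup>+s. heat r (\<lambda>w. indicator {0<..<t} s * ?e (t - s) * heat (t - s) (?F s) w) z \<partial>lborel)"
      by (subst heat_nn_integral) measurable
    also have "\<dots> = (\<integral>\<^sup>+s. ?e r * heat r (\<lambda>w. indicator {0<..<t} s * ?e (t - s) * heat (t - s) (?F s) w) z \<partial>lborel)"
      by (rule nn_integral_cmult[symmetric]) measurable
    also have "\<dots> = (\<integral>\<^sup>+s. indicator {0<..<t} s * ?I s \<partial>lborel)"
    proof (rule nn_integral_cong)
      fix s :: real
      show "?e r * heat r (\<lambda>w. indicator {0<..<t} s * ?e (t - s) * heat (t - s) (?F s) w) z = indicator {0<..<t} s * ?I s"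
      proof (cases "s \<in> {0<..<t}")
        case True
        have "heat r (\<lambda>w. indicator {0<..<t} s * ?e (t - s) * heat (t - s) (?F s) w) z =
            ?e (t - s) * heat (r + (t - s)) (?F s) z"
          using True r by (subst heat_cmult) (auto simp: heat_semigroup)
        then show ?thesis
          using True e_add[of r "t - s"] by (simp add: algebra_simps)
      qed (simp add: heat_def)
    qed
    finally show ?thesis ..
  qed
  also have "?e (t + r) * gauss_tail (t + r) z = ?e r * heat r (\<lambda>w. ?e t * gauss_tail t w) z"
    using t r e_add[of r t] unfolding gauss_tail_def
    by (subst heat_cmult) (auto simp: heat_semigroup algebra_simps)
  finally have "ennreal (max_tail z (t + r)) = ?e r * (heat r (\<lambda>w. ?e t * gauss_tail t w) z +
        heat r (\<lambda>w. \<integral>\<^sup>+s. indicator {0<..<t} s * ?e (t - s) * heat (t - s) (?F s) w \<partial>lborel) z) +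
      (\<integral>\<^sup>+s. indicator {0<..<r} s * ?e (r - s) * heat (r - s) (?F (t + s)) z \<partial>lborel)"
    by (simp add: distrib_left add.assoc)
  also have "heat r (\<lambda>w. ?e t * gauss_tail t w) z +
        heat r (\<lambda>w. \<integral>\<^sup>+s. indicator {0<..<t} s * ?e (t - s) * heat (t - s) (?F s) w \<partial>lborel) z =
      heat r (\<lambda>w. ennreal (max_tail w t)) z"
    unfolding max_tail_mild[OF t] by (rule heat_add[symmetric]) measurable
  finally show ?thesis .
qed

text \<open>The linear equation with growth rate \<open>1 - d\<close> supplies a lower barrier as long as the barrier
  stays below \<open>d\<close>. A lower bound by a multiple of the barrier improves itself when inserted into
  the integral equation, and iterating yields the barrier itself.\<close>

lemma max_tail_barrier:
  assumes t: "0 \<le> t" and d: "0 \<le> d" "d \<le> 1" and e: "0 \<le> e" "e * exp ((1 - d) * T) \<le> d"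
    and init: "\<And>w. w < c \<Longrightarrow> e \<le> max_tail w t" and r: "0 < r" "r \<le> T"
  shows "ennreal (e * exp ((1 - d) * r)) * gauss_tail r (z - c) \<le> ennreal (max_tail z (t + r))"
proof -
  define q where "q r w = enn2real (gauss_tail r w)" for r w
  have q: "gauss_tail r w = ennreal (q r w)" "0 \<le> q r w" "q r w \<le> 1" if "0 < r" for r w
  proof -
    show "gauss_tail r w = ennreal (q r w)"
      using gauss_tail_le_1[OF that, of w] by (cases "gauss_tail r w") (auto simp: q_def top_unique)
    show "0 \<le> q r w" "q r w \<le> 1"
      using gauss_tail_le_1[OF that, of w] by (auto simp: q_def intro: enn2real_leI)
  qed
  \<comment> \<open>If the fraction \<open>l\<close> of the barrier is a lower bound, the integral
    equation yields the fraction \<open>l + (1 - l) * exp (- (2 - d) * r)\<close>. As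
    \<open>(2 - d) * r\<close> is at most \<open>2 * T\<close>, the missing fraction shrinks at
    least by the factor \<open>?\<rho>\<close> in each round, uniformly in \<open>r\<close>.\<close>
  let ?\<rho> = "1 - exp (- 2 * T)"
  have T: "0 < T"
    using r by simp
  have \<rho>: "0 \<le> ?\<rho>" "?\<rho> < 1"
    using T by auto
  have iter: "(1 - ?\<rho> ^ n) * (e * exp ((1 - d) * r) * q r (z - c)) \<le> max_tail z (t + r)"
    if "0 < r" "r \<le> T" for n r z
    using that
  proof (induction n arbitrary: r z)
    case 0
    then show ?case
      by (simp add: max_tail_nonneg)
  next
    case (Suc n)
    define l where "l = 1 - ?\<rho> ^ n"
    have l: "0 \<le> l" "l \<le> 1"
      using \<rho> by (auto simp: l_def power_le_one)
    let ?b = "\<lambda>s. e * exp ((1 - d) * s)"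
    \<comment> \<open>On \<open>[0, d]\<close> one has \<open>2 * v - v^2 \<ge> (2 - d) * v\<close>.
      This is applied to \<open>v = l * x\<close>, which stays below \<open>d\<close> because the
      barrier does.\<close>
    have F: "l * (2 - d) * ?b s * q s (w - c) \<le> 1 - (1 - max_tail w (t + s))\<^sup>2" if s: "0 < s" "s \<le> T" for s w
    proof -
      define x where "x = ?b s * q s (w - c)"
      have "?b s \<le> e * exp ((1 - d) * T)"
        using s d e mult_left_mono[of s T "1 - d"] by (intro mult_left_mono) auto
      then have b: "?b s \<le> d"
        using e by linarith
      have x: "0 \<le> x" "x \<le> d"
        using q[OF s(1), of "w - c"] e b mult_mono[OF b, of "q s (w - c)" 1] by (auto simp: x_def d)
      have "l * x \<le> max_tail w (t + s)"
        using Suc.IH[OF s, of w] by (simp add: x_def l_def mult.assoc)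
      then have "(1 - max_tail w (t + s))\<^sup>2 \<le> (1 - l * x)\<^sup>2"
        using max_tail_le_1[of w "t + s"] by (intro power_mono) auto
      moreover have "l * x * (l * x) \<le> l * x * d"
        using l x mult_mono[of l 1 x d] by (intro mult_left_mono) auto
      ultimately show ?thesis
        by (simp add: power2_eq_square algebra_simps x_def)
    qed
    have M1: "ennreal (exp (- r)) * heat r (\<lambda>w. ennreal (max_tail w t)) z \<ge>
        ennreal (exp (- r)) * (ennreal e * gauss_tail r (z - c))"
    proof -
      have "ennreal e * gauss_tail r (z - c) = heat r (\<lambda>w. ennreal e * indicator {..<0} (w - c)) z"
        unfolding gauss_tail_def by (subst heat_cmult) (simp_all add: heat_shift)
      also have "\<dots> \<le> heat r (\<lambda>w. ennreal (max_tail w t)) z"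
        using init by (intro heat_mono) (auto simp: indicator_def intro: ennreal_leI)
      finally show ?thesis
        by (intro mult_left_mono) auto
    qed
    have M2: "(\<integral>\<^sup>+s. indicator {0<..<r} s * ennreal (exp (- (r - s))) *
        heat (r - s) (\<lambda>w. ennreal (1 - (1 - max_tail w (t + s))\<^sup>2)) z \<partial>lborel) \<ge>
      (\<integral>\<^sup>+s. indicator {0<..<r} s * ennreal (exp (- (r - s))) *
        (ennreal (l * (2 - d) * ?b s) * gauss_tail r (z - c)) \<partial>lborel)"
    proof (intro nn_integral_mono, goal_cases)
      case (1 s)
      show ?case
      proof (cases "s \<in> {0<..<r}")
        case True
        then have s: "0 < s" "s < r" "s \<le> T"
          using Suc.prems by auto
        have "ennreal (l * (2 - d) * ?b s) * gauss_tail r (z - c) =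
            ennreal (l * (2 - d) * ?b s) * heat (r - s) (gauss_tail s) (z - c)"
          unfolding gauss_tail_def using s by (subst heat_semigroup) auto
        also have "\<dots> = heat (r - s) (\<lambda>w. ennreal (l * (2 - d) * ?b s) * gauss_tail s (w - c)) z"
          by (subst heat_cmult) (simp_all add: heat_shift)
        also have "\<dots> \<le> heat (r - s) (\<lambda>w. ennreal (1 - (1 - max_tail w (t + s))\<^sup>2)) z"
        proof (intro heat_mono)
          fix w
          have "0 \<le> l * (2 - d) * ?b s"
            using l d e by (intro mult_nonneg_nonneg) auto
          then show "ennreal (l * (2 - d) * ?b s) * gauss_tail s (w - c) \<le> ennreal (1 - (1 - max_tail w (t + s))\<^sup>2)"
            using F[OF s(1,3), of w] q[OF s(1), of "w - c"] by (simp add: ennreal_mult[symmetric] ennreal_leI)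
        qed
        finally show ?thesis
          by (intro mult_left_mono) auto
      qed simp
    qed
    \<comment> \<open>By the semigroup property the Gaussian factor no longer depends on
      \<open>s\<close>, so the time integral is explicit. For \<open>l = 1\<close> it adds to the
      initial term \<open>exp (- r) * e\<close> exactly what is missing to
      \<open>e * exp ((1 - d) * r)\<close>.\<close>
    have M3: "(\<integral>\<^sup>+s. indicator {0<..<r} s * ennreal (exp (- (r - s))) *
        (ennreal (l * (2 - d) * ?b s) * gauss_tail r (z - c)) \<partial>lborel) =
      ennreal (l * e * (exp ((1 - d) * r) - exp (- r))) * gauss_tail r (z - c)"
    proof -
      have eq: "indicator {0<..<r} s * ennreal (exp (- (r - s))) * (ennreal (l * (2 - d) * ?b s) * gauss_tail r (z - c)) =
         (ennreal (l * e * exp (- r)) * gauss_tail r (z - c)) * (indicator {0<..<r} s * ennreal ((2 - d) * exp ((2 - d) * s)))" for s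
      proof -
        have "ennreal (exp (- (r - s))) * ennreal (l * (2 - d) * ?b s) =
            ennreal (l * e * exp (- r)) * ennreal ((2 - d) * exp ((2 - d) * s))"
        proof -
          have "exp (- (r - s)) * exp ((1 - d) * s) = exp (- r) * exp ((2 - d) * s)"
            by (simp add: mult_exp_exp algebra_simps)
          note * = this
          have "exp (- (r - s)) * (l * (2 - d) * ?b s) = l * (2 - d) * e * (exp (- (r - s)) * exp ((1 - d) * s))"
            by (simp only: ac_simps)
          also have "\<dots> = l * e * exp (- r) * ((2 - d) * exp ((2 - d) * s))"
            unfolding * by (simp only: ac_simps)
          finally have "exp (- (r - s)) * (l * (2 - d) * ?b s) = l * e * exp (- r) * ((2 - d) * exp ((2 - d) * s))" .
          moreover have "0 \<le> l * (2 - d) * ?b s" "0 \<le> l * e * exp (- r)" "0 \<le> (2 - d) * exp ((2 - d) * s)"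
            using l d e by (auto intro!: mult_nonneg_nonneg)
          ultimately show ?thesis
            by (simp only: ennreal_mult[symmetric] exp_ge_zero)
        qed
        note * = this
        have "indicator {0<..<r} s * ennreal (exp (- (r - s))) * (ennreal (l * (2 - d) * ?b s) * gauss_tail r (z - c)) =
            indicator {0<..<r} s * gauss_tail r (z - c) * (ennreal (exp (- (r - s))) * ennreal (l * (2 - d) * ?b s))"
          by (simp only: ac_simps)
        then show ?thesis
          unfolding * by (simp only: ac_simps)
      qed
      have "(\<integral>\<^sup>+s. indicator {0<..<r} s * ennreal (exp (- (r - s))) *
          (ennreal (l * (2 - d) * ?b s) * gauss_tail r (z - c)) \<partial>lborel) =
        (ennreal (l * e * exp (- r)) * gauss_tail r (z - c)) * ennreal (exp ((2 - d) * r) - 1)"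
        unfolding eq using d Suc.prems by (subst nn_integral_cmult) (auto simp: nn_integral_exp_Ioo)
      also have "\<dots> = ennreal (l * e * exp (- r) * (exp ((2 - d) * r) - 1)) * gauss_tail r (z - c)"
        using l d e Suc.prems by (subst ennreal_mult) (auto simp: ac_simps)
      also have "l * e * exp (- r) * (exp ((2 - d) * r) - 1) = l * e * (exp ((1 - d) * r) - exp (- r))"
        by (simp add: algebra_simps mult_exp_exp)
      finally show ?thesis .
    qed
    have M4: "ennreal (max_tail z (t + r)) \<ge> ennreal (exp (- r)) * (ennreal e * gauss_tail r (z - c)) +
       ennreal (l * e * (exp ((1 - d) * r) - exp (- r))) * gauss_tail r (z - c)"
      using add_mono[OF M1 M2] unfolding M3 max_tail_mild_from[OF t Suc.prems(1)] .
    have M5: "0 \<le> exp ((1 - d) * r) - exp (- r)"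
      using d Suc.prems by (auto simp: algebra_simps intro!: mult_left_le_one_le)
    have "exp (- r) * e * q r (z - c) + l * e * (exp ((1 - d) * r) - exp (- r)) * q r (z - c) \<le> max_tail z (t + r)"
      using M4 M5 q[OF Suc.prems(1), of "z - c"] e l max_tail_nonneg
      by (simp add: ennreal_mult[symmetric] ennreal_plus[symmetric] mult.assoc del: ennreal_plus)
    moreover have "(1 - ?\<rho> ^ Suc n) * (e * exp ((1 - d) * r) * q r (z - c)) \<le>
      exp (- r) * e * q r (z - c) + l * e * (exp ((1 - d) * r) - exp (- r)) * q r (z - c)"
    proof -
      have "0 \<le> d * r"
        using Suc.prems d by simp
      then have "- 2 * T + (1 - d) * r \<le> - r"
        using Suc.prems by (simp add: algebra_simps)
      then have "exp (- 2 * T) * exp ((1 - d) * r) \<le> exp (- r)"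
        by (simp only: mult_exp_exp exp_le_cancel_iff)
      then have "(1 - l) * (exp (- 2 * T) * exp ((1 - d) * r)) \<le> (1 - l) * exp (- r)"
        using l by (intro mult_left_mono) auto
      moreover have "1 - ?\<rho> ^ Suc n = l + (1 - l) * exp (- 2 * T)"
        by (simp add: l_def algebra_simps)
      ultimately have "(1 - ?\<rho> ^ Suc n) * exp ((1 - d) * r) \<le> exp (- r) + l * (exp ((1 - d) * r) - exp (- r))"
        by (simp only:) (simp add: algebra_simps)
      from mult_right_mono[OF this, of "e * q r (z - c)"] show ?thesis
        using q[OF Suc.prems(1), of "z - c"] e by (simp add: algebra_simps)
    qed
    ultimately show ?case
      by linarith
  qed
  have "(\<lambda>n. (1 - ?\<rho> ^ n) * (e * exp ((1 - d) * r) * q r (z - c))) \<longlonglongrightarrow> (1 - 0) * (e * exp ((1 - d) * r) * q r (z - c))"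
    using \<rho> by (intro tendsto_intros LIMSEQ_power_zero) auto
  then have "(1 - 0) * (e * exp ((1 - d) * r) * q r (z - c)) \<le> max_tail z (t + r)"
    using iter[OF r] by (intro LIMSEQ_le_const2) auto
  then show ?thesis
    using q[OF r(1), of "z - c"] e by (simp add: ennreal_mult[symmetric] ennreal_leI)
qed

end

text \<open>The density decreases on the positive half line, so on the unit interval above
  \<open>x\<close> it is at least its value at the right end.\<close>

lemma gauss_tail_lower:
  assumes "0 < T" "0 \<le> x"
  shows "ennreal (normal_density 0 (sqrt T) (x + 1)) \<le> gauss_tail T x"
proof -
  let ?p = "normal_density 0 (sqrt T)"
  have "ennreal (?p (x + 1)) = (\<integral>\<^sup>+w. ennreal (?p (x + 1)) * indicator {x<..x + 1} w \<partial>lborel)"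
    by (simp add: nn_integral_cmult)
  also have "\<dots> \<le> gauss_tail T x"
    unfolding gauss_tail_eq
  proof (rule nn_integral_mono)
    fix w
    show "ennreal (?p (x + 1)) * indicator {x<..x + 1} w \<le> ennreal (?p w) * indicator {x<..} w"
    proof (cases "w \<in> {x<..x + 1}")
      case True
      then have "w\<^sup>2 \<le> (x + 1)\<^sup>2"
        using assms by (intro power_mono) auto
      then have "?p (x + 1) \<le> ?p w"
        using assms by (auto simp: normal_density_def divide_simps intro!: mult_left_mono)
      then show ?thesis
        using True by (simp add: ennreal_leI)
    qed simp
  qed
  finally show ?thesis .
qed

lemma gaussian_growth:
  fixes c :: real
  assumes "0 \<le> c" "c < sqrt 2"
  obtains d T where "0 < d" "d \<le> 1" "0 < T" "1 \<le> exp ((1 - d) * T) * normal_density 0 (sqrt T) (c * T + 1)"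
proof -
  \<comment> \<open>Half of the gap between the growth rate 1 and the Gaussian cost
    \<open>c^2 / 2\<close>. The net rate \<open>(1 - d) - c^2 / 2\<close> is again \<open>d\<close>,
    and \<open>exp (d * T)\<close> beats the square root in the normal density.\<close>
  define d where "d = (1 - c\<^sup>2 / 2) / 2"
  have "c\<^sup>2 < (sqrt 2)\<^sup>2"
    using assms by (intro power_strict_mono) auto
  then have d: "0 < d" "d \<le> 1"
    using zero_le_power2[of c] by (simp_all add: d_def order_trans[of "- 2" 0])
  have "filterlim (\<lambda>T. exp (d * T - c - 1 / (2 * T)) / sqrt (2 * pi * T)) at_top at_top"
    using d by real_asymp
  then have "\<forall>\<^sub>F T in at_top. 1 \<le> exp (d * T - c - 1 / (2 * T)) / sqrt (2 * pi * T)"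
    by (simp add: filterlim_at_top)
  then have "\<forall>\<^sub>F T in at_top. 1 \<le> exp (d * T - c - 1 / (2 * T)) / sqrt (2 * pi * T) \<and> 0 < T"
    using eventually_gt_at_top[of 0] by eventually_elim auto
  then obtain T where T: "1 \<le> exp (d * T - c - 1 / (2 * T)) / sqrt (2 * pi * T)" "0 < T"
    using eventually_happens'[OF trivial_limit_at_top_linorder] by blast
  have "(1 - d) * T - (c * T + 1)\<^sup>2 / (2 * T) = d * T - c - 1 / (2 * T)"
    using T by (simp add: d_def field_simps power2_eq_square)
  then have "exp ((1 - d) * T) * exp (- ((c * T + 1)\<^sup>2 / (2 * T))) = exp (d * T - c - 1 / (2 * T))"
    by (simp only: mult_exp_exp diff_conv_add_uminus)
  moreover have "normal_density 0 (sqrt T) (c * T + 1) = exp (- ((c * T + 1)\<^sup>2 / (2 * T))) / sqrt (2 * pi * T)"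
    using T by (simp add: normal_density_def)
  ultimately have "exp ((1 - d) * T) * normal_density 0 (sqrt T) (c * T + 1) = exp (d * T - c - 1 / (2 * T)) / sqrt (2 * pi * T)"
    by (simp only: times_divide_eq_right)
  with T d that show ?thesis
    by auto
qed

context branching_brownian_motion
begin

text \<open>Renewal over steps of length \<open>T\<close>: if the tail is at least \<open>e\<close>
  below a level, then by \<open>max_tail_barrier\<close> and the choice of \<open>T\<close> it is
  again at least \<open>e\<close> below the level raised by \<open>c * T\<close>. The same
  \<open>e\<close> survives every step.\<close>

lemma max_tail_speed:
  assumes c: "0 \<le> c" "c < sqrt 2"
  obtains e K where "0 < e" "e \<le> 1" "\<And>s w. 0 \<le> s \<Longrightarrow> w < c * s - K \<Longrightarrow> e \<le> max_tail w s"
proof -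
  obtain d T where d: "0 < d" "d \<le> 1" and T: "0 < T"
    and g: "1 \<le> exp ((1 - d) * T) * normal_density 0 (sqrt T) (c * T + 1)"
    using gaussian_growth[OF c] by blast
  \<comment> \<open>Chosen so that the barrier started from \<open>e\<close> reaches
    \<open>d\<close>, the largest admissible height, exactly at time \<open>T\<close>.\<close>
  define e where "e = d * exp (- ((1 - d) * T))"
  have e: "0 < e" "e * exp ((1 - d) * T) \<le> d"
    using d by (simp_all add: e_def mult.assoc mult_exp_exp)
  have "exp (- ((1 - d) * T)) \<le> 1"
    using d T by simp
  then have e1: "e \<le> 1"
    using d mult_mono[of d 1 "exp (- ((1 - d) * T))" 1] by (simp add: e_def)
  note barrier = max_tail_barrier[OF _ less_imp_le[OF d(1)] d(2) less_imp_le[OF e(1)] e(2)]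
  have step: "w < c * (real n * T) \<Longrightarrow> e \<le> max_tail w (real n * T)" for n w
  proof (induction n arbitrary: w)
    case 0
    then show ?case
      using e1 by (simp add: max_tail_0)
  next
    case (Suc n)
    have "ennreal e \<le> ennreal (e * exp ((1 - d) * T) * normal_density 0 (sqrt T) (c * T + 1))"
      using mult_left_mono[OF g, of e] e by (intro ennreal_leI) (simp add: mult.assoc)
    also have "\<dots> = ennreal (e * exp ((1 - d) * T)) * ennreal (normal_density 0 (sqrt T) (c * T + 1))"
      using e by (simp add: ennreal_mult)
    also have "\<dots> \<le> ennreal (e * exp ((1 - d) * T)) * gauss_tail T (c * T)"
      using T c by (intro mult_left_mono gauss_tail_lower) auto
    also have "\<dots> \<le> ennreal (e * exp ((1 - d) * T)) * gauss_tail T (w - c * (real n * T))"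
      using Suc.prems by (intro mult_left_mono gauss_tail_antimono) (auto simp: algebra_simps)
    also have "\<dots> \<le> ennreal (max_tail w (real n * T + T))"
      using T Suc.IH by (intro barrier) auto
    finally show ?case
      using max_tail_nonneg by (simp add: algebra_simps)
  qed
  \<comment> \<open>Between two grid times the level is not raised; the barrier keeps at least half
    of \<open>e\<close> because \<open>gauss_tail r 0 = 1/2\<close>. The progress forgone is at most
    \<open>c * T\<close>.\<close>
  have "e / 2 \<le> max_tail w s" if s: "0 \<le> s" and w: "w < c * s - c * T" for s w
  proof -
    define n where "n = nat \<lfloor>s / T\<rfloor>"
    define r where "r = s - real n * T"
    have "0 \<le> s / T"
      using s T by simp
    then have "real n \<le> s / T" "s / T < real n + 1"
      by (simp_all add: n_def)
    then have r: "0 \<le> r" "r < T"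
      using T by (simp_all add: r_def field_simps)
    have s_eq: "s = real n * T + r"
      by (simp add: r_def)
    have "c * s - c * T \<le> c * (real n * T)"
      using c mult_left_mono[of r T c] r by (simp add: s_eq algebra_simps)
    with w have w': "w < c * (real n * T)"
      by simp
    show ?thesis
    proof (cases "r = 0")
      case True
      then show ?thesis
        using step[OF w'] e by (simp add: s_eq)
    next
      case False
      with r have r0: "0 < r"
        by simp
      have "e * 1 \<le> e * exp ((1 - d) * r)"
        using d e r0 by (intro mult_left_mono) auto
      then have "ennreal (e / 2) \<le> ennreal (e * exp ((1 - d) * r) * (1 / 2))"
        by (intro ennreal_leI) simp
      also have "\<dots> = ennreal (e * exp ((1 - d) * r)) * gauss_tail r 0"
        using e by (subst ennreal_mult) (auto simp: gauss_tail_0[OF r0])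
      also have "\<dots> \<le> ennreal (e * exp ((1 - d) * r)) * gauss_tail r (w - c * (real n * T))"
        using w' by (intro mult_left_mono gauss_tail_antimono) auto
      also have "\<dots> \<le> ennreal (max_tail w (real n * T + r))"
        using T step r r0 by (intro barrier) auto
      finally show ?thesis
        using max_tail_nonneg by (simp add: s_eq)
    qed
  qed
  with e(1) e1 that[of "e / 2" "c * T"] show ?thesis
    by simp
qed

end

section \<open>Exponential moments of the maximum\<close>

lemma nn_integral_normal_exp:
  assumes "0 < r"
  shows "(\<integral>\<^sup>+x. ennreal (normal_density 0 (sqrt r) x) * ennreal (exp (- k * x)) \<partial>lborel) = ennreal (exp (k\<^sup>2 * r / 2))"
proof -
  have "normal_density 0 (sqrt r) x * exp (- k * x) = exp (k\<^sup>2 * r / 2) * normal_density (- k * r) (sqrt r) x" for x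
  proof -
    have "- x\<^sup>2 / (2 * r) + - k * x = k\<^sup>2 * r / 2 + - (x - - k * r)\<^sup>2 / (2 * r)"
      using assms by (simp add: field_simps power2_eq_square)
    then have "exp (- x\<^sup>2 / (2 * r)) * exp (- k * x) = exp (k\<^sup>2 * r / 2) * exp (- (x - - k * r)\<^sup>2 / (2 * r))"
      unfolding mult_exp_exp by (rule arg_cong)
    then show ?thesis
      using assms by (simp add: normal_density_def)
  qed
  then have "(\<integral>\<^sup>+x. ennreal (normal_density 0 (sqrt r) x) * ennreal (exp (- k * x)) \<partial>lborel) =
      (\<integral>\<^sup>+x. ennreal (exp (k\<^sup>2 * r / 2)) * ennreal (normal_density (- k * r) (sqrt r) x) \<partial>lborel)"
    by (simp add: ennreal_mult[symmetric])
  also have "\<dots> = ennreal (exp (k\<^sup>2 * r / 2))"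
    using assms by (subst nn_integral_cmult) (auto simp: nn_integral_normal_density)
  finally show ?thesis .
qed

text \<open>Exchanges exponential moments of a maximum for integrals of its distribution function
  over all levels.\<close>

lemma exp_layer_cake:
  fixes m k :: real
  assumes "0 < k"
  shows "ennreal (exp (- k * m)) = (\<integral>\<^sup>+z. ennreal (k * exp (- k * z)) * indicator {m..} z \<partial>lborel)"
proof -
  have "(\<integral>\<^sup>+z. ennreal (k * exp (- k * z)) * indicator {m..} z \<partial>lborel) = ennreal (0 - (- exp (- k * m)))"
  proof (rule nn_integral_FTC_atLeast)
    show "((\<lambda>z. - exp (- k * z)) \<longlongrightarrow> 0) at_top"
      using assms by real_asymp
  qed (use assms in \<open>auto intro!: derivative_eq_intros\<close>)
  then show ?thesis
    by simp
qed

context branching_brownian_motion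
begin

definition max_pair_moment :: "real \<Rightarrow> real \<Rightarrow> ennreal" where
  "max_pair_moment k s = (\<integral>\<^sup>+y1. (\<integral>\<^sup>+y2. ennreal (exp (- k * max (max\<^sub>0 s y1) (max\<^sub>0 s y2))) \<partial>\<mu>) \<partial>\<mu>)"

lemma measurable_max_pair_moment [measurable]: "max_pair_moment k \<in> borel_measurable borel"
proof -
  interpret \<mu>: prob_space \<mu>
    by (rule prob_space_tree_law)
  show ?thesis
    unfolding max_pair_moment_def[abs_def] by measurable
qed

lemma exp_moment_0: "exp_moment k 0 = 1"
proof -
  have "exp_moment k 0 = (\<integral>\<^sup>+y. 1 \<partial>\<mu>)"
    unfolding exp_moment_def
  proof (rule nn_integral_cong_AE)
    show "AE y in \<mu>. ennreal (exp (- k * max\<^sub>0 0 y)) = 1"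
      using AE_regular by eventually_elim (simp add: max_position_zero)
  qed
  also have "\<dots> = 1"
    using prob_space.emeasure_space_1[OF prob_space_tree_law] by simp
  finally show ?thesis .
qed

lemma exp_moment_recursion:
  assumes t: "0 < t"
  shows "exp_moment k t = ennreal (exp ((k\<^sup>2 / 2 - 1) * t)) +
    (\<integral>\<^sup>+s. indicator {0<..<t} s * ennreal (exp ((k\<^sup>2 / 2 - 1) * (t - s))) * max_pair_moment k s \<partial>lborel)"
proof -
  interpret \<mu>: prob_space \<mu>
    by (rule prob_space_tree_law)
  have e: "ennreal (exp (- r)) * ennreal (exp (k\<^sup>2 * r / 2)) = ennreal (exp ((k\<^sup>2 / 2 - 1) * r))" for r
    by (simp add: ennreal_mult[symmetric] mult_exp_exp algebra_simps)
  have pair: "(\<integral>\<^sup>+y1. (\<integral>\<^sup>+y2. ennreal (exp (- k * (x + max (max\<^sub>0 s y1) (max\<^sub>0 s y2)))) \<partial>\<mu>) \<partial>\<mu>) =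
      ennreal (exp (- k * x)) * max_pair_moment k s" for x s
  proof -
    have "ennreal (exp (- k * (x + m))) = ennreal (exp (- k * x)) * ennreal (exp (- k * m))" for m
      by (simp add: ennreal_mult[symmetric] mult_exp_exp algebra_simps)
    then show ?thesis
      unfolding max_pair_moment_def by (simp add: nn_integral_cmult)
  qed
  have conv: "indicator {0<..<t} s * ennreal (exp (- (t - s))) *
      (\<integral>\<^sup>+x. ennreal (normal_density 0 (sqrt (t - s)) x) * (ennreal (exp (- k * x)) * max_pair_moment k s) \<partial>lborel) =
      indicator {0<..<t} s * ennreal (exp ((k\<^sup>2 / 2 - 1) * (t - s))) * max_pair_moment k s" for s
  proof (cases "s \<in> {0<..<t}")
    case True
    have "(\<integral>\<^sup>+x. ennreal (normal_density 0 (sqrt (t - s)) x) * (ennreal (exp (- k * x)) * max_pair_moment k s) \<partial>lborel) =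
        ennreal (exp (k\<^sup>2 * (t - s) / 2)) * max_pair_moment k s"
      using True by (simp only: mult.assoc[symmetric], subst nn_integral_multc)
        (auto simp: nn_integral_normal_exp[simplified])
    then show ?thesis
      using True by (simp add: e[symmetric] mult.assoc)
  qed simp
  show ?thesis
    unfolding exp_moment_def
    by (subst nn_integral_max_branching[OF t, of "\<lambda>m. ennreal (exp (- k * m))"])
       (simp_all only: pair conv nn_integral_normal_exp[OF t] e, measurable)
qed

lemma max_pair_moment_le_square:
  assumes "0 \<le> k"
  shows "max_pair_moment (2 * k) s \<le> (exp_moment k s)\<^sup>2"
proof -
  interpret \<mu>: prob_space \<mu>
    by (rule prob_space_tree_law)
  have "max_pair_moment (2 * k) s \<le>
      (\<integral>\<^sup>+y1. (\<integral>\<^sup>+y2. ennreal (exp (- k * max\<^sub>0 s y1)) * ennreal (exp (- k * max\<^sub>0 s y2)) \<partial>\<mu>) \<partial>\<mu>)"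
    unfolding max_pair_moment_def
  proof (intro nn_integral_mono)
    fix y1 y2
    have "k * (max\<^sub>0 s y1 + max\<^sub>0 s y2) \<le> k * (2 * max (max\<^sub>0 s y1) (max\<^sub>0 s y2))"
      using assms by (intro mult_left_mono) auto
    then show "ennreal (exp (- (2 * k) * max (max\<^sub>0 s y1) (max\<^sub>0 s y2))) \<le>
        ennreal (exp (- k * max\<^sub>0 s y1)) * ennreal (exp (- k * max\<^sub>0 s y2))"
      by (simp add: ennreal_mult[symmetric] mult_exp_exp algebra_simps ennreal_leI)
  qed
  also have "\<dots> = (exp_moment k s)\<^sup>2"
    unfolding exp_moment_def power2_eq_square by (simp add: nn_integral_cmult nn_integral_multc)
  finally show ?thesis .
qed

lemma emeasure_max_le: "emeasure \<mu> {y. max\<^sub>0 s y \<le> z} = ennreal (1 - max_tail z s)"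
proof -
  interpret \<mu>: prob_space \<mu>
    by (rule prob_space_tree_law)
  have "{y. max\<^sub>0 s y \<le> z} = space \<mu> - {y. z < max\<^sub>0 s y}"
    by auto
  then show ?thesis
    by (simp only: \<mu>.emeasure_eq_measure) (subst \<mu>.prob_compl, auto simp: max_tail_def)
qed

text \<open>If the second copy is above \<open>a\<close>, so is the larger of the two; otherwise the
  larger one is bounded below by the first copy, which is independent of that event.\<close>

lemma max_pair_moment_le_split:
  assumes "0 \<le> k"
  shows "max_pair_moment k s \<le> ennreal (1 - max_tail a s) * exp_moment k s + ennreal (exp (- k * a))"
proof -
  interpret \<mu>: prob_space \<mu>
    by (rule prob_space_tree_law)
  have "max_pair_moment k s \<le>
      (\<integral>\<^sup>+y1. (\<integral>\<^sup>+y2. ennreal (exp (- k * max\<^sub>0 s y1)) * indicator {y. max\<^sub>0 s y \<le> a} y2 + ennreal (exp (- k * a)) \<partial>\<mu>) \<partial>\<mu>)"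
    unfolding max_pair_moment_def
  proof (intro nn_integral_mono)
    fix y1 y2
    show "ennreal (exp (- k * max (max\<^sub>0 s y1) (max\<^sub>0 s y2))) \<le>
        ennreal (exp (- k * max\<^sub>0 s y1)) * indicator {y. max\<^sub>0 s y \<le> a} y2 + ennreal (exp (- k * a))"
    proof (cases "max\<^sub>0 s y2 \<le> a")
      case True
      have "ennreal (exp (- k * max (max\<^sub>0 s y1) (max\<^sub>0 s y2))) \<le> ennreal (exp (- k * max\<^sub>0 s y1))"
        using assms by (intro ennreal_leI) (auto intro: mult_left_mono)
      with True show ?thesis
        by (simp add: add_increasing2)
    next
      case False
      have "ennreal (exp (- k * max (max\<^sub>0 s y1) (max\<^sub>0 s y2))) \<le> ennreal (exp (- k * a))"
        using assms False by (intro ennreal_leI) (auto intro: mult_left_mono)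
      with False show ?thesis
        by simp
    qed
  qed
  also have "\<dots> = exp_moment k s * emeasure \<mu> {y. max\<^sub>0 s y \<le> a} + ennreal (exp (- k * a))"
    using \<mu>.emeasure_space_1
    by (simp add: nn_integral_add nn_integral_cmult nn_integral_multc exp_moment_def)
  finally show ?thesis
    by (simp add: emeasure_max_le mult.commute)
qed

text \<open>The maximum dominates a single Brownian motion in law: for \<open>d = e = 1\<close> the
  barrier does not grow and is the plain Gaussian tail. The bound supplies the a priori finiteness
  from which \<open>exp_moment_small\<close> starts its iteration.\<close>

lemma exp_moment_le:
  assumes k: "0 < k" and t: "0 < t"
  shows "exp_moment k t \<le> ennreal (exp (k\<^sup>2 * t / 2))"
proof -
  interpret \<mu>: prob_space \<mu>
    by (rule prob_space_tree_law)
  interpret P: pair_sigma_finite \<mu> lborel ..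
  let ?p = "\<lambda>x. ennreal (normal_density 0 (sqrt t) x)"
  have *: "emeasure \<mu> {y. max\<^sub>0 t y \<le> z} \<le> (\<integral>\<^sup>+x. ?p x * indicator {..z} x \<partial>lborel)" for z
  proof -
    have "gauss_tail t z \<le> ennreal (max_tail z t)"
      using max_tail_barrier[of 0 1 1 t 0 t z] t by (simp add: max_tail_0)
    then have "ennreal (1 - max_tail z t) + gauss_tail t z \<le> ennreal (1 - max_tail z t) + ennreal (max_tail z t)"
      by (rule add_left_mono)
    also have "\<dots> = 1"
      using max_tail_le_1[of z t] max_tail_nonneg[of z t] by (simp add: ennreal_plus[symmetric] del: ennreal_plus)
    also have "1 = (\<integral>\<^sup>+x. ?p x \<partial>lborel)"
      using t by (simp add: nn_integral_normal_density)
    also have "\<dots> = (\<integral>\<^sup>+x. ?p x * indicator {..z} x + ?p x * indicator {z<..} x \<partial>lborel)"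
      by (intro nn_integral_cong) (auto simp: indicator_def)
    also have "\<dots> = (\<integral>\<^sup>+x. ?p x * indicator {..z} x \<partial>lborel) + gauss_tail t z"
      unfolding gauss_tail_eq by (rule nn_integral_add) measurable
    finally show ?thesis
      using gauss_tail_le_1[OF t, of z]
      by (simp add: emeasure_max_le top_unique ennreal_add_left_cancel_le add.commute[of _ "gauss_tail t z"])
         (auto simp: top_unique)
  qed
  have "exp_moment k t = (\<integral>\<^sup>+y. (\<integral>\<^sup>+z. ennreal (k * exp (- k * z)) * indicator {max\<^sub>0 t y..} z \<partial>lborel) \<partial>\<mu>)"
    unfolding exp_moment_def exp_layer_cake[OF k] ..
  also have "\<dots> = (\<integral>\<^sup>+z. (\<integral>\<^sup>+y. ennreal (k * exp (- k * z)) * indicator {y. max\<^sub>0 t y \<le> z} y \<partial>\<mu>) \<partial>lborel)"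
  proof -
    have *: "indicator {max\<^sub>0 t y..} z = (indicator {y. max\<^sub>0 t y \<le> z} y :: ennreal)" for y z
      by (simp add: indicator_def)
    have [measurable]: "Measurable.pred (\<mu> \<Otimes>\<^sub>M lborel) (\<lambda>x. fst x \<in> {y. max\<^sub>0 t y \<le> snd x})"
      by simp
    show ?thesis
      unfolding * by (rule P.Fubini'[symmetric]) (simp add: case_prod_beta')
  qed
  also have "\<dots> = (\<integral>\<^sup>+z. ennreal (k * exp (- k * z)) * emeasure \<mu> {y. max\<^sub>0 t y \<le> z} \<partial>lborel)"
    by (simp add: nn_integral_cmult)
  also have "\<dots> \<le> (\<integral>\<^sup>+z. ennreal (k * exp (- k * z)) * (\<integral>\<^sup>+x. ?p x * indicator {..z} x \<partial>lborel) \<partial>lborel)"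
    by (intro nn_integral_mono mult_left_mono *) auto
  also have "\<dots> = (\<integral>\<^sup>+z. (\<integral>\<^sup>+x. ?p x * (ennreal (k * exp (- k * z)) * indicator {x..} z) \<partial>lborel) \<partial>lborel)"
    by (subst nn_integral_cmult[symmetric]) (auto intro!: nn_integral_cong simp: indicator_def ac_simps)
  also have "\<dots> = (\<integral>\<^sup>+x. (\<integral>\<^sup>+z. ?p x * (ennreal (k * exp (- k * z)) * indicator {x..} z) \<partial>lborel) \<partial>lborel)"
  proof (rule lborel_pair.Fubini')
    have [measurable]: "Measurable.pred (borel \<Otimes>\<^sub>M borel) (\<lambda>x. snd x \<in> {fst x :: real..})"
      unfolding atLeast_iff by measurable
    show "(\<lambda>(x, z). ?p x * (ennreal (k * exp (- k * z)) * indicator {x..} z)) \<in> borel_measurable (lborel \<Otimes>\<^sub>M lborel)"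
      by measurable
  qed
  also have "\<dots> = (\<integral>\<^sup>+x. ?p x * ennreal (exp (- k * x)) \<partial>lborel)"
    unfolding exp_layer_cake[OF k] by (intro nn_integral_cong nn_integral_cmult) measurable
  also have "\<dots> = ennreal (exp (k\<^sup>2 * t / 2))"
    by (rule nn_integral_normal_exp[OF t])
  finally show ?thesis .
qed

text \<open>If \<open>M\<^sub>s\<close> exceeds \<open>c s - K\<close> with probability at least \<open>e\<close>, the branching equation bounds
  \<open>H t = exp (k c t) * exp_moment k t\<close> affinely by its own supremum, with a factor
  \<open>(1 - e) / (1 - k\<^sup>2 / 2 - k c) < 1\<close> for small \<open>k\<close>.\<close>

lemma exp_moment_small:
  assumes c: "0 \<le> c" "c < sqrt 2"
  obtains k0 where "0 < k0"
    "\<And>k. 0 < k \<Longrightarrow> k < k0 \<Longrightarrow> \<exists>C\<ge>0. \<forall>t\<ge>0. exp_moment k t \<le> ennreal (C * exp (- k * c * t))"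
proof -
  obtain e K where e: "0 < e" "e \<le> 1" and speed: "\<And>s w. 0 \<le> s \<Longrightarrow> w < c * s - K \<Longrightarrow> e \<le> max_tail w s"
    using max_tail_speed[OF c] by blast
  \<comment> \<open>For \<open>k < k0\<close> one has \<open>k^2 \<le> k\<close> and
    \<open>k * (1 + c) < e / 2\<close>, hence \<open>k^2 / 2 + k * c < e\<close>, which is the
    inequality \<open>1 - e < \<rho>\<close> behind the contraction.\<close>
  define k0 where "k0 = min 1 (e / (2 * (1 + c)))"
  have "0 < k0"
    using e c by (simp add: k0_def)
  moreover have "\<exists>C\<ge>0. \<forall>t\<ge>0. exp_moment k t \<le> ennreal (C * exp (- k * c * t))" if k: "0 < k" "k < k0" for k
  proof -
    define \<rho> where "\<rho> = 1 - k\<^sup>2 / 2 - k * c"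
    have "k < 1" "k * (1 + c) < e / 2"
      using k c by (auto simp: k0_def field_simps)
    moreover have "k\<^sup>2 \<le> k"
      using k \<open>k < 1\<close> by (simp add: power2_eq_square mult_left_le_one_le)
    ultimately have \<rho>: "1 - e < \<rho>"
      using k e by (simp add: \<rho>_def algebra_simps)
    with e have \<rho>0: "0 < \<rho>"
      by linarith
    define \<theta> where "\<theta> = (1 - e) / \<rho>"
    have \<theta>: "0 \<le> \<theta>" "\<theta> < 1"
      using \<rho> \<rho>0 e by (auto simp: \<theta>_def)
    \<comment> \<open>The contribution of the split level \<open>a = c * s - (K + 1)\<close>. The
      extra 1 makes the inequality required by \<open>speed\<close> strict.\<close>
    define A where "A = exp (k * (K + 1))"
    define H where "H t = ennreal (exp (k * c * t)) * exp_moment k t" for t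
    have H_pair: "max_pair_moment k s \<le> ennreal (exp (- k * c * s)) * ennreal ((1 - e) * D + A)"
      if s: "0 \<le> s" and D: "0 \<le> D" "H s \<le> ennreal D" for s D
    proof -
      have "exp_moment k s = ennreal (exp (- k * c * s)) * H s"
        by (simp add: H_def mult.assoc[symmetric] ennreal_mult[symmetric] mult_exp_exp)
      then have "exp_moment k s \<le> ennreal (exp (- k * c * s)) * ennreal D"
        using D by (simp add: mult_left_mono)
      moreover have "1 - max_tail (c * s - (K + 1)) s \<le> 1 - e"
        using speed[OF s] by simp
      ultimately have X1: "ennreal (1 - max_tail (c * s - (K + 1)) s) * exp_moment k s \<le>
          ennreal (1 - e) * (ennreal (exp (- k * c * s)) * ennreal D)"
        by (intro mult_mono ennreal_leI) auto
      have X2: "ennreal (exp (- k * (c * s - (K + 1)))) = ennreal (exp (- k * c * s)) * ennreal A"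
        by (simp add: A_def ennreal_mult[symmetric] mult_exp_exp algebra_simps)
      have "max_pair_moment k s \<le> ennreal (1 - max_tail (c * s - (K + 1)) s) * exp_moment k s +
          ennreal (exp (- k * (c * s - (K + 1))))"
        using k by (intro max_pair_moment_le_split) simp
      also have "\<dots> \<le> ennreal (1 - e) * (ennreal (exp (- k * c * s)) * ennreal D) + ennreal (exp (- k * c * s)) * ennreal A"
        unfolding X2 by (intro add_right_mono X1)
      also have "\<dots> = ennreal (exp (- k * c * s)) * ennreal ((1 - e) * D + A)"
      proof -
        have "ennreal ((1 - e) * D + A) = ennreal (1 - e) * ennreal D + ennreal A"
          using e D by (simp add: ennreal_mult A_def)
        then show ?thesis
          by (simp only: distrib_left ac_simps)
      qed
      finally show ?thesis .
    qed
    have H_step: "H t \<le> ennreal (1 + A / \<rho> + \<theta> * D)"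
      if t: "0 < t" and D: "0 \<le> D" "\<And>s. 0 < s \<Longrightarrow> s < t \<Longrightarrow> H s \<le> ennreal D" for t D
    proof -
      let ?G = "ennreal ((1 - e) * D + A)"
      have A: "0 \<le> (1 - e) * D + A"
        using e D by (simp add: A_def)
      have "H t = ennreal (exp (k * c * t)) * ennreal (exp ((k\<^sup>2 / 2 - 1) * t)) + ennreal (exp (k * c * t)) *
          (\<integral>\<^sup>+s. indicator {0<..<t} s * ennreal (exp ((k\<^sup>2 / 2 - 1) * (t - s))) * max_pair_moment k s \<partial>lborel)"
        unfolding H_def exp_moment_recursion[OF t] by (simp add: distrib_left)
      also have "ennreal (exp (k * c * t)) * ennreal (exp ((k\<^sup>2 / 2 - 1) * t)) = ennreal (exp (- \<rho> * t))"
        by (simp add: ennreal_mult[symmetric] mult_exp_exp \<rho>_def algebra_simps)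
      also have "\<dots> \<le> ennreal 1"
        using \<rho>0 t by (intro ennreal_leI) simp
      also have "ennreal (exp (k * c * t)) *
          (\<integral>\<^sup>+s. indicator {0<..<t} s * ennreal (exp ((k\<^sup>2 / 2 - 1) * (t - s))) * max_pair_moment k s \<partial>lborel) =
          (\<integral>\<^sup>+s. ennreal (exp (k * c * t)) *
            (indicator {0<..<t} s * ennreal (exp ((k\<^sup>2 / 2 - 1) * (t - s))) * max_pair_moment k s) \<partial>lborel)"
        by (rule nn_integral_cmult[symmetric]) measurable
      also have "\<dots> \<le> (\<integral>\<^sup>+s. ennreal (exp (- \<rho> * t) / \<rho>) * ?G * (indicator {0<..<t} s * ennreal (\<rho> * exp (\<rho> * s))) \<partial>lborel)"
      proof (rule nn_integral_mono)
        fix s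
        show "ennreal (exp (k * c * t)) *
            (indicator {0<..<t} s * ennreal (exp ((k\<^sup>2 / 2 - 1) * (t - s))) * max_pair_moment k s) \<le>
            ennreal (exp (- \<rho> * t) / \<rho>) * ?G * (indicator {0<..<t} s * ennreal (\<rho> * exp (\<rho> * s)))"
        proof (cases "s \<in> {0<..<t}")
          case True
          have "exp (k * c * t) * exp ((k\<^sup>2 / 2 - 1) * (t - s)) * exp (- k * c * s) = exp (- \<rho> * t) * exp (\<rho> * s)"
            unfolding mult_exp_exp by (rule arg_cong[where f = exp]) (simp add: \<rho>_def field_simps)
          then have *: "ennreal (exp (k * c * t)) * ennreal (exp ((k\<^sup>2 / 2 - 1) * (t - s))) * ennreal (exp (- k * c * s)) =
              ennreal (exp (- \<rho> * t) / \<rho>) * ennreal (\<rho> * exp (\<rho> * s))"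
            using \<rho>0 by (simp add: ennreal_mult[symmetric])
          have "ennreal (exp (k * c * t)) * (ennreal (exp ((k\<^sup>2 / 2 - 1) * (t - s))) * max_pair_moment k s) \<le>
              ennreal (exp (k * c * t)) * (ennreal (exp ((k\<^sup>2 / 2 - 1) * (t - s))) * (ennreal (exp (- k * c * s)) * ?G))"
            using True D by (intro mult_left_mono H_pair) auto
          also have "\<dots> = (ennreal (exp (k * c * t)) * ennreal (exp ((k\<^sup>2 / 2 - 1) * (t - s))) * ennreal (exp (- k * c * s))) * ?G"
            by (simp only: mult.assoc)
          also have "\<dots> = ennreal (exp (- \<rho> * t) / \<rho>) * ?G * ennreal (\<rho> * exp (\<rho> * s))"
            unfolding * by (simp only: ac_simps)
          finally show ?thesis
            using True by simp
        qed simp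
      qed
      also have "\<dots> = ennreal (exp (- \<rho> * t) / \<rho>) * ?G * ennreal (exp (\<rho> * t) - 1)"
        using \<rho>0 t by (subst nn_integral_cmult) (auto simp: nn_integral_exp_Ioo)
      also have "\<dots> = ennreal (exp (- \<rho> * t) / \<rho> * ((1 - e) * D + A) * (exp (\<rho> * t) - 1))"
      proof -
        have "0 \<le> exp (- \<rho> * t) / \<rho>" "0 \<le> exp (\<rho> * t) - 1"
          using \<rho>0 t by auto
        with A show ?thesis
          by (simp only: ennreal_mult mult_nonneg_nonneg)
      qed
      also have "\<dots> \<le> ennreal (((1 - e) * D + A) / \<rho>)"
      proof (rule ennreal_leI)
        have "x / \<rho> * z * (y - 1) = z / \<rho> * (x * y - x)" for x y z
          using \<rho>0 by (simp add: field_simps)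
        then have "exp (- \<rho> * t) / \<rho> * ((1 - e) * D + A) * (exp (\<rho> * t) - 1) =
            ((1 - e) * D + A) / \<rho> * (exp (- \<rho> * t) * exp (\<rho> * t) - exp (- \<rho> * t))" .
        also have "\<dots> \<le> ((1 - e) * D + A) / \<rho> * 1"
          using \<rho>0 A by (intro mult_left_mono) (auto simp: mult_exp_exp)
        finally show "exp (- \<rho> * t) / \<rho> * ((1 - e) * D + A) * (exp (\<rho> * t) - 1) \<le> ((1 - e) * D + A) / \<rho>"
          by simp
      qed
      also have "ennreal 1 + ennreal (((1 - e) * D + A) / \<rho>) = ennreal (1 + A / \<rho> + \<theta> * D)"
      proof -
        have "0 \<le> ((1 - e) * D + A) / \<rho>"
          using \<rho>0 A by simp
        then have "ennreal 1 + ennreal (((1 - e) * D + A) / \<rho>) = ennreal (1 + ((1 - e) * D + A) / \<rho>)"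
          by (intro ennreal_plus[symmetric]) auto
        also have "1 + ((1 - e) * D + A) / \<rho> = 1 + A / \<rho> + \<theta> * D"
          by (simp add: \<theta>_def add_divide_distrib)
        finally show ?thesis .
      qed
      finally show ?thesis
        by (simp add: add_mono)
    qed
    \<comment> \<open>The fixed point of the affine map
      \<open>D \<mapsto> 1 + A / \<rho> + \<theta> * D\<close> from \<open>H_step\<close>.\<close>
    define C where "C = (1 + A / \<rho>) / (1 - \<theta>)"
    have C: "1 + A / \<rho> + \<theta> * C = C" "1 \<le> C"
    proof -
      have "C * (1 - \<theta>) = 1 + A / \<rho>"
        using \<theta> by (simp add: C_def)
      then show "1 + A / \<rho> + \<theta> * C = C"
        by (simp add: algebra_simps)
      have "0 \<le> A / \<rho>"
        using \<rho>0 by (simp add: A_def)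
      then have "1 * (1 - \<theta>) \<le> 1 + A / \<rho>"
        using \<theta> add_mono[of "1 - \<theta>" 1 0 "A / \<rho>"] by simp
      then show "1 \<le> C"
        unfolding C_def using \<theta> by (subst pos_le_divide_eq) auto
    qed
    have "H t \<le> ennreal C" if t: "0 < t" for t
    proof -
      \<comment> \<open>A crude bound of \<open>H\<close> on the finite horizon up to
        \<open>t\<close>. It may depend on \<open>t\<close>, since its share in the estimate is
        multiplied by \<theta> in each iteration and disappears in the limit.\<close>
      define D0 where "D0 = exp (k * c * t) * exp (k\<^sup>2 * t / 2)"
      have H0: "H s \<le> ennreal D0" if s: "0 < s" "s \<le> t" for s
      proof -
        have "H s \<le> ennreal (exp (k * c * s)) * ennreal (exp (k\<^sup>2 * s / 2))"
          unfolding H_def using exp_moment_le[OF k(1) s(1)] by (intro mult_left_mono) auto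
        also have "\<dots> \<le> ennreal D0"
          unfolding D0_def using s k c
          by (subst ennreal_mult[symmetric]) (auto intro!: ennreal_leI mult_mono)
        finally show ?thesis .
      qed
      have iter: "H s \<le> ennreal (C + \<theta> ^ n * D0)" if s: "0 < s" "s \<le> t" for n s
        using s
      proof (induction n arbitrary: s)
        case 0
        then show ?case
          using order_trans[OF H0[OF 0] ennreal_leI[of D0 "C + D0"]] C by simp
      next
        case (Suc n)
        have "H s \<le> ennreal (1 + A / \<rho> + \<theta> * (C + \<theta> ^ n * D0))"
          using Suc C \<theta> by (intro H_step) (auto simp: D0_def)
        also have "1 + A / \<rho> + \<theta> * (C + \<theta> ^ n * D0) = C + \<theta> ^ Suc n * D0"
          using C(1) by (simp add: algebra_simps)
        finally show ?case .
      qed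
      have "(\<lambda>n. ennreal (C + \<theta> ^ n * D0)) \<longlonglongrightarrow> ennreal (C + 0 * D0)"
        using \<theta> by (intro tendsto_intros tendsto_ennrealI LIMSEQ_power_zero) auto
      then show ?thesis
        using iter[OF t order_refl] by (intro LIMSEQ_le_const) auto
    qed
    note HC = this
    have "exp_moment k t \<le> ennreal (C * exp (- k * c * t))" if t: "0 \<le> t" for t
    proof (cases "t = 0")
      case True
      then show ?thesis
        using C by (simp add: exp_moment_0)
    next
      case False
      with t have t: "0 < t"
        by simp
      have "exp_moment k t = ennreal (exp (- k * c * t)) * H t"
        by (simp add: H_def mult.assoc[symmetric] ennreal_mult[symmetric] mult_exp_exp)
      also have "\<dots> \<le> ennreal (exp (- k * c * t)) * ennreal C"
        using HC[OF t] by (intro mult_left_mono) auto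
      finally show ?thesis
        using C by (simp add: ennreal_mult[symmetric] mult.commute)
    qed
    then show ?thesis
      using C by (intro exI[of _ C]) auto
  qed
  ultimately show ?thesis
    using that by blast
qed

section \<open>Doubling the exponent\<close>

lemma exp_moment_double:
  assumes k: "0 \<le> k" and C: "0 \<le> C" and bound: "\<And>s. 0 \<le> s \<Longrightarrow> exp_moment k s \<le> ennreal (C * exp (a * s))"
    and b: "2 * k\<^sup>2 - 1 < b" "2 * a < b"
  obtains C' where "0 \<le> C'" "\<And>t. 0 \<le> t \<Longrightarrow> exp_moment (2 * k) t \<le> ennreal (C' * exp (b * t))"
proof -
  \<comment> \<open>The integral convolves the rates \<open>2 * k^2 - 1\<close> and
    \<open>2 * a\<close>. If they coincide, a factor \<open>t\<close> appears; bounding both by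
    \<open>m\<close> accepts this factor and absorbs it in \<open>exp ((b - m) * t)\<close>.\<close>
  define m where "m = max (2 * k\<^sup>2 - 1) (2 * a)"
  have m: "m < b" "2 * k\<^sup>2 - 1 \<le> m" "2 * a \<le> m"
    using b by (auto simp: m_def)
  define C' where "C' = 1 + C\<^sup>2 / (b - m)"
  have C': "1 \<le> C'"
    using m by (simp add: C'_def)
  have "exp_moment (2 * k) t \<le> ennreal (C' * exp (b * t))" if t: "0 < t" for t
  proof -
    have pair: "indicator {0<..<t} s * ennreal (exp ((2 * k\<^sup>2 - 1) * (t - s))) * max_pair_moment (2 * k) s \<le>
        ennreal (C\<^sup>2 * exp (m * t)) * indicator {0<..<t} s" for s
    proof (cases "s \<in> {0<..<t}")
      case True
      have "max_pair_moment (2 * k) s \<le> (ennreal (C * exp (a * s)))\<^sup>2"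
        using True by (intro order_trans[OF max_pair_moment_le_square[OF k]] power_mono bound) auto
      also have "\<dots> = ennreal (C\<^sup>2 * exp (2 * a * s))"
        using C by (simp add: ennreal_power power_mult_distrib exp_double[symmetric] mult.assoc)
      finally have "ennreal (exp ((2 * k\<^sup>2 - 1) * (t - s))) * max_pair_moment (2 * k) s \<le>
          ennreal (exp ((2 * k\<^sup>2 - 1) * (t - s))) * ennreal (C\<^sup>2 * exp (2 * a * s))"
        by (intro mult_left_mono) auto
      also have "\<dots> = ennreal (C\<^sup>2 * (exp ((2 * k\<^sup>2 - 1) * (t - s)) * exp (2 * a * s)))"
        by (subst ennreal_mult[symmetric]) (auto simp: ac_simps)
      also have "\<dots> \<le> ennreal (C\<^sup>2 * (exp (m * (t - s)) * exp (m * s)))"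
        using True m by (intro ennreal_leI mult_left_mono mult_mono) (auto intro: mult_right_mono)
      also have "exp (m * (t - s)) * exp (m * s) = exp (m * t)"
        by (simp add: mult_exp_exp algebra_simps)
      finally show ?thesis
        using True by simp
    next
      case False
      then show ?thesis
        by (auto simp: indicator_def)
    qed
    have "exp_moment (2 * k) t = ennreal (exp ((2 * k\<^sup>2 - 1) * t)) +
      (\<integral>\<^sup>+s. indicator {0<..<t} s * ennreal (exp ((2 * k\<^sup>2 - 1) * (t - s))) * max_pair_moment (2 * k) s \<partial>lborel)"
      using exp_moment_recursion[OF t, of "2 * k"] by (simp add: power_mult_distrib)
    also have "\<dots> \<le> ennreal (exp (b * t)) + (\<integral>\<^sup>+s. ennreal (C\<^sup>2 * exp (m * t)) * indicator {0<..<t} s \<partial>lborel)"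
      using b t by (intro add_mono nn_integral_mono pair ennreal_leI) (auto intro: mult_right_mono)
    also have "(\<integral>\<^sup>+s. ennreal (C\<^sup>2 * exp (m * t)) * indicator {0<..<t} s \<partial>lborel) = ennreal (C\<^sup>2 * exp (m * t) * t)"
      using t by (simp add: nn_integral_cmult ennreal_mult)
    also have "\<dots> \<le> ennreal (C\<^sup>2 / (b - m) * exp (b * t))"
    proof (rule ennreal_leI)
      have "(b - m) * t \<le> exp ((b - m) * t)"
        using exp_ge_add_one_self[of "(b - m) * t"] by linarith
      then have "t \<le> exp ((b - m) * t) / (b - m)"
        using m by (simp add: field_simps)
      then have "C\<^sup>2 * exp (m * t) * t \<le> C\<^sup>2 * exp (m * t) * (exp ((b - m) * t) / (b - m))"
        by (intro mult_left_mono) auto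
      also have "\<dots> = C\<^sup>2 / (b - m) * (exp (m * t) * exp ((b - m) * t))"
        by simp
      also have "exp (m * t) * exp ((b - m) * t) = exp (b * t)"
        by (simp add: mult_exp_exp algebra_simps)
      finally show "C\<^sup>2 * exp (m * t) * t \<le> C\<^sup>2 / (b - m) * exp (b * t)" .
    qed
    also have "ennreal (exp (b * t)) + ennreal (C\<^sup>2 / (b - m) * exp (b * t)) = ennreal (C' * exp (b * t))"
      using m by (subst ennreal_plus[symmetric]) (auto simp: C'_def algebra_simps)
    finally show ?thesis
      by (simp add: add_left_mono)
  qed
  then have "exp_moment (2 * k) t \<le> ennreal (C' * exp (b * t))" if "0 \<le> t" for t
    using that C' by (cases "t = 0") (auto simp: exp_moment_0)
  with C' show ?thesis
    by (intro that[of C']) auto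
qed

text \<open>Induction on the number of halvings that bring \<open>k\<close> below the range of
  \<open>exp_moment_small\<close>. The hypotheses pass from \<open>(k, b)\<close> to
  \<open>(k / 2, b / 2)\<close>: the first is linear, and the second follows from
  \<open>k^2 / 8 - 1 \<le> k^2 / 4 - 1/2\<close>. The strict inequalities leave room for an
  intermediate rate \<open>a\<close> at every halving.\<close>

lemma exp_moment_bound:
  assumes c: "0 \<le> c" "c < sqrt 2" and k: "0 < k" and b: "- k * c < b" "k\<^sup>2 / 2 - 1 < b"
  shows "\<exists>C\<ge>0. \<forall>t\<ge>0. exp_moment k t \<le> ennreal (C * exp (b * t))"
proof -
  obtain k0 where k0: "0 < k0"
    "\<And>k. 0 < k \<Longrightarrow> k < k0 \<Longrightarrow> \<exists>C\<ge>0. \<forall>t\<ge>0. exp_moment k t \<le> ennreal (C * exp (- k * c * t))"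
    using exp_moment_small[OF c] by blast
  obtain j where "k / k0 < 2 ^ j"
    using real_arch_pow[of 2 "k / k0"] by auto
  then have "k / 2 ^ j < k0"
    using k0 by (simp add: field_simps)
  then show ?thesis
    using k b
  proof (induction j arbitrary: k b)
    case 0
    then obtain C where C: "0 \<le> C" "\<And>t. 0 \<le> t \<Longrightarrow> exp_moment k t \<le> ennreal (C * exp (- k * c * t))"
      using k0(2)[of k] by auto
    have "exp_moment k t \<le> ennreal (C * exp (b * t))" if "0 \<le> t" for t
      using that C 0 mult_right_mono[of "- k * c" b t]
      by (intro order_trans[OF C(2)[OF that]] ennreal_leI mult_left_mono) auto
    with C show ?case
      by auto
  next
    case (Suc j)
    have "- (k / 2) * c < b / 2"
      using Suc.prems(3) by simp
    moreover have "(k / 2)\<^sup>2 / 2 - 1 < b / 2"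
    proof -
      have "(k / 2)\<^sup>2 = k\<^sup>2 / 4"
        by (simp add: power_divide)
      then show ?thesis
        using Suc.prems(4) zero_le_power2[of k] by linarith
    qed
    ultimately have "max (- (k / 2) * c) ((k / 2)\<^sup>2 / 2 - 1) < b / 2"
      unfolding max_less_iff_conj ..
    then obtain a where "max (- (k / 2) * c) ((k / 2)\<^sup>2 / 2 - 1) < a" "a < b / 2"
      using dense by blast
    then have a: "- (k / 2) * c < a" "(k / 2)\<^sup>2 / 2 - 1 < a" "2 * a < b"
      by simp_all
    have "\<exists>C\<ge>0. \<forall>t\<ge>0. exp_moment (k / 2) t \<le> ennreal (C * exp (a * t))"
      using Suc.prems a by (intro Suc.IH) (auto simp: mult.commute)
    then obtain C where C: "0 \<le> C" "\<And>t. 0 \<le> t \<Longrightarrow> exp_moment (k / 2) t \<le> ennreal (C * exp (a * t))"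
      by auto
    have "2 * (k / 2)\<^sup>2 - 1 < b"
      using Suc.prems by (simp add: power_divide)
    from exp_moment_double[OF _ C this a(3)] show ?case
      using Suc.prems by auto
  qed
qed

lemma exp_moment_critical:
  assumes \<alpha>: "\<alpha> < - \<gamma>"
  obtains C b where "0 \<le> C" "2 * b < \<alpha>\<^sup>2 - 1"
    "\<And>t. 0 \<le> t \<Longrightarrow> exp_moment (- \<alpha> / sqrt 2) t \<le> ennreal (C * exp (b * t))"
proof -
  define k where "k = - \<alpha> / sqrt 2"
  have sqrt2: "1 < sqrt (2 :: real)"
    by simp
  with \<alpha> have \<alpha>_neg: "\<alpha> < 0"
    unfolding \<gamma>_def by linarith
  then have k: "0 < k"
    by (simp add: k_def divide_neg_pos)
  have \<alpha>k: "\<alpha> = - sqrt 2 * k"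
    by (simp add: k_def)
  then have \<alpha>2: "\<alpha>\<^sup>2 = 2 * k\<^sup>2"
    by (simp add: power_mult_distrib)
  \<comment> \<open>The roots of \<open>\<alpha>^2 - 2 * \<alpha> - 1\<close> are
    \<open>1 - sqrt 2 = - \<gamma>\<close> and \<open>1 + sqrt 2\<close>; both factors are positive
    to the left of the smaller root.\<close>
  have "0 < - \<alpha> - (sqrt 2 - 1)" "0 < - \<alpha> + (sqrt 2 + 1)"
    using \<alpha> \<alpha>_neg sqrt2 unfolding \<gamma>_def by linarith+
  then have "0 < (- \<alpha> - (sqrt 2 - 1)) * (- \<alpha> + (sqrt 2 + 1))"
    by (rule mult_pos_pos)
  also have "\<dots> = \<alpha>\<^sup>2 - 2 * \<alpha> - 1"
    by (simp add: power2_eq_square algebra_simps)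
  also have "\<dots> = 2 * k\<^sup>2 + 2 * (sqrt 2 * k) - 1"
    unfolding \<alpha>2 unfolding \<alpha>k by simp
  finally have "1 / 2 - k\<^sup>2 < sqrt 2 * k"
    by simp
  then have "(1 / 2 - k\<^sup>2) / k < sqrt 2"
    using k by (simp only: pos_divide_less_eq)
  then obtain q where q: "(1 / 2 - k\<^sup>2) / k < q" "q < sqrt 2"
    using dense by blast
  \<comment> \<open>For large \<open>k\<close> the required speed is negative, while the speed
    estimate is stated for nonnegative speeds.\<close>
  define c where "c = max 0 q"
  have c: "0 \<le> c" "c < sqrt 2" "(1 / 2 - k\<^sup>2) / k < c"
    using q by (simp_all add: c_def less_max_iff_disj)
  have m: "max (- k * c) (k\<^sup>2 / 2 - 1) < k\<^sup>2 - 1 / 2"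
  proof -
    have "1 / 2 - k\<^sup>2 < c * k"
      using c(3) k by (simp only: pos_divide_less_eq)
    then have "- k * c < k\<^sup>2 - 1 / 2"
      by (simp add: mult.commute)
    moreover have "k\<^sup>2 / 2 - 1 < k\<^sup>2 - 1 / 2"
      using zero_le_power2[of k] by linarith
    ultimately show ?thesis
      by simp
  qed
  then obtain b where "max (- k * c) (k\<^sup>2 / 2 - 1) < b" "b < k\<^sup>2 - 1 / 2"
    using dense by blast
  then have b: "- k * c < b" "k\<^sup>2 / 2 - 1 < b" "b < k\<^sup>2 - 1 / 2"
    by simp_all
  obtain C where "0 \<le> C" "\<And>t. 0 \<le> t \<Longrightarrow> exp_moment k t \<le> ennreal (C * exp (b * t))"
    using exp_moment_bound[OF c(1,2) k b(1,2)] by auto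
  moreover have "2 * b < \<alpha>\<^sup>2 - 1"
    using b(3) unfolding \<alpha>2 by simp
  ultimately show ?thesis
    using that[of C b] unfolding k_def by blast
qed

end

section \<open>Asymptotics of the lower tail\<close>

text \<open>The time \<open>s\<close> left after the first branching is \<open>0\<close> with positive probability. To stay within
  Lebesgue measure, \<open>s\<close> ranges over \<open>(-1, t)\<close> and only \<open>max 0 s\<close> is used: the unit interval
  \<open>(-1, 0]\<close> carries the atom.\<close>

definition limit_weight :: "real \<Rightarrow> real \<Rightarrow> real \<Rightarrow> real" where
  "limit_weight \<alpha> s y = indicator {-1<..} s * exp ((1 - \<alpha>\<^sup>2) * max 0 s + sqrt 2 * \<alpha> * y)"

text \<open>After multiplication by \<open>norming\<close>, this is the density of remaining time
  and distance at time \<open>t\<close>; see \<open>norming_density\<close>. The two factors next to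
  \<open>limit_weight\<close> tend to 1, but the square root blows up as \<open>s\<close> approaches
  \<open>t\<close>.\<close>

definition weight :: "real \<Rightarrow> real \<Rightarrow> real \<Rightarrow> real \<Rightarrow> real" where
  "weight \<alpha> t s y = (if s < t then limit_weight \<alpha> s y * sqrt (t / (t - max 0 s)) *
     exp (- (sqrt 2 * \<alpha> * max 0 s - y)\<^sup>2 / (2 * (t - max 0 s))) else 0)"

definition norming :: "real \<Rightarrow> real \<Rightarrow> real" where
  "norming \<alpha> t = sqrt (2 * pi * t) * exp ((1 + \<alpha>\<^sup>2) * t)"

lemma measurable_limit_weight [measurable (raw)]:
  assumes [measurable]: "f \<in> borel_measurable N" "g \<in> borel_measurable N"
  shows "(\<lambda>x. limit_weight \<alpha> (f x) (g x)) \<in> borel_measurable N"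
  unfolding limit_weight_def by measurable

lemma measurable_weight [measurable (raw)]:
  assumes [measurable]: "f \<in> borel_measurable N" "g \<in> borel_measurable N"
  shows "(\<lambda>x. weight \<alpha> t (f x) (g x)) \<in> borel_measurable N"
  unfolding weight_def by measurable

lemma limit_weight_nonneg: "0 \<le> limit_weight \<alpha> s y"
  by (simp add: limit_weight_def)

lemma weight_nonneg: "0 < t \<Longrightarrow> 0 \<le> weight \<alpha> t s y"
  by (simp add: weight_def limit_weight_nonneg)

lemma norming_density:
  assumes "0 < t" "s < t"
  shows "norming \<alpha> t * (indicator {-1<..} s * exp (- (t - max 0 s)) *
      normal_density 0 (sqrt (t - max 0 s)) (sqrt 2 * \<alpha> * t - y)) = weight \<alpha> t s y"
proof -
  define r where "r = max 0 s"
  have r: "r < t" "0 < t - r"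
    using assms by (auto simp: r_def)
  \<comment> \<open>Expand around the main term \<open>sqrt 2 * \<alpha> * (t - r)\<close>. Its
    square gives the exponential order in \<open>t - r\<close>, the cross term is linear in
    \<open>y\<close> and becomes part of the limit weight, and the remaining square is divided by
    \<open>t - r\<close>.\<close>
  have "(sqrt 2 * \<alpha> * t - y)\<^sup>2 = (sqrt 2 * \<alpha> * (t - r) + (sqrt 2 * \<alpha> * r - y))\<^sup>2"
    by (simp add: algebra_simps)
  also have "\<dots> = 2 * \<alpha>\<^sup>2 * (t - r)\<^sup>2 + 2 * (sqrt 2 * \<alpha> * (t - r)) * (sqrt 2 * \<alpha> * r - y) + (sqrt 2 * \<alpha> * r - y)\<^sup>2"
    by (simp add: power2_sum power_mult_distrib)
  finally have "(sqrt 2 * \<alpha> * t - y)\<^sup>2 / (2 * (t - r)) =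
      (2 * \<alpha>\<^sup>2 * (t - r)\<^sup>2 + 2 * (sqrt 2 * \<alpha> * (t - r)) * (sqrt 2 * \<alpha> * r - y) + (sqrt 2 * \<alpha> * r - y)\<^sup>2) / (2 * (t - r))"
    by (rule arg_cong)
  also have "\<dots> = \<alpha>\<^sup>2 * (t - r) + (sqrt 2 * \<alpha>) * (sqrt 2 * \<alpha> * r - y) + (sqrt 2 * \<alpha> * r - y)\<^sup>2 / (2 * (t - r))"
  proof -
    have "(2 * \<alpha>\<^sup>2 * q\<^sup>2 + 2 * (sqrt 2 * \<alpha> * q) * z + z\<^sup>2) / (2 * q) = \<alpha>\<^sup>2 * q + (sqrt 2 * \<alpha>) * z + z\<^sup>2 / (2 * q)"
      if "0 < q" for q z :: real
      using that by (simp add: field_simps power2_eq_square)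
    with r(2) show ?thesis
      by blast
  qed
  also have "(sqrt 2 * \<alpha>) * (sqrt 2 * \<alpha> * r - y) = 2 * \<alpha>\<^sup>2 * r - sqrt 2 * \<alpha> * y"
    by (simp add: algebra_simps power2_eq_square)
  finally have *: "(1 + \<alpha>\<^sup>2) * t + - (t - r) + - (sqrt 2 * \<alpha> * t - y)\<^sup>2 / (2 * (t - r)) =
      (1 - \<alpha>\<^sup>2) * r + sqrt 2 * \<alpha> * y + - (sqrt 2 * \<alpha> * r - y)\<^sup>2 / (2 * (t - r))"
    by (simp add: algebra_simps)
  have e: "exp ((1 + \<alpha>\<^sup>2) * t) * exp (- (t - r)) * exp (- (sqrt 2 * \<alpha> * t - y)\<^sup>2 / (2 * (t - r))) =
      exp ((1 - \<alpha>\<^sup>2) * r + sqrt 2 * \<alpha> * y) * exp (- (sqrt 2 * \<alpha> * r - y)\<^sup>2 / (2 * (t - r)))"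
    unfolding mult_exp_exp * ..
  have n: "normal_density 0 (sqrt (t - r)) (sqrt 2 * \<alpha> * t - y) =
      exp (- (sqrt 2 * \<alpha> * t - y)\<^sup>2 / (2 * (t - r))) / sqrt (2 * pi * (t - r))"
    using r by (simp add: normal_density_def)
  have q: "sqrt (2 * pi * t) / sqrt (2 * pi * (t - r)) = sqrt (t / (t - r))"
    using r by (simp add: real_sqrt_divide real_sqrt_mult)
  have "norming \<alpha> t * (indicator {-1<..} s * exp (- (t - r)) * normal_density 0 (sqrt (t - r)) (sqrt 2 * \<alpha> * t - y)) =
      indicator {-1<..} s * (sqrt (2 * pi * t) / sqrt (2 * pi * (t - r))) *
      (exp ((1 + \<alpha>\<^sup>2) * t) * exp (- (t - r)) * exp (- (sqrt 2 * \<alpha> * t - y)\<^sup>2 / (2 * (t - r))))"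
    unfolding norming_def n by simp
  also have "\<dots> = weight \<alpha> t s y"
    unfolding e q weight_def limit_weight_def r_def[symmetric] using assms by simp
  finally show ?thesis
    unfolding r_def .
qed

context branching_brownian_motion
begin

definition joint :: "(real \<times> real \<times> tree_data \<times> tree_data) measure" where
  "joint = lborel \<Otimes>\<^sub>M (lborel \<Otimes>\<^sub>M (\<mu> \<Otimes>\<^sub>M \<mu>))"

lemma sets_joint [measurable_cong]: "sets joint = sets (borel \<Otimes>\<^sub>M (borel \<Otimes>\<^sub>M (borel \<Otimes>\<^sub>M borel)))"
  unfolding joint_def by (intro sets_pair_measure_cong) auto

lemma space_joint [simp]: "space joint = UNIV"
  by (simp add: joint_def space_pair_measure)

lemma nn_integral_joint:
  assumes [measurable]: "f \<in> borel_measurable (borel \<Otimes>\<^sub>M (borel \<Otimes>\<^sub>M (borel \<Otimes>\<^sub>M borel)))"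
  shows "(\<integral>\<^sup>+z. f z \<partial>joint) = (\<integral>\<^sup>+s. (\<integral>\<^sup>+y. (\<integral>\<^sup>+y1. (\<integral>\<^sup>+y2. f (s, y, y1, y2) \<partial>\<mu>) \<partial>\<mu>) \<partial>lborel) \<partial>lborel)"
proof -
  interpret \<mu>: prob_space \<mu>
    by (rule prob_space_tree_law)
  interpret MM: pair_prob_space \<mu> \<mu> ..
  have LM: "sigma_finite_measure (lborel \<Otimes>\<^sub>M (\<mu> \<Otimes>\<^sub>M \<mu>))"
    by (intro sigma_finite_pair_measure sigma_finite_lborel \<mu>.sigma_finite_measure_axioms)
  show ?thesis
    unfolding joint_def
    by (simp add: sigma_finite_measure.nn_integral_fst[OF LM, symmetric] MM.nn_integral_fst[symmetric] \<mu>.nn_integral_fst[symmetric])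
qed

definition below :: "real \<times> real \<times> tree_data \<times> tree_data \<Rightarrow> bool" where
  "below = (\<lambda>(s, y, y1, y2). max\<^sub>0 (max 0 s) y1 \<le> y \<and> max\<^sub>0 (max 0 s) y2 \<le> y)"

lemma measurable_below [measurable]: "Measurable.pred (borel \<Otimes>\<^sub>M (borel \<Otimes>\<^sub>M (borel \<Otimes>\<^sub>M borel))) below"
  unfolding below_def by measurable

definition branching_data :: "real \<Rightarrow> real \<Rightarrow> 'w \<Rightarrow> real \<times> real \<times> tree_data \<times> tree_data" where
  "branching_data c t \<omega> = (t - min t (L [] \<omega>), c - B [] (min t (L [] \<omega>)) \<omega>,
     subtree False (tree_data_of L B \<omega>), subtree True (tree_data_of L B \<omega>))"

lemma sets_max_below [measurable]: "max_below M L B z t \<in> sets M"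
proof -
  have [measurable]: "tree_data_of L B \<in> M \<rightarrow>\<^sub>M borel"
    by (rule measurable_tree_data)
  have "max_below M L B z t = {\<omega> \<in> space M. max\<^sub>0 t (tree_data_of L B \<omega>) \<le> z}"
    by (auto simp: max_below_def max_position_tree_data)
  also have "\<dots> \<in> sets M"
    by measurable
  finally show ?thesis .
qed

lemma max_below_iff:
  assumes "0 < t"
  shows "AE \<omega> in M. \<omega> \<in> max_below M L B c t \<longleftrightarrow> below (branching_data c t \<omega>)"
  using max_decomposition[OF assms] AE_space[of M] 
proof eventually_elim
  case (elim \<omega>)
  have "max 0 (t - min t (L [] \<omega>)) = t - min t (L [] \<omega>)"
    by simp
  moreover have "x + max a b \<le> c \<longleftrightarrow> a \<le> c - x \<and> b \<le> c - x" for x a b :: real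
    by (auto simp: max_def)
  ultimately show ?case
    using elim by (simp add: max_below_def below_def branching_data_def max_position_tree_data[symmetric])
qed

text \<open>Turns an expectation on the conditioning event into an integral against the fixed
  reference measure \<open>joint\<close>. The horizon \<open>t\<close> enters the right-hand side
  only through \<open>weight\<close>, so limits can be taken under one integral. \<open>F\<close> is
  evaluated at \<open>max 0 s\<close> because the atom has been spread over a unit interval.\<close>

lemma nn_integral_branching_data:
  fixes F :: "real \<times> real \<times> tree_data \<times> tree_data \<Rightarrow> ennreal" and \<alpha> t :: real
  assumes t: "0 < t" and F [measurable]: "F \<in> borel_measurable (borel \<Otimes>\<^sub>M (borel \<Otimes>\<^sub>M (borel \<Otimes>\<^sub>M borel)))"
  defines "c \<equiv> sqrt 2 * \<alpha> * t"
  shows "ennreal (norming \<alpha> t) * (\<integral>\<^sup>+\<omega>. indicator (max_below M L B c t) \<omega> * F (branching_data c t \<omega>) \<partial>M) =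
    (\<integral>\<^sup>+(s, y, y1, y2). ennreal (weight \<alpha> t s y) * (of_bool (below (s, y, y1, y2)) * F (max 0 s, y, y1, y2)) \<partial>joint)"
proof -
  interpret \<mu>: prob_space \<mu>
    by (rule prob_space_tree_law)
  let ?F = "\<lambda>z. of_bool (below z) * F z"
  define g where "g = (\<lambda>(s, x, y1, y2). ?F (s, c - x, y1, y2))"
  have [measurable]: "g \<in> borel_measurable (borel \<Otimes>\<^sub>M (borel \<Otimes>\<^sub>M (borel \<Otimes>\<^sub>M borel)))"
    unfolding g_def by measurable
  define G where "G s y = (\<integral>\<^sup>+y1. (\<integral>\<^sup>+y2. ?F (s, y, y1, y2) \<partial>\<mu>) \<partial>\<mu>)" for s y
  have G [measurable]: "(\<lambda>z. G (f z) (h z)) \<in> borel_measurable N"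
    if [measurable]: "f \<in> borel_measurable N" "h \<in> borel_measurable N" for f h and N :: "'n measure"
    unfolding G_def by measurable
  define H where "H s r = (\<integral>\<^sup>+y. ennreal (normal_density 0 (sqrt r) (c - y)) * G s y \<partial>lborel)" for s r
  have [measurable]: "(\<lambda>z. H (f z) (h z)) \<in> borel_measurable N"
    if [measurable]: "f \<in> borel_measurable N" "h \<in> borel_measurable N" for f h and N :: "'n measure"
    unfolding H_def by measurable
  have H: "(\<integral>\<^sup>+x. ennreal (normal_density 0 (sqrt r) x) * (\<integral>\<^sup>+y1. (\<integral>\<^sup>+y2. g (s, x, y1, y2) \<partial>\<mu>) \<partial>\<mu>) \<partial>lborel) = H s r" for s r
    unfolding H_def g_def prod.case G_def[symmetric]
    by (subst nn_integral_real_affine[where c = "-1" and t = c]) auto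
  have "(\<integral>\<^sup>+\<omega>. indicator (max_below M L B c t) \<omega> * F (branching_data c t \<omega>) \<partial>M) =
      (\<integral>\<^sup>+\<omega>. g (t - min t (L [] \<omega>), B [] (min t (L [] \<omega>)) \<omega>,
        subtree False (tree_data_of L B \<omega>), subtree True (tree_data_of L B \<omega>)) \<partial>M)"
    using max_below_iff[OF t, of c]
    by (intro nn_integral_cong_AE) (auto elim!: eventually_mono simp: g_def branching_data_def indicator_def)
  also have "\<dots> = ennreal (exp (- t)) * H 0 t + (\<integral>\<^sup>+s. indicator {0<..<t} s * ennreal (exp (- (t - s))) * H s (t - s) \<partial>lborel)"
    unfolding nn_integral_branching[OF t \<open>g \<in> _\<close>] H ..
  also have "\<dots> = (\<integral>\<^sup>+s. indicator {-1<..<t} s * ennreal (exp (- (t - max 0 s))) * H (max 0 s) (t - max 0 s) \<partial>lborel)"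
  proof -
    have "(\<integral>\<^sup>+s. indicator {-1<..<t} s * ennreal (exp (- (t - max 0 s))) * H (max 0 s) (t - max 0 s) \<partial>lborel) =
      (\<integral>\<^sup>+s. (ennreal (exp (- t)) * H 0 t) * indicator {-1<..0} s + indicator {0<..<t} s * ennreal (exp (- (t - s))) * H s (t - s) \<partial>lborel)"
      using t by (intro nn_integral_cong) (auto simp: indicator_def max_def)
    also have "\<dots> = ennreal (exp (- t)) * H 0 t + (\<integral>\<^sup>+s. indicator {0<..<t} s * ennreal (exp (- (t - s))) * H s (t - s) \<partial>lborel)"
      by (subst nn_integral_add) (auto simp: nn_integral_cmult)
    finally show ?thesis ..
  qed
  finally have "ennreal (norming \<alpha> t) * (\<integral>\<^sup>+\<omega>. indicator (max_below M L B c t) \<omega> * F (branching_data c t \<omega>) \<partial>M) =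
      (\<integral>\<^sup>+s. ennreal (norming \<alpha> t) * (indicator {-1<..<t} s * ennreal (exp (- (t - max 0 s))) * H (max 0 s) (t - max 0 s)) \<partial>lborel)"
    by (simp add: nn_integral_cmult)
  also have "\<dots> = (\<integral>\<^sup>+s. (\<integral>\<^sup>+y. ennreal (weight \<alpha> t s y) * G (max 0 s) y \<partial>lborel) \<partial>lborel)"
  proof (rule nn_integral_cong)
    fix s
    show "ennreal (norming \<alpha> t) * (indicator {-1<..<t} s * ennreal (exp (- (t - max 0 s))) * H (max 0 s) (t - max 0 s)) =
        (\<integral>\<^sup>+y. ennreal (weight \<alpha> t s y) * G (max 0 s) y \<partial>lborel)"
    proof (cases "s < t")
      case True
      have "ennreal (norming \<alpha> t) * (indicator {-1<..<t} s * ennreal (exp (- (t - max 0 s))) * ennreal (normal_density 0 (sqrt (t - max 0 s)) (c - y))) =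
          ennreal (weight \<alpha> t s y)" for y
        unfolding norming_density[OF t True, symmetric] c_def[symmetric] using True t
        by (cases "-1 < s") (auto simp: ennreal_mult norming_def)
      then have "ennreal (weight \<alpha> t s y) * G (max 0 s) y =
        ennreal (norming \<alpha> t) * (indicator {-1<..<t} s * ennreal (exp (- (t - max 0 s)))) *
          (ennreal (normal_density 0 (sqrt (t - max 0 s)) (c - y)) * G (max 0 s) y)" for y
        by (metis (no_types, lifting) mult.assoc)
      then show ?thesis
        unfolding H_def by (simp add: nn_integral_cmult mult.assoc)
    qed (simp add: weight_def)
  qed
  also have "\<dots> = (\<integral>\<^sup>+(s, y, y1, y2). ennreal (weight \<alpha> t s y) * ?F (max 0 s, y, y1, y2) \<partial>joint)"
    unfolding G_def by (subst nn_integral_joint) (auto simp: nn_integral_cmult)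
  finally show ?thesis
    by (simp add: below_def)
qed

end

section \<open>Pointwise limit and domination of the weights\<close>

lemma sqrt_exp_tendsto_1:
  fixes r D :: real
  shows "((\<lambda>t. sqrt (t / (t - r)) * exp (- D / (2 * (t - r)))) \<longlongrightarrow> 1) at_top"
  by real_asymp

lemma weight_tendsto: "((\<lambda>t. weight \<alpha> t s y) \<longlongrightarrow> limit_weight \<alpha> s y) at_top"
proof -
  have "((\<lambda>t. limit_weight \<alpha> s y * (sqrt (t / (t - max 0 s)) *
      exp (- (sqrt 2 * \<alpha> * max 0 s - y)\<^sup>2 / (2 * (t - max 0 s))))) \<longlongrightarrow> limit_weight \<alpha> s y * 1) at_top"
    by (intro tendsto_intros sqrt_exp_tendsto_1)
  moreover have "\<forall>\<^sub>F t in at_top. limit_weight \<alpha> s y * (sqrt (t / (t - max 0 s)) *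
      exp (- (sqrt 2 * \<alpha> * max 0 s - y)\<^sup>2 / (2 * (t - max 0 s)))) = weight \<alpha> t s y"
    using eventually_gt_at_top[of s] by eventually_elim (simp add: weight_def)
  ultimately have "((\<lambda>t. weight \<alpha> t s y) \<longlongrightarrow> limit_weight \<alpha> s y * 1) at_top"
    by (rule Lim_transform_eventually)
  then show ?thesis
    by simp
qed

lemma weight_le:
  assumes "0 < t"
  shows "weight \<alpha> t s y \<le> limit_weight \<alpha> s y * (indicator {..<t} s * sqrt (t / (t - max 0 s)))"
proof (cases "s < t")
  case True
  with assms have "0 < t - max 0 s"
    by auto
  then have "exp (- (sqrt 2 * \<alpha> * max 0 s - y)\<^sup>2 / (2 * (t - max 0 s))) \<le> 1" "0 \<le> sqrt (t / (t - max 0 s))"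
    using assms by auto
  then have "sqrt (t / (t - max 0 s)) * exp (- (sqrt 2 * \<alpha> * max 0 s - y)\<^sup>2 / (2 * (t - max 0 s))) \<le> sqrt (t / (t - max 0 s)) * 1"
    by (intro mult_left_mono)
  then show ?thesis
    using True mult_left_mono[OF _ limit_weight_nonneg[of \<alpha> s y]] by (simp add: weight_def mult.assoc)
qed (simp add: weight_def)

lemma weight_le_early:
  assumes "0 < t" "s \<le> t / 2"
  shows "weight \<alpha> t s y \<le> sqrt 2 * limit_weight \<alpha> s y"
proof -
  have "t \<le> 2 * (t - max 0 s)" "0 < t - max 0 s"
    using assms by (auto simp: max_def)
  then have "t / (t - max 0 s) \<le> 2"
    by (simp add: divide_le_eq)
  then have "sqrt (t / (t - max 0 s)) \<le> sqrt 2"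
    by (rule real_sqrt_le_mono)
  then have "limit_weight \<alpha> s y * (indicator {..<t} s * sqrt (t / (t - max 0 s))) \<le> limit_weight \<alpha> s y * sqrt 2"
    using assms by (intro mult_left_mono limit_weight_nonneg) auto
  with weight_le[OF assms(1), of \<alpha> s y] show ?thesis
    by (simp add: mult.commute)
qed

text \<open>The factor \<open>sqrt (t / (t - s))\<close> is unbounded as \<open>s\<close> approaches
  \<open>t\<close>, so the limit weight cannot dominate there. The singularity is integrable,
  however, and costs only a factor linear in \<open>t\<close>.\<close>

lemma nn_integral_sqrt_singularity:
  assumes "0 < t"
  shows "(\<integral>\<^sup>+s. indicator {t / 2<..<t} s * ennreal (sqrt (t / (t - s))) \<partial>lborel) \<le> ennreal (2 * t)"
proof -
  have "((\<lambda>x. x powr (- 1 / 2)) has_integral ((t / 2) powr (- 1 / 2 + 1) / (- 1 / 2 + 1))) {0..t / 2}"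
    using assms by (intro has_integral_powr_from_0) auto
  then have I: "(\<integral>\<^sup>+x. ennreal (x powr (- 1 / 2)) * indicator {0..t / 2} x \<partial>lborel) = ennreal (2 * sqrt (t / 2))"
    using assms by (subst nn_integral_has_integral_lebesgue') (auto simp: powr_half_sqrt mult.commute)
  have "(\<integral>\<^sup>+s. indicator {t / 2<..<t} s * ennreal (sqrt (t / (t - s))) \<partial>lborel) =
      (\<integral>\<^sup>+x. indicator {0<..<t / 2} x * ennreal (sqrt (t / x)) \<partial>lborel)"
    by (subst nn_integral_real_affine[where c = "-1" and t = t]) (auto intro!: nn_integral_cong simp: indicator_def)
  also have "\<dots> \<le> (\<integral>\<^sup>+x. ennreal (sqrt t) * (ennreal (x powr (- 1 / 2)) * indicator {0..t / 2} x) \<partial>lborel)"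
  proof (rule nn_integral_mono)
    fix x :: real
    have "sqrt (t / x) = sqrt t * x powr (- 1 / 2)" if "0 < x"
      using that by (simp add: real_sqrt_divide powr_minus_divide powr_half_sqrt)
    then show "indicator {0<..<t / 2} x * ennreal (sqrt (t / x)) \<le>
        ennreal (sqrt t) * (ennreal (x powr (- 1 / 2)) * indicator {0..t / 2} x)"
      by (auto simp: indicator_def ennreal_mult)
  qed
  also have "\<dots> = ennreal (sqrt t) * ennreal (2 * sqrt (t / 2))"
    by (subst nn_integral_cmult) (measurable, simp only: I)
  also have "\<dots> \<le> ennreal (2 * t)"
  proof -
    have "sqrt (t / 2) \<le> sqrt t"
      using assms by (intro real_sqrt_le_mono) auto
    then have "sqrt t * (2 * sqrt (t / 2)) \<le> sqrt t * (2 * sqrt t)"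
      using assms by (intro mult_left_mono) auto
    also have "\<dots> = 2 * t"
      using assms by simp
    finally have "ennreal (sqrt t * (2 * sqrt (t / 2))) \<le> ennreal (2 * t)"
      by (rule ennreal_leI)
    then show ?thesis
      using assms by (simp only: ennreal_mult real_sqrt_ge_zero mult_nonneg_nonneg zero_le_numeral
          divide_nonneg_pos zero_less_numeral less_imp_le)
  qed
  finally show ?thesis .
qed

section \<open>Exponential decay in the remaining time\<close>

context branching_brownian_motion
begin

lemma max_cdf_eq: "max_cdf M L B y s = 1 - max_tail y s"
proof -
  interpret \<mu>: prob_space \<mu>
    by (rule prob_space_tree_law)
  have [measurable]: "tree_data_of L B \<in> M \<rightarrow>\<^sub>M borel"
    by (rule measurable_tree_data)
  have "ennreal (max_cdf M L B y s) = emeasure M (tree_data_of L B -` {x. max\<^sub>0 s x \<le> y} \<inter> space M)"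
    unfolding max_cdf_def emeasure_eq_measure
    by (intro arg_cong[where f = ennreal] arg_cong[where f = prob])
       (auto simp: max_below_def max_position_tree_data)
  also have "\<dots> = emeasure \<mu> {x. max\<^sub>0 s x \<le> y}"
    unfolding tree_law_def by (rule emeasure_distr[symmetric]) measurable
  finally show ?thesis
    using max_tail_le_1[of y s] by (simp add: emeasure_max_le max_cdf_def)
qed

lemma nn_integral_below:
  "(\<integral>\<^sup>+y1. (\<integral>\<^sup>+y2. of_bool (below (s, y, y1, y2)) \<partial>\<mu>) \<partial>\<mu>) = ennreal ((max_cdf M L B y (max 0 s))\<^sup>2)"
proof -
  interpret \<mu>: prob_space \<mu>
    by (rule prob_space_tree_law)
  let ?A = "{x. max\<^sub>0 (max 0 s) x \<le> y}"
  have "(\<integral>\<^sup>+y1. (\<integral>\<^sup>+y2. of_bool (below (s, y, y1, y2)) \<partial>\<mu>) \<partial>\<mu>) =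
      (\<integral>\<^sup>+y1. (\<integral>\<^sup>+y2. indicator ?A y1 * indicator ?A y2 \<partial>\<mu>) \<partial>\<mu>)"
    by (intro nn_integral_cong) (simp add: below_def indicator_def)
  also have "\<dots> = emeasure \<mu> ?A * emeasure \<mu> ?A"
    by (simp add: nn_integral_cmult nn_integral_multc)
  finally show ?thesis
    using max_tail_le_1[of y "max 0 s"] by (simp add: emeasure_max_le max_cdf_eq power2_eq_square ennreal_mult)
qed

lemma max_pair_moment_layer_cake:
  assumes "0 < k"
  shows "(\<integral>\<^sup>+y. ennreal (k * exp (- k * y)) * ennreal ((max_cdf M L B y (max 0 s))\<^sup>2) \<partial>lborel) = max_pair_moment k (max 0 s)"
proof -
  interpret \<mu>: prob_space \<mu>
    by (rule prob_space_tree_law)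
  interpret P: pair_sigma_finite \<mu> lborel ..
  let ?f = "\<lambda>y y1 y2. ennreal (k * exp (- k * y)) * of_bool (below (s, y, y1, y2))"
  have "max_pair_moment k (max 0 s) = (\<integral>\<^sup>+y1. (\<integral>\<^sup>+y2. (\<integral>\<^sup>+y. ?f y y1 y2 \<partial>lborel) \<partial>\<mu>) \<partial>\<mu>)"
    unfolding max_pair_moment_def exp_layer_cake[OF assms]
    by (intro nn_integral_cong) (auto simp: below_def indicator_def)
  also have "\<dots> = (\<integral>\<^sup>+y1. (\<integral>\<^sup>+y. (\<integral>\<^sup>+y2. ?f y y1 y2 \<partial>\<mu>) \<partial>lborel) \<partial>\<mu>)"
    by (intro nn_integral_cong P.Fubini'[symmetric]) measurable
  also have "\<dots> = (\<integral>\<^sup>+y. (\<integral>\<^sup>+y1. (\<integral>\<^sup>+y2. ?f y y1 y2 \<partial>\<mu>) \<partial>\<mu>) \<partial>lborel)"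
    by (rule P.Fubini'[symmetric]) measurable
  also have "\<dots> = (\<integral>\<^sup>+y. ennreal (k * exp (- k * y)) * ennreal ((max_cdf M L B y (max 0 s))\<^sup>2) \<partial>lborel)"
    unfolding nn_integral_below[symmetric] by (intro nn_integral_cong) (simp add: nn_integral_cmult)
  finally show ?thesis ..
qed

lemma measurable_max_cdf [measurable (raw)]:
  assumes [measurable]: "f \<in> borel_measurable N" "g \<in> borel_measurable N"
  shows "(\<lambda>x. max_cdf M L B (f x) (g x)) \<in> borel_measurable N"
  unfolding max_cdf_eq by measurable

text \<open>The limiting weight of remaining time \<open>s\<close>, summed over the distance
  \<open>y\<close>. For \<open>s > 0\<close> it is the inner integral of \<open>\<Phi>\<close>, kept
  in \<open>ennreal\<close> until its finiteness is known.\<close>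

definition slice :: "real \<Rightarrow> real \<Rightarrow> ennreal" where
  "slice \<alpha> s = (\<integral>\<^sup>+y. ennreal (limit_weight \<alpha> s y) * ennreal ((max_cdf M L B y (max 0 s))\<^sup>2) \<partial>lborel)"

lemma measurable_slice [measurable]: "slice \<alpha> \<in> borel_measurable borel"
  unfolding slice_def[abs_def] by measurable

lemma slice_bound:
  assumes \<alpha>: "\<alpha> < - \<gamma>"
  obtains C d where "0 \<le> C" "0 < d" "\<And>s. slice \<alpha> s \<le> ennreal (C * exp (- d * max 0 s)) * indicator {-1<..} s"
proof -
  define k where "k = - \<alpha> / sqrt 2"
  have "1 < sqrt (2 :: real)"
    by simp
  with \<alpha> have "\<alpha> < 0"
    unfolding \<gamma>_def by linarith
  then have k: "0 < k"
    by (simp add: k_def divide_neg_pos)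
  have k2: "2 * k = - (sqrt 2 * \<alpha>)"
  proof -
    have "2 * k = - (2 / sqrt 2 * \<alpha>)"
      by (simp add: k_def)
    then show ?thesis
      by (simp only: real_div_sqrt[of 2] zero_le_numeral)
  qed
  obtain C b where C: "0 \<le> C" "2 * b < \<alpha>\<^sup>2 - 1" "\<And>t. 0 \<le> t \<Longrightarrow> exp_moment k t \<le> ennreal (C * exp (b * t))"
    using exp_moment_critical[OF \<alpha>] unfolding k_def by blast
  \<comment> \<open>Positive precisely by the rate obtained in
    \<open>exp_moment_critical\<close>.\<close>
  define d where "d = \<alpha>\<^sup>2 - 1 - 2 * b"
  have "slice \<alpha> s \<le> ennreal (C\<^sup>2 / (2 * k) * exp (- d * max 0 s)) * indicator {-1<..} s" for s
  proof (cases "-1 < s")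
    case True
    let ?r = "max 0 s"
    have "limit_weight \<alpha> s y = exp ((1 - \<alpha>\<^sup>2) * ?r) / (2 * k) * (2 * k * exp (- (2 * k) * y))" for y
      using True k \<open>\<alpha> < 0\<close> by (simp add: limit_weight_def k2 exp_add)
    then have "slice \<alpha> s = (\<integral>\<^sup>+y. ennreal (exp ((1 - \<alpha>\<^sup>2) * ?r) / (2 * k)) *
        (ennreal (2 * k * exp (- (2 * k) * y)) * ennreal ((max_cdf M L B y ?r)\<^sup>2)) \<partial>lborel)"
      unfolding slice_def using k
      by (intro nn_integral_cong) (simp only: ennreal_mult mult.assoc divide_nonneg_pos exp_ge_zero mult_nonneg_nonneg less_imp_le)
    also have "\<dots> = ennreal (exp ((1 - \<alpha>\<^sup>2) * ?r) / (2 * k)) * max_pair_moment (2 * k) ?r"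
      using k max_pair_moment_layer_cake[of "2 * k" s] by (subst nn_integral_cmult) auto
    also have "\<dots> \<le> ennreal (exp ((1 - \<alpha>\<^sup>2) * ?r) / (2 * k)) * (ennreal (C * exp (b * ?r)))\<^sup>2"
      using k C by (intro mult_left_mono order_trans[OF max_pair_moment_le_square] power_mono) auto
    also have "\<dots> = ennreal (exp ((1 - \<alpha>\<^sup>2) * ?r) / (2 * k) * (C * exp (b * ?r))\<^sup>2)"
    proof -
      have "0 \<le> C * exp (b * ?r)" "0 \<le> exp ((1 - \<alpha>\<^sup>2) * ?r) / (2 * k)"
        using k C by auto
      then show ?thesis
        by (simp only: ennreal_power ennreal_mult zero_le_power)
    qed
    also have "exp ((1 - \<alpha>\<^sup>2) * ?r) / (2 * k) * (C * exp (b * ?r))\<^sup>2 =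
        C\<^sup>2 / (2 * k) * (exp ((1 - \<alpha>\<^sup>2) * ?r) * exp (2 * (b * ?r)))"
      by (simp add: power_mult_distrib exp_double)
    also have "exp ((1 - \<alpha>\<^sup>2) * ?r) * exp (2 * (b * ?r)) = exp (- d * ?r)"
      by (simp add: mult_exp_exp d_def algebra_simps)
    finally show ?thesis
      using True by simp
  qed (simp add: slice_def limit_weight_def)
  with C k that[of "C\<^sup>2 / (2 * k)" d] show ?thesis
    by (simp add: d_def)
qed

lemma nn_integral_slice:
  "(\<integral>\<^sup>+(s, y, y1, y2). f s * (ennreal (limit_weight \<alpha> s y) * of_bool (below (s, y, y1, y2))) \<partial>joint) =
    (\<integral>\<^sup>+s. f s * slice \<alpha> s \<partial>lborel)"
  if [measurable]: "f \<in> borel_measurable borel"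
proof -
  interpret \<mu>: prob_space \<mu>
    by (rule prob_space_tree_law)
  show ?thesis
    unfolding slice_def nn_integral_below[symmetric]
    by (subst nn_integral_joint) (simp_all add: nn_integral_cmult)
qed

text \<open>This number turns out to be \<open>\<Phi> / sqrt 2\<close>; it is also the total mass of
  the dominating function in the limit theorem.\<close>

definition mass :: "real \<Rightarrow> ennreal" where
  "mass \<alpha> = (\<integral>\<^sup>+(s, y, y1, y2). ennreal (limit_weight \<alpha> s y) * of_bool (below (s, y, y1, y2)) \<partial>joint)"

lemma mass_eq: "mass \<alpha> = (\<integral>\<^sup>+s. slice \<alpha> s \<partial>lborel)"
  using nn_integral_slice[of "\<lambda>_. 1" \<alpha>] by (simp add: mass_def)

lemma mass_finite:
  assumes \<alpha>: "\<alpha> < - \<gamma>"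
  shows "mass \<alpha> < \<infinity>"
proof -
  obtain C d where C: "0 \<le> C" "0 < d" "\<And>s. slice \<alpha> s \<le> ennreal (C * exp (- d * max 0 s)) * indicator {-1<..} s"
    using slice_bound[OF \<alpha>] by blast
  have d: "(\<integral>\<^sup>+s. ennreal (exponential_density d s) \<partial>lborel) = 1"
    using prob_space.emeasure_space_1[OF prob_space_exponential_density[OF C(2)]] by (simp add: emeasure_density)
  have "mass \<alpha> \<le> (\<integral>\<^sup>+s. ennreal C * indicator {-1<..0} s + ennreal (C / d) * ennreal (exponential_density d s) \<partial>lborel)"
    unfolding mass_eq
  proof (intro nn_integral_mono order_trans[OF C(3)])
    fix s
    show "ennreal (C * exp (- d * max 0 s)) * indicator {-1<..} s \<le>
      ennreal C * indicator {-1<..0} s + ennreal (C / d) * ennreal (exponential_density d s)"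
      using C by (auto simp: indicator_def exponential_density_def ennreal_mult[symmetric] max_def mult.commute)
  qed
  also have "\<dots> = ennreal C + ennreal (C / d)"
    by (subst nn_integral_add) (auto simp: nn_integral_cmult d)
  finally show ?thesis
    using le_less_trans by fastforce
qed

text \<open>For \<open>s > t / 2\<close> the square root costs at most \<open>2 * t\<close> in
  total, while \<open>slice\<close> is at most of order \<open>exp (- d * t / 2)\<close>.\<close>

lemma late_branching_negligible:
  assumes \<alpha>: "\<alpha> < - \<gamma>"
  shows "((\<lambda>t. \<integral>\<^sup>+(s, y, y1, y2). of_bool (t / 2 < s) * (ennreal (weight \<alpha> t s y) * of_bool (below (s, y, y1, y2))) \<partial>joint) \<longlongrightarrow> 0) at_top"
proof -
  obtain C d where C: "0 \<le> C" "0 < d" "\<And>s. slice \<alpha> s \<le> ennreal (C * exp (- d * max 0 s)) * indicator {-1<..} s"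
    using slice_bound[OF \<alpha>] by blast
  have bound: "(\<integral>\<^sup>+(s, y, y1, y2). of_bool (t / 2 < s) * (ennreal (weight \<alpha> t s y) * of_bool (below (s, y, y1, y2))) \<partial>joint) \<le>
      ennreal (2 * C * t * exp (- d * (t / 2)))" if t: "0 < t" for t
  proof -
    let ?w = "\<lambda>s. indicator {t / 2<..<t} s * ennreal (sqrt (t / (t - s)))"
    have "(\<integral>\<^sup>+(s, y, y1, y2). of_bool (t / 2 < s) * (ennreal (weight \<alpha> t s y) * of_bool (below (s, y, y1, y2))) \<partial>joint) \<le>
       (\<integral>\<^sup>+(s, y, y1, y2). ?w s * (ennreal (limit_weight \<alpha> s y) * of_bool (below (s, y, y1, y2))) \<partial>joint)"
    proof (rule nn_integral_mono, clarify)
      fix s y y1 y2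
      show "of_bool (t / 2 < s) * (ennreal (weight \<alpha> t s y) * of_bool (below (s, y, y1, y2))) \<le>
        ?w s * (ennreal (limit_weight \<alpha> s y) * of_bool (below (s, y, y1, y2)))"
      proof (cases "t / 2 < s \<and> s < t \<and> below (s, y, y1, y2)")
        case True
        with t have "max 0 s = s"
          by simp
        with True weight_le[OF t, of \<alpha> s y] have "ennreal (weight \<alpha> t s y) \<le> ennreal (sqrt (t / (t - s)) * limit_weight \<alpha> s y)"
          by (intro ennreal_leI) (simp add: mult.commute)
        also have "\<dots> = ennreal (sqrt (t / (t - s))) * ennreal (limit_weight \<alpha> s y)"
          using True t by (intro ennreal_mult limit_weight_nonneg) auto
        finally show ?thesis
          using True by simp
      qed (auto simp: weight_def)
    qed
    also have "\<dots> = (\<integral>\<^sup>+s. ?w s * slice \<alpha> s \<partial>lborel)"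
      by (rule nn_integral_slice) measurable
    also have "\<dots> \<le> (\<integral>\<^sup>+s. ?w s * ennreal (C * exp (- d * (t / 2))) \<partial>lborel)"
    proof (rule nn_integral_mono)
      fix s
      show "?w s * slice \<alpha> s \<le> ?w s * ennreal (C * exp (- d * (t / 2)))"
      proof (cases "s \<in> {t / 2<..<t}")
        case True
        have "slice \<alpha> s \<le> ennreal (C * exp (- d * max 0 s))"
          using C(3)[of s] True t by simp
        also have "\<dots> \<le> ennreal (C * exp (- d * (t / 2)))"
          using C True t by (intro ennreal_leI mult_left_mono) auto
        finally show ?thesis
          by (rule mult_left_mono) simp
      qed simp
    qed
    also have "\<dots> = (\<integral>\<^sup>+s. ?w s \<partial>lborel) * ennreal (C * exp (- d * (t / 2)))"
      by (rule nn_integral_multc) measurable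
    also have "\<dots> \<le> ennreal (2 * t) * ennreal (C * exp (- d * (t / 2)))"
      using t by (intro mult_right_mono nn_integral_sqrt_singularity) auto
    finally show ?thesis
      using t C by (simp add: ennreal_mult[symmetric] ac_simps)
  qed
  have "((\<lambda>t. 2 * C * t * exp (- d * (t / 2))) \<longlongrightarrow> 0) at_top"
    using C(2) by real_asymp
  then have "((\<lambda>t. ennreal (2 * C * t * exp (- d * (t / 2)))) \<longlongrightarrow> ennreal 0) at_top"
    by (rule tendsto_ennrealI)
  then have lim: "((\<lambda>t. ennreal (2 * C * t * exp (- d * (t / 2)))) \<longlongrightarrow> 0) at_top"
    by simp
  show ?thesis
    by (rule tendsto_sandwich[OF _ _ tendsto_const lim])
       (rule always_eventually, simp, rule eventually_mono[OF eventually_gt_at_top[of 0] bound])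
qed

text \<open>Dominated convergence on \<open>s \<le> t / 2\<close>, where \<open>weight\<close> is at
  most \<open>sqrt 2\<close> times its limit and \<open>mass\<close> is finite. The later part
  vanishes by \<open>late_branching_negligible\<close>, as \<open>H\<close> is bounded and supported
  on \<open>below\<close>.\<close>

lemma weighted_convergence:
  assumes \<alpha>: "\<alpha> < - \<gamma>"
    and H [measurable]: "H \<in> borel_measurable (borel \<Otimes>\<^sub>M (borel \<Otimes>\<^sub>M (borel \<Otimes>\<^sub>M borel)))"
    and H_bound: "\<And>z. 0 \<le> H z" "\<And>z. H z \<le> K * of_bool (below z)" and K: "0 \<le> K"
  shows "((\<lambda>t. \<integral>\<^sup>+(s, y, y1, y2). ennreal (weight \<alpha> t s y * H (s, y, y1, y2)) \<partial>joint) \<longlongrightarrow>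
    (\<integral>\<^sup>+(s, y, y1, y2). ennreal (limit_weight \<alpha> s y * H (s, y, y1, y2)) \<partial>joint)) at_top"
proof -
  \<comment> \<open>The condition \<open>0 < t\<close> is included because a sequence tending to
    infinity may start with nonpositive terms, while the domination has to hold for every
    index.\<close>
  let ?early = "\<lambda>t (s, y, y1, y2). ennreal (of_bool (0 < t \<and> s \<le> t / 2) * weight \<alpha> t s y * H (s, y, y1, y2))"
  let ?late = "\<lambda>t (s, y, y1, y2). ennreal (of_bool (t / 2 < s) * weight \<alpha> t s y * H (s, y, y1, y2))"
  let ?lim = "\<lambda>(s, y, y1, y2). ennreal (limit_weight \<alpha> s y * H (s, y, y1, y2))"
  let ?bd = "\<lambda>(s, y, y1, y2). ennreal (sqrt 2 * K) * (ennreal (limit_weight \<alpha> s y) * of_bool (below (s, y, y1, y2)))"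
  have early: "((\<lambda>t. \<integral>\<^sup>+z. ?early t z \<partial>joint) \<longlongrightarrow> (\<integral>\<^sup>+z. ?lim z \<partial>joint)) at_top"
  proof (rule tendsto_at_topI_sequentially)
    fix X :: "nat \<Rightarrow> real" assume X: "filterlim X at_top sequentially"
    show "(\<lambda>n. \<integral>\<^sup>+z. ?early (X n) z \<partial>joint) \<longlonglongrightarrow> (\<integral>\<^sup>+z. ?lim z \<partial>joint)"
    proof (rule nn_integral_dominated_convergence[where w = ?bd])
      show "AE z in joint. ?early (X j) z \<le> ?bd z" for j
      proof (intro AE_I2, clarify)
        fix s y y1 y2
        show "ennreal (of_bool (0 < X j \<and> s \<le> X j / 2) * weight \<alpha> (X j) s y * H (s, y, y1, y2)) \<le>
          ennreal (sqrt 2 * K) * (ennreal (limit_weight \<alpha> s y) * of_bool (below (s, y, y1, y2)))"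
        proof (cases "0 < X j \<and> s \<le> X j / 2")
          case True
          have "weight \<alpha> (X j) s y * H (s, y, y1, y2) \<le> (sqrt 2 * limit_weight \<alpha> s y) * (K * of_bool (below (s, y, y1, y2)))"
            using True H_bound weight_le_early[of "X j" s \<alpha> y] weight_nonneg[of "X j" \<alpha> s y] limit_weight_nonneg[of \<alpha> s y]
            by (intro mult_mono) auto
          then have "ennreal (weight \<alpha> (X j) s y * H (s, y, y1, y2)) \<le>
              ennreal ((sqrt 2 * K) * (limit_weight \<alpha> s y * of_bool (below (s, y, y1, y2))))"
            by (intro ennreal_leI) (simp add: ac_simps)
          also have "\<dots> = ennreal (sqrt 2 * K) * (ennreal (limit_weight \<alpha> s y) * of_bool (below (s, y, y1, y2)))"
            using K limit_weight_nonneg[of \<alpha> s y] by (subst ennreal_mult) (auto simp: ennreal_mult)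
          finally show ?thesis
            using True by simp
        next
          case False
          then have "of_bool (0 < X j \<and> s \<le> X j / 2) = (0 :: real)"
            unfolding of_bool_eq_0_iff .
          then show ?thesis
            by (simp only: mult_zero_left ennreal_0 zero_le)
        qed
      qed
      have "(\<integral>\<^sup>+z. ?bd z \<partial>joint) = ennreal (sqrt 2 * K) * mass \<alpha>"
        unfolding mass_def by (subst nn_integral_cmult[symmetric]) (auto intro!: nn_integral_cong)
      then show "(\<integral>\<^sup>+z. ?bd z \<partial>joint) < \<infinity>"
        using mass_finite[OF \<alpha>] by (simp add: ennreal_mult_less_top)
      show "AE z in joint. (\<lambda>n. ?early (X n) z) \<longlonglongrightarrow> ?lim z"
      proof (intro AE_I2, clarify)
        fix s y y1 y2
        have "\<forall>\<^sub>F t in at_top. weight \<alpha> t s y = of_bool (0 < t \<and> s \<le> t / 2) * weight \<alpha> t s y"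
          using eventually_gt_at_top[of 0] eventually_ge_at_top[of "2 * s"] by eventually_elim simp
        with weight_tendsto[of \<alpha> s y] have "((\<lambda>t. of_bool (0 < t \<and> s \<le> t / 2) * weight \<alpha> t s y) \<longlongrightarrow> limit_weight \<alpha> s y) at_top"
          by (rule Lim_transform_eventually)
        from filterlim_compose[OF this X]
        show "(\<lambda>n. ennreal (of_bool (0 < X n \<and> s \<le> X n / 2) * weight \<alpha> (X n) s y * H (s, y, y1, y2))) \<longlonglongrightarrow>
            ennreal (limit_weight \<alpha> s y * H (s, y, y1, y2))"
          by (intro tendsto_ennrealI tendsto_intros)
      qed
    qed measurable
  qed
  have late: "((\<lambda>t. \<integral>\<^sup>+z. ?late t z \<partial>joint) \<longlongrightarrow> 0) at_top"
  proof (rule tendsto_sandwich[OF _ _ tendsto_const])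
    show "\<forall>\<^sub>F t in at_top. 0 \<le> (\<integral>\<^sup>+z. ?late t z \<partial>joint)"
      by simp
    show "\<forall>\<^sub>F t in at_top. (\<integral>\<^sup>+z. ?late t z \<partial>joint) \<le> ennreal K *
        (\<integral>\<^sup>+(s, y, y1, y2). of_bool (t / 2 < s) * (ennreal (weight \<alpha> t s y) * of_bool (below (s, y, y1, y2))) \<partial>joint)"
      using eventually_gt_at_top[of 0]
    proof eventually_elim
      case (elim t)
      have "(\<integral>\<^sup>+z. ?late t z \<partial>joint) \<le> (\<integral>\<^sup>+(s, y, y1, y2). ennreal K *
          (of_bool (t / 2 < s) * (ennreal (weight \<alpha> t s y) * of_bool (below (s, y, y1, y2)))) \<partial>joint)"
      proof (rule nn_integral_mono, clarify)
        fix s y y1 y2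
        have "weight \<alpha> t s y * H (s, y, y1, y2) \<le> weight \<alpha> t s y * (K * of_bool (below (s, y, y1, y2)))"
          using H_bound weight_nonneg[OF elim] by (intro mult_left_mono) auto
        then have "ennreal (of_bool (t / 2 < s) * weight \<alpha> t s y * H (s, y, y1, y2)) \<le>
            ennreal (K * (of_bool (t / 2 < s) * (weight \<alpha> t s y * of_bool (below (s, y, y1, y2)))))"
          by (intro ennreal_leI) (simp add: ac_simps)
        also have "\<dots> = ennreal K * (of_bool (t / 2 < s) * (ennreal (weight \<alpha> t s y) * of_bool (below (s, y, y1, y2))))"
          using K weight_nonneg[OF elim, of \<alpha> s y] by (simp add: ennreal_mult)
        finally show "ennreal (of_bool (t / 2 < s) * weight \<alpha> t s y * H (s, y, y1, y2)) \<le>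
           ennreal K * (of_bool (t / 2 < s) * (ennreal (weight \<alpha> t s y) * of_bool (below (s, y, y1, y2))))" .
      qed
      also have "\<dots> = ennreal K * (\<integral>\<^sup>+(s, y, y1, y2). of_bool (t / 2 < s) * (ennreal (weight \<alpha> t s y) * of_bool (below (s, y, y1, y2))) \<partial>joint)"
        by (subst nn_integral_cmult[symmetric]) (auto intro!: nn_integral_cong)
      finally show ?case .
    qed
    show "((\<lambda>t. ennreal K * (\<integral>\<^sup>+(s, y, y1, y2). of_bool (t / 2 < s) * (ennreal (weight \<alpha> t s y) * of_bool (below (s, y, y1, y2))) \<partial>joint)) \<longlongrightarrow> 0) at_top"
      using ennreal_tendsto_cmult[OF _ late_branching_negligible[OF \<alpha>], of "ennreal K"] by simp
  qed
  have "\<forall>\<^sub>F t in at_top. (\<integral>\<^sup>+z. ?early t z \<partial>joint) + (\<integral>\<^sup>+z. ?late t z \<partial>joint) =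
      (\<integral>\<^sup>+(s, y, y1, y2). ennreal (weight \<alpha> t s y * H (s, y, y1, y2)) \<partial>joint)"
    using eventually_gt_at_top[of 0]
  proof eventually_elim
    case (elim t)
    have "(\<integral>\<^sup>+z. ?early t z \<partial>joint) + (\<integral>\<^sup>+z. ?late t z \<partial>joint) = (\<integral>\<^sup>+z. ?early t z + ?late t z \<partial>joint)"
      by (rule nn_integral_add[symmetric]) measurable
    also have "\<dots> = (\<integral>\<^sup>+(s, y, y1, y2). ennreal (weight \<alpha> t s y * H (s, y, y1, y2)) \<partial>joint)"
      using elim by (intro nn_integral_cong) (auto simp: not_le not_less)
    finally show ?case .
  qed
  with tendsto_add[OF early late] show ?thesis
    by (auto intro: Lim_transform_eventually)
qed


section \<open>Identification of the normalizing constant\<close>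

lemma slice_atom:
  assumes "\<alpha> < 0" "-1 < s" "s \<le> 0"
  shows "slice \<alpha> s = ennreal (- 1 / (sqrt 2 * \<alpha>))"
proof -
  define k where "k = - (sqrt 2 * \<alpha>)"
  have k: "0 < k"
    using assms by (simp add: k_def mult_pos_neg)
  have "ennreal (1 / k) * ennreal (k * exp (- k * y)) = ennreal (exp (sqrt 2 * \<alpha> * y))" for y
    using k by (simp add: ennreal_mult[symmetric]) (simp add: k_def)
  then have "slice \<alpha> s = (\<integral>\<^sup>+y. ennreal (1 / k) * (ennreal (k * exp (- k * y)) * indicator {0..} y) \<partial>lborel)"
    unfolding slice_def using assms
    by (intro nn_integral_cong)
       (auto simp: limit_weight_def max_cdf_eq max_tail_0 indicator_def max_def)
  also have "\<dots> = ennreal (1 / k) * ennreal (exp (- k * 0))"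
    unfolding exp_layer_cake[OF k] by (rule nn_integral_cmult) measurable
  finally show ?thesis
    by (simp add: k_def)
qed

lemma slice_eq:
  assumes "0 \<le> s"
  shows "slice \<alpha> s = (\<integral>\<^sup>+y. ennreal (exp ((1 - \<alpha>\<^sup>2) * s + sqrt 2 * \<alpha> * y) * (max_cdf M L B y s)\<^sup>2) \<partial>lborel)"
  unfolding slice_def using assms by (intro nn_integral_cong) (simp add: limit_weight_def ennreal_mult)

lemma slice_finite: "\<alpha> < - \<gamma> \<Longrightarrow> slice \<alpha> s < \<infinity>"
proof -
  assume "\<alpha> < - \<gamma>"
  then obtain C d where "slice \<alpha> s \<le> ennreal (C * exp (- d * max 0 s)) * indicator {-1<..} s"
    using slice_bound by metis
  also have "\<dots> < \<infinity>"
    by (simp add: indicator_def)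
  finally show ?thesis .
qed

lemma mass_split:
  assumes "\<alpha> < 0"
  shows "mass \<alpha> = ennreal (- 1 / (sqrt 2 * \<alpha>)) + (\<integral>\<^sup>+s. indicator {0..} s * slice \<alpha> s \<partial>lborel)"
proof -
  have "mass \<alpha> = (\<integral>\<^sup>+s. ennreal (- 1 / (sqrt 2 * \<alpha>)) * indicator {-1<..<0} s + indicator {0..} s * slice \<alpha> s \<partial>lborel)"
    unfolding mass_eq using assms
    by (intro nn_integral_cong) (auto simp: indicator_def slice_atom, simp add: slice_def limit_weight_def)
  also have "\<dots> = ennreal (- 1 / (sqrt 2 * \<alpha>)) + (\<integral>\<^sup>+s. indicator {0..} s * slice \<alpha> s \<partial>lborel)"
    by (subst nn_integral_add) (auto simp: nn_integral_cmult)
  finally show ?thesis .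
qed

lemma slice_Bochner:
  assumes "0 \<le> s"
  shows "(LINT y|lborel. exp ((1 - \<alpha>\<^sup>2) * s + sqrt 2 * \<alpha> * y) * (max_cdf M L B y s)\<^sup>2) = enn2real (slice \<alpha> s)"
  unfolding slice_eq[OF assms] by (rule integral_eq_nn_integral) auto

text \<open>The unit interval that carries the atom has mass
  \<open>- 1 / (sqrt 2 * \<alpha>)\<close>, which accounts for the term
  \<open>- 1 / \<alpha>\<close> of \<open>\<Phi>\<close>. Finiteness of \<open>mass\<close> and of
  each \<open>slice\<close> identifies the Bochner integrals in \<open>\<Phi>\<close> with the
  nonnegative ones.\<close>

lemma Phi_eq:
  assumes \<alpha>: "\<alpha> < - \<gamma>"
  shows "ennreal (\<Phi> M L B \<alpha>) = ennreal (sqrt 2) * mass \<alpha>" "0 < \<Phi> M L B \<alpha>"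
proof -
  have "1 < sqrt (2 :: real)"
    by simp
  with \<alpha> have neg: "\<alpha> < 0"
    unfolding \<gamma>_def by linarith
  define I where "I = (\<integral>\<^sup>+s. indicator {0..} s * slice \<alpha> s \<partial>lborel)"
  have "I \<le> mass \<alpha>"
    unfolding mass_split[OF neg] I_def by simp
  then have I: "I < \<infinity>"
    using mass_finite[OF \<alpha>] by (rule le_less_trans)
  have "(LINT s:{0..}|lborel. (LINT y|lborel. exp ((1 - \<alpha>\<^sup>2) * s + sqrt 2 * \<alpha> * y) * (max_cdf M L B y s)\<^sup>2)) =
      (LINT s|lborel. indicator {0..} s * enn2real (slice \<alpha> s))"
    unfolding set_lebesgue_integral_def
    by (intro Bochner_Integration.integral_cong) (auto simp: indicator_def slice_Bochner)
  also have "\<dots> = enn2real (\<integral>\<^sup>+s. ennreal (indicator {0..} s * enn2real (slice \<alpha> s)) \<partial>lborel)"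
    by (rule integral_eq_nn_integral) auto
  also have "(\<integral>\<^sup>+s. ennreal (indicator {0..} s * enn2real (slice \<alpha> s)) \<partial>lborel) = I"
    unfolding I_def using slice_finite[OF \<alpha>]
    by (intro nn_integral_cong) (auto simp: indicator_def less_top)
  finally have Phi: "\<Phi> M L B \<alpha> = - (1 / \<alpha>) + sqrt 2 * enn2real I"
    unfolding \<Phi>_def by simp
  have "0 < - (1 / \<alpha>)"
    using neg by (simp add: divide_pos_neg)
  moreover have "0 \<le> sqrt 2 * enn2real I"
    by simp
  ultimately show "0 < \<Phi> M L B \<alpha>"
    unfolding Phi by linarith
  have "sqrt 2 * (- 1 / (sqrt 2 * \<alpha>)) = - (1 / \<alpha>)"
    by simp
  moreover have "ennreal (sqrt 2) * mass \<alpha> = ennreal (sqrt 2 * (- 1 / (sqrt 2 * \<alpha>))) + ennreal (sqrt 2 * enn2real I)"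
  proof -
    have "ennreal (sqrt 2 * enn2real I) = ennreal (sqrt 2) * I"
      using I by (simp add: ennreal_mult' less_top)
    moreover have "ennreal (sqrt 2 * (- 1 / (sqrt 2 * \<alpha>))) = ennreal (sqrt 2) * ennreal (- 1 / (sqrt 2 * \<alpha>))"
      by (rule ennreal_mult') simp
    ultimately show ?thesis
      unfolding mass_split[OF neg] I_def[symmetric] by (simp only: distrib_left)
  qed
  ultimately show "ennreal (\<Phi> M L B \<alpha>) = ennreal (sqrt 2) * mass \<alpha>"
    unfolding Phi using \<open>0 < - (1 / \<alpha>)\<close> \<open>0 \<le> sqrt 2 * enn2real I\<close>
    by (simp only: ennreal_plus less_imp_le)
qed

lemma norming_max_below:
  assumes t: "0 < t"
  shows "ennreal (norming \<alpha> t) * emeasure M (max_below M L B (sqrt 2 * \<alpha> * t) t) =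
    (\<integral>\<^sup>+(s, y, y1, y2). ennreal (weight \<alpha> t s y * of_bool (below (s, y, y1, y2))) \<partial>joint)"
proof -
  have "ennreal (norming \<alpha> t) * emeasure M (max_below M L B (sqrt 2 * \<alpha> * t) t) =
      (\<integral>\<^sup>+(s, y, y1, y2). ennreal (weight \<alpha> t s y) * (of_bool (below (s, y, y1, y2)) * 1) \<partial>joint)"
    using nn_integral_branching_data[OF t, of "\<lambda>_. 1" \<alpha>] by simp
  also have "\<dots> = (\<integral>\<^sup>+(s, y, y1, y2). ennreal (weight \<alpha> t s y * of_bool (below (s, y, y1, y2))) \<partial>joint)"
    by (intro nn_integral_cong) auto
  finally show ?thesis .
qed

lemma prob_max_below_tendsto:
  assumes \<alpha>: "\<alpha> < - \<gamma>"
  shows "((\<lambda>t. norming \<alpha> t * measure M (max_below M L B (sqrt 2 * \<alpha> * t) t)) \<longlongrightarrow> \<Phi> M L B \<alpha> / sqrt 2) at_top"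
proof -
  have "((\<lambda>t. \<integral>\<^sup>+(s, y, y1, y2). ennreal (weight \<alpha> t s y * of_bool (below (s, y, y1, y2))) \<partial>joint) \<longlongrightarrow>
      (\<integral>\<^sup>+(s, y, y1, y2). ennreal (limit_weight \<alpha> s y * of_bool (below (s, y, y1, y2))) \<partial>joint)) at_top"
    by (rule weighted_convergence[OF \<alpha>, where K = 1]) auto
  also have "(\<integral>\<^sup>+(s, y, y1, y2). ennreal (limit_weight \<alpha> s y * of_bool (below (s, y, y1, y2))) \<partial>joint) = mass \<alpha>"
    unfolding mass_def by (intro nn_integral_cong) auto
  also have "mass \<alpha> = ennreal (\<Phi> M L B \<alpha> / sqrt 2)"
  proof -
    have "ennreal (1 / sqrt 2) * ennreal (\<Phi> M L B \<alpha>) = (ennreal (1 / sqrt 2) * ennreal (sqrt 2)) * mass \<alpha>"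
      unfolding Phi_eq(1)[OF \<alpha>] by (simp only: mult.assoc)
    also have "ennreal (1 / sqrt 2) * ennreal (sqrt 2) = 1"
      by (subst ennreal_mult[symmetric]) auto
    finally show ?thesis
      using Phi_eq(2)[OF \<alpha>] by (simp add: ennreal_mult[symmetric])
  qed
  finally have "((\<lambda>t. \<integral>\<^sup>+(s, y, y1, y2). ennreal (weight \<alpha> t s y * of_bool (below (s, y, y1, y2))) \<partial>joint) \<longlongrightarrow>
      ennreal (\<Phi> M L B \<alpha> / sqrt 2)) at_top" .
  moreover have "\<forall>\<^sub>F t in at_top. (\<integral>\<^sup>+(s, y, y1, y2). ennreal (weight \<alpha> t s y * of_bool (below (s, y, y1, y2))) \<partial>joint) =
      ennreal (norming \<alpha> t * measure M (max_below M L B (sqrt 2 * \<alpha> * t) t))"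
    using eventually_gt_at_top[of 0]
    by eventually_elim (simp add: norming_max_below[symmetric] emeasure_eq_measure ennreal_mult norming_def)
  ultimately have "((\<lambda>t. ennreal (norming \<alpha> t * measure M (max_below M L B (sqrt 2 * \<alpha> * t) t))) \<longlongrightarrow>
      ennreal (\<Phi> M L B \<alpha> / sqrt 2)) at_top"
    by (rule Lim_transform_eventually)
  then show ?thesis
    using Phi_eq(2)[OF \<alpha>]
    by (subst (asm) tendsto_ennreal_iff)
       (auto intro!: eventually_mono[OF eventually_gt_at_top[of 0]] simp: norming_def)
qed

lemma prob_max_below_asymp:
  assumes \<alpha>: "\<alpha> < - \<gamma>"
  shows "(\<lambda>t. measure M (max_below M L B (sqrt 2 * \<alpha> * t) t)) \<sim>[at_top]
    (\<lambda>t. \<Phi> M L B \<alpha> / sqrt (4 * pi) * t powr (- 1 / 2) * exp (- (1 + \<alpha>\<^sup>2) * t))"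
proof (rule asymp_equivI')
  let ?\<Phi> = "\<Phi> M L B \<alpha>" and ?p = "\<lambda>t. measure M (max_below M L B (sqrt 2 * \<alpha> * t) t)"
  have \<Phi>: "0 < ?\<Phi>"
    by (rule Phi_eq(2)[OF \<alpha>])
  have "((\<lambda>t. norming \<alpha> t * ?p t / (?\<Phi> / sqrt 2)) \<longlongrightarrow> (?\<Phi> / sqrt 2) / (?\<Phi> / sqrt 2)) at_top"
    using \<Phi> by (intro tendsto_divide prob_max_below_tendsto \<alpha> tendsto_const) auto
  then have lim: "((\<lambda>t. norming \<alpha> t * ?p t / (?\<Phi> / sqrt 2)) \<longlongrightarrow> 1) at_top"
    using \<Phi> by simp
  have "norming \<alpha> t * ?p t / (?\<Phi> / sqrt 2) = ?p t / (?\<Phi> / sqrt (4 * pi) * t powr (- 1 / 2) * exp (- (1 + \<alpha>\<^sup>2) * t))"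
    if t: "0 < t" for t
  proof -
    have e: "exp (- (1 + \<alpha>\<^sup>2) * t) = inverse (exp ((1 + \<alpha>\<^sup>2) * t))"
      by (simp add: exp_minus[symmetric] algebra_simps)
    have p: "t powr (- 1 / 2) = inverse (sqrt t)"
      using t by (simp add: powr_minus powr_half_sqrt)
    have q: "sqrt (2 * pi * t) * sqrt 2 = sqrt (4 * pi) * sqrt t"
      by (simp add: real_sqrt_mult[symmetric])
    have "norming \<alpha> t * ?p t / (?\<Phi> / sqrt 2) = ?p t * (sqrt (2 * pi * t) * sqrt 2) * exp ((1 + \<alpha>\<^sup>2) * t) / ?\<Phi>"
      by (simp add: norming_def)
    also have "\<dots> = ?p t / (?\<Phi> / sqrt (4 * pi) * t powr (- 1 / 2) * exp (- (1 + \<alpha>\<^sup>2) * t))"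
      unfolding q e p by (simp add: field_simps)
    finally show ?thesis .
  qed
  then have "\<forall>\<^sub>F t in at_top. norming \<alpha> t * ?p t / (?\<Phi> / sqrt 2) =
      ?p t / (?\<Phi> / sqrt (4 * pi) * t powr (- 1 / 2) * exp (- (1 + \<alpha>\<^sup>2) * t))"
    by (intro eventually_mono[OF eventually_gt_at_top[of 0]]) auto
  with lim show "((\<lambda>t. ?p t / (?\<Phi> / sqrt (4 * pi) * t powr (- 1 / 2) * exp (- (1 + \<alpha>\<^sup>2) * t))) \<longlongrightarrow> 1) at_top"
    by (rule Lim_transform_eventually)
qed

section \<open>Law of the limiting branching data\<close>

definition limit_data :: "real \<Rightarrow> (real \<times> real \<times> tree_data \<times> tree_data) measure" where
  "limit_data \<alpha> = density joint (\<lambda>(s, y, y1, y2).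
     ennreal (sqrt 2 / \<Phi> M L B \<alpha>) * (ennreal (limit_weight \<alpha> s y) * of_bool (below (s, y, y1, y2))))"

lemma sets_limit_data [measurable_cong]: "sets (limit_data \<alpha>) = sets (borel \<Otimes>\<^sub>M (borel \<Otimes>\<^sub>M (borel \<Otimes>\<^sub>M borel)))"
  by (simp add: limit_data_def sets_joint)

lemma space_limit_data [simp]: "space (limit_data \<alpha>) = UNIV"
  by (simp add: limit_data_def)

lemma nn_integral_limit_data:
  assumes [measurable]: "f \<in> borel_measurable (borel \<Otimes>\<^sub>M (borel \<Otimes>\<^sub>M (borel \<Otimes>\<^sub>M borel)))"
  shows "(\<integral>\<^sup>+z. f z \<partial>limit_data \<alpha>) = ennreal (sqrt 2 / \<Phi> M L B \<alpha>) *
    (\<integral>\<^sup>+(s, y, y1, y2). ennreal (limit_weight \<alpha> s y) * (of_bool (below (s, y, y1, y2)) * f (s, y, y1, y2)) \<partial>joint)"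
proof -
  have "(\<integral>\<^sup>+z. f z \<partial>limit_data \<alpha>) = (\<integral>\<^sup>+(s, y, y1, y2). ennreal (sqrt 2 / \<Phi> M L B \<alpha>) *
      (ennreal (limit_weight \<alpha> s y) * (of_bool (below (s, y, y1, y2)) * f (s, y, y1, y2))) \<partial>joint)"
    unfolding limit_data_def
    by (subst nn_integral_density) (auto intro!: nn_integral_cong simp: mult.assoc)
  also have "\<dots> = ennreal (sqrt 2 / \<Phi> M L B \<alpha>) *
    (\<integral>\<^sup>+(s, y, y1, y2). ennreal (limit_weight \<alpha> s y) * (of_bool (below (s, y, y1, y2)) * f (s, y, y1, y2)) \<partial>joint)"
    by (subst nn_integral_cmult[symmetric]) (auto intro!: nn_integral_cong)
  finally show ?thesis .
qed

lemma nn_integral_limit_data_iterated: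
  assumes [measurable]: "f \<in> borel_measurable (borel \<Otimes>\<^sub>M (borel \<Otimes>\<^sub>M (borel \<Otimes>\<^sub>M borel)))"
  shows "(\<integral>\<^sup>+z. f z \<partial>limit_data \<alpha>) = ennreal (sqrt 2 / \<Phi> M L B \<alpha>) *
    (\<integral>\<^sup>+s. (\<integral>\<^sup>+y. ennreal (limit_weight \<alpha> s y) *
      (\<integral>\<^sup>+y1. (\<integral>\<^sup>+y2. of_bool (below (s, y, y1, y2)) * f (s, y, y1, y2) \<partial>\<mu>) \<partial>\<mu>) \<partial>lborel) \<partial>lborel)"
proof -
  interpret \<mu>: prob_space \<mu>
    by (rule prob_space_tree_law)
  show ?thesis
    by (simp add: nn_integral_limit_data nn_integral_joint nn_integral_cmult)
qed

lemma Phi_mass: "\<alpha> < - \<gamma> \<Longrightarrow> ennreal (sqrt 2 / \<Phi> M L B \<alpha>) * mass \<alpha> = 1"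
proof -
  assume \<alpha>: "\<alpha> < - \<gamma>"
  have "ennreal (sqrt 2 / \<Phi> M L B \<alpha>) = ennreal (1 / \<Phi> M L B \<alpha>) * ennreal (sqrt 2)"
    using Phi_eq(2)[OF \<alpha>] by (simp add: ennreal_mult[symmetric])
  then have "ennreal (sqrt 2 / \<Phi> M L B \<alpha>) * mass \<alpha> = ennreal (1 / \<Phi> M L B \<alpha>) * ennreal (\<Phi> M L B \<alpha>)"
    by (simp add: Phi_eq(1)[OF \<alpha>] mult.assoc)
  also have "\<dots> = 1"
    using Phi_eq(2)[OF \<alpha>] by (subst ennreal_mult[symmetric]) auto
  finally show ?thesis .
qed

lemma prob_space_limit_data:
  assumes \<alpha>: "\<alpha> < - \<gamma>"
  shows "prob_space (limit_data \<alpha>)"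
proof (rule prob_spaceI)
  have "emeasure (limit_data \<alpha>) (space (limit_data \<alpha>)) = (\<integral>\<^sup>+z. 1 \<partial>limit_data \<alpha>)"
    by simp
  also have "\<dots> = ennreal (sqrt 2 / \<Phi> M L B \<alpha>) * mass \<alpha>"
    by (simp only: nn_integral_limit_data[OF borel_measurable_const] mass_def mult_1_right)
  finally show "emeasure (limit_data \<alpha>) (space (limit_data \<alpha>)) = 1"
    using Phi_mass[OF \<alpha>] by simp
qed

lemma AE_regular_joint: "AE z in joint. regular (fst (snd (snd z))) \<and> regular (snd (snd (snd z)))"
proof -
  interpret \<mu>: prob_space \<mu>
    by (rule prob_space_tree_law)
  have [measurable (raw)]: "Measurable.pred N (\<lambda>x. regular (f x))" if "f \<in> N \<rightarrow>\<^sub>M borel" for f and N :: "'n measure"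
    using measurable_compose[OF that measurable_regular] .
  let ?bad = "\<lambda>z. \<not> (regular (fst (snd (snd z))) \<and> regular (snd (snd (snd z))))"
  have "(\<integral>\<^sup>+z. of_bool (?bad z) \<partial>joint) = (\<integral>\<^sup>+s. (\<integral>\<^sup>+y. (\<integral>\<^sup>+y1. (\<integral>\<^sup>+y2. of_bool (\<not> (regular y1 \<and> regular y2)) \<partial>\<mu>) \<partial>\<mu>) \<partial>lborel) \<partial>lborel)"
    by (subst nn_integral_joint) auto
  also have "(\<integral>\<^sup>+y1. (\<integral>\<^sup>+y2. of_bool (\<not> (regular y1 \<and> regular y2)) \<partial>\<mu>) \<partial>\<mu>) = (\<integral>\<^sup>+y1. (\<integral>\<^sup>+y2. 0 \<partial>\<mu>) \<partial>\<mu>)"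
  proof (rule nn_integral_cong_AE)
    show "AE y1 in \<mu>. (\<integral>\<^sup>+y2. of_bool (\<not> (regular y1 \<and> regular y2)) \<partial>\<mu>) = (\<integral>\<^sup>+y2. 0 \<partial>\<mu>)"
      using AE_regular
    proof eventually_elim
      case (elim y1)
      show ?case
        using AE_regular by (intro nn_integral_cong_AE) (auto elim!: eventually_mono simp: elim)
    qed
  qed
  finally have "(\<integral>\<^sup>+z. of_bool (?bad z) \<partial>joint) = 0"
    by simp
  then have "AE z in joint. (of_bool (?bad z) :: ennreal) = 0"
    by (subst (asm) nn_integral_0_iff_AE) measurable
  then show ?thesis
    by eventually_elim (simp split: if_splits)
qed

lemma AE_regular_limit_data:
  "AE z in limit_data \<alpha>. regular (fst (snd (snd z))) \<and> regular (snd (snd (snd z)))"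
proof -
  have "(\<lambda>(s, y, y1, y2). ennreal (sqrt 2 / \<Phi> M L B \<alpha>) *
      (ennreal (limit_weight \<alpha> s y) * of_bool (below (s, y, y1, y2)))) \<in> borel_measurable joint"
    by measurable
  from AE_density[OF this] show ?thesis
    unfolding limit_data_def using AE_regular_joint by (auto elim: eventually_mono)
qed

end

section \<open>The limit object\<close>

text \<open>Borel measurability of maps into products with \<open>point_measure\<close> cannot be checked coordinatewise.
  The limit space therefore carries the largest sigma-algebra for which its points are measurable
  functions of the underlying branching data.\<close>

definition final_measure :: "'a measure \<Rightarrow> ('a \<Rightarrow> 'b) \<Rightarrow> 'b measure" where
  "final_measure Q T = distr Q (sigma UNIV {A. T -` A \<inter> space Q \<in> sets Q}) T"

lemma sets_final_measure: "sets (final_measure Q T) = {A. T -` A \<inter> space Q \<in> sets Q}"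
proof -
  have "sigma_algebra UNIV {A. T -` A \<inter> space Q \<in> sets Q}"
    unfolding sigma_algebra_iff2
  proof (intro conjI ballI allI impI)
    fix A assume "A \<in> {A. T -` A \<inter> space Q \<in> sets Q}"
    moreover have "T -` (UNIV - A) \<inter> space Q = space Q - (T -` A \<inter> space Q)"
      by auto
    ultimately show "UNIV - A \<in> {A. T -` A \<inter> space Q \<in> sets Q}"
      by auto
  next
    fix A :: "nat \<Rightarrow> _" assume "range A \<subseteq> {A. T -` A \<inter> space Q \<in> sets Q}"
    then have "(\<Union>i. T -` A i \<inter> space Q) \<in> sets Q"
      by (intro sets.countable_UN) auto
    moreover have "T -` (\<Union>i. A i) \<inter> space Q = (\<Union>i. T -` A i \<inter> space Q)"
      by auto
    ultimately show "(\<Union>i. A i) \<in> {A. T -` A \<inter> space Q \<in> sets Q}"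
      by (simp only: mem_Collect_eq)
  qed auto
  then show ?thesis
    by (simp add: final_measure_def sigma_algebra.sigma_sets_eq)
qed

lemma space_final_measure [simp]: "space (final_measure Q T) = UNIV"
  by (simp add: final_measure_def space_measure_of_conv)

lemma measurable_final_algebra: "T \<in> Q \<rightarrow>\<^sub>M sigma UNIV {A. T -` A \<inter> space Q \<in> sets Q}"
  by (rule measurable_measure_of) auto

lemma prob_space_final_measure: "prob_space Q \<Longrightarrow> prob_space (final_measure Q T)"
  unfolding final_measure_def by (intro prob_space.prob_space_distr measurable_final_algebra)

lemma measurable_final_measure:
  assumes "(\<lambda>x. f (T x)) \<in> Q \<rightarrow>\<^sub>M N" "space N = UNIV"
  shows "f \<in> final_measure Q T \<rightarrow>\<^sub>M N"
proof (rule measurableI)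
  fix A assume "A \<in> sets N"
  from measurable_sets[OF assms(1) this] show "f -` A \<inter> space (final_measure Q T) \<in> sets (final_measure Q T)"
    by (simp add: sets_final_measure vimage_def)
qed (use assms in simp)

lemma nn_integral_final_measure:
  assumes "f \<in> borel_measurable (final_measure Q T)"
  shows "(\<integral>\<^sup>+\<omega>. f \<omega> \<partial>final_measure Q T) = (\<integral>\<^sup>+x. f (T x) \<partial>Q)"
  unfolding final_measure_def
  by (rule nn_integral_distr[OF measurable_final_algebra]) (use assms in \<open>simp add: final_measure_def\<close>)

text \<open>The complement of the range of \<open>T\<close> has empty preimage, so it belongs to the
  final sigma-algebra and is a null set, whatever \<open>\<phi>\<close> is. This suits predicates
  such as the one involving \<open>pm_max\<close>.\<close>

lemma AE_final_measure:
  assumes "\<And>x. x \<in> space Q \<Longrightarrow> \<phi> (T x)"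
  shows "AE \<omega> in final_measure Q T. \<phi> \<omega>"
proof (rule AE_I[where N = "- T ` space Q"])
  have "T -` (- T ` space Q) \<inter> space Q = {}"
    by auto
  then show "- T ` space Q \<in> sets (final_measure Q T)"
    by (simp only: sets_final_measure mem_Collect_eq sets.empty_sets)
  with \<open>T -` (- T ` space Q) \<inter> space Q = {}\<close> show "emeasure (final_measure Q T) (- T ` space Q) = 0"
    unfolding final_measure_def
    by (subst emeasure_distr[OF measurable_final_algebra]) (simp_all only: sets_distr emeasure_empty)
qed (use assms in auto)

text \<open>The values for irregular data are consistent with each other: with
  \<open>xi = chi = 0\<close> the limit process is a unit mass at 0, whose maximum is
  \<open>- E = 0\<close>. Hence the relation between \<open>E\<close> and the maximum holds at every
  point of the range.\<close>

definition limit_coords :: "real \<times> real \<times> tree_data \<times> tree_data \<Rightarrow> real \<times> real \<times> real \<times> point_measure \<times> point_measure" where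
  "limit_coords = (\<lambda>(s, y, y1, y2).
     if regular y1 \<and> regular y2
     then (max 0 s, y, y - max (max\<^sub>0 (max 0 s) y1) (max\<^sub>0 (max 0 s) y2), particles (max 0 s) y1, particles (max 0 s) y2)
     else (0, 0, 0, pm_dirac 0, pm_dirac 0))"

definition coord_xi :: "real \<times> real \<times> real \<times> point_measure \<times> point_measure \<Rightarrow> real" where
  "coord_xi \<omega> = fst \<omega>"

definition coord_chi :: "real \<times> real \<times> real \<times> point_measure \<times> point_measure \<Rightarrow> real" where
  "coord_chi \<omega> = fst (snd \<omega>)"

definition coord_E :: "real \<times> real \<times> real \<times> point_measure \<times> point_measure \<Rightarrow> real" where
  "coord_E \<omega> = fst (snd (snd \<omega>))"

definition coord_B1 :: "real \<times> real \<times> real \<times> point_measure \<times> point_measure \<Rightarrow> point_measure" where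
  "coord_B1 \<omega> = fst (snd (snd (snd \<omega>)))"

definition coord_B2 :: "real \<times> real \<times> real \<times> point_measure \<times> point_measure \<Rightarrow> point_measure" where
  "coord_B2 \<omega> = snd (snd (snd (snd \<omega>)))"

lemmas coord_defs = coord_xi_def coord_chi_def coord_E_def coord_B1_def coord_B2_def

lemma coords_regular:
  assumes "regular y1" "regular y2"
  shows "coord_xi (limit_coords (s, y, y1, y2)) = max 0 s"
    "coord_chi (limit_coords (s, y, y1, y2)) = y"
    "coord_E (limit_coords (s, y, y1, y2)) = y - max (max\<^sub>0 (max 0 s) y1) (max\<^sub>0 (max 0 s) y2)"
    "coord_B1 (limit_coords (s, y, y1, y2)) = particles (max 0 s) y1"
    "coord_B2 (limit_coords (s, y, y1, y2)) = particles (max 0 s) y2"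
  using assms by (simp_all add: coord_defs limit_coords_def)

context branching_brownian_motion
begin

definition limit_space :: "real \<Rightarrow> (real \<times> real \<times> real \<times> point_measure \<times> point_measure) measure" where
  "limit_space \<alpha> = final_measure (limit_data \<alpha>) limit_coords"

lemma prob_space_limit_space: "\<alpha> < - \<gamma> \<Longrightarrow> prob_space (limit_space \<alpha>)"
  unfolding limit_space_def by (intro prob_space_final_measure prob_space_limit_data)

lemma space_limit_space [simp]: "space (limit_space \<alpha>) = UNIV"
  by (simp add: limit_space_def)

lemma measurable_coords [measurable]:
  "coord_xi \<in> borel_measurable (limit_space \<alpha>)" "coord_chi \<in> borel_measurable (limit_space \<alpha>)"
  "coord_E \<in> borel_measurable (limit_space \<alpha>)"
  "coord_B1 \<in> limit_space \<alpha> \<rightarrow>\<^sub>M borel" "coord_B2 \<in> limit_space \<alpha> \<rightarrow>\<^sub>M borel"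
proof -
  let ?B = "borel \<Otimes>\<^sub>M (borel \<Otimes>\<^sub>M (borel \<Otimes>\<^sub>M borel)) :: (real \<times> real \<times> tree_data \<times> tree_data) measure"
  let ?reg = "\<lambda>z::real \<times> real \<times> tree_data \<times> tree_data. regular (fst (snd (snd z))) \<and> regular (snd (snd (snd z)))"
  have Q: "f \<in> limit_data \<alpha> \<rightarrow>\<^sub>M N \<longleftrightarrow> f \<in> ?B \<rightarrow>\<^sub>M N" for f :: "real \<times> real \<times> tree_data \<times> tree_data \<Rightarrow> 'n" and N
    by (simp only: measurable_cong_sets[OF sets_limit_data refl])
  have reg: "Measurable.pred ?B ?reg"
    by measurable
  have "(\<lambda>z. coord_xi (limit_coords z)) = (\<lambda>z. if ?reg z then max 0 (fst z) else 0)"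
    "(\<lambda>z. coord_chi (limit_coords z)) = (\<lambda>z. if ?reg z then fst (snd z) else 0)"
    "(\<lambda>z. coord_E (limit_coords z)) = (\<lambda>z. if ?reg z then fst (snd z) -
       max (max\<^sub>0 (max 0 (fst z)) (fst (snd (snd z)))) (max\<^sub>0 (max 0 (fst z)) (snd (snd (snd z)))) else 0)"
    by (auto simp: coord_defs limit_coords_def case_prod_beta')
  then show "coord_xi \<in> borel_measurable (limit_space \<alpha>)" "coord_chi \<in> borel_measurable (limit_space \<alpha>)"
    "coord_E \<in> borel_measurable (limit_space \<alpha>)"
    unfolding limit_space_def by (auto intro!: measurable_final_measure simp: Q)
  have "(\<lambda>z. coord_B1 (limit_coords z)) = (\<lambda>z. if ?reg z then particles (max 0 (fst z)) (fst (snd (snd z))) else pm_dirac 0)"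
    "(\<lambda>z. coord_B2 (limit_coords z)) = (\<lambda>z. if ?reg z then particles (max 0 (fst z)) (snd (snd (snd z))) else pm_dirac 0)"
    by (auto simp: coord_defs limit_coords_def case_prod_beta')
  moreover have "(\<lambda>z. if ?reg z then particles (max 0 (fst z)) (fst (snd (snd z))) else pm_dirac 0) \<in> ?B \<rightarrow>\<^sub>M borel"
    "(\<lambda>z. if ?reg z then particles (max 0 (fst z)) (snd (snd (snd z))) else pm_dirac 0) \<in> ?B \<rightarrow>\<^sub>M borel"
    using reg by (intro measurable_If measurable_particles; simp add: pred_def)+
  ultimately show "coord_B1 \<in> limit_space \<alpha> \<rightarrow>\<^sub>M borel" "coord_B2 \<in> limit_space \<alpha> \<rightarrow>\<^sub>M borel"
    unfolding limit_space_def by (auto intro!: measurable_final_measure simp: Q)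
qed

lemma nn_integral_limit_space:
  assumes f: "f \<in> borel_measurable (limit_space \<alpha>)"
    and g: "g \<in> borel_measurable (borel \<Otimes>\<^sub>M (borel \<Otimes>\<^sub>M (borel \<Otimes>\<^sub>M borel)))"
    and fg: "\<And>s y y1 y2. regular y1 \<Longrightarrow> regular y2 \<Longrightarrow> f (limit_coords (s, y, y1, y2)) = g (s, y, y1, y2)"
  shows "(\<integral>\<^sup>+\<omega>. f \<omega> \<partial>limit_space \<alpha>) = ennreal (sqrt 2 / \<Phi> M L B \<alpha>) *
    (\<integral>\<^sup>+s. (\<integral>\<^sup>+y. ennreal (limit_weight \<alpha> s y) *
      (\<integral>\<^sup>+y1. (\<integral>\<^sup>+y2. of_bool (below (s, y, y1, y2)) * g (s, y, y1, y2) \<partial>\<mu>) \<partial>\<mu>) \<partial>lborel) \<partial>lborel)"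
proof -
  have "(\<integral>\<^sup>+\<omega>. f \<omega> \<partial>limit_space \<alpha>) = (\<integral>\<^sup>+z. f (limit_coords z) \<partial>limit_data \<alpha>)"
    using f unfolding limit_space_def by (rule nn_integral_final_measure)
  also have "\<dots> = (\<integral>\<^sup>+z. g z \<partial>limit_data \<alpha>)"
  proof (rule nn_integral_cong_AE)
    show "AE z in limit_data \<alpha>. f (limit_coords z) = g z"
      using AE_regular_limit_data
    proof eventually_elim
      case (elim z)
      then show ?case
        using fg[of "fst (snd (snd z))" "snd (snd (snd z))" "fst z" "fst (snd z)"] by simp
    qed
  qed
  finally show ?thesis
    using nn_integral_limit_data_iterated[OF g] by simp
qed

section \<open>Laws of the limit coordinates\<close>

lemma emeasure_xi:
  assumes \<alpha>: "\<alpha> < - \<gamma>" and A [measurable]: "A \<in> sets borel"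
  shows "emeasure (distr (limit_space \<alpha>) borel coord_xi) A =
    ennreal (1 / (- \<alpha> * \<Phi> M L B \<alpha>)) * indicator A 0 +
    (\<integral>\<^sup>+s\<in>A \<inter> {0<..}. ennreal (sqrt 2 / \<Phi> M L B \<alpha> *
       (LINT z|lborel. exp (sqrt 2 * \<alpha> * z + (1 - \<alpha>\<^sup>2) * s) * (max_cdf M L B z s)\<^sup>2)) \<partial>lborel)"
proof -
  let ?\<Phi> = "\<Phi> M L B \<alpha>"
  have "1 < sqrt (2 :: real)"
    by simp
  with \<alpha> have neg: "\<alpha> < 0"
    unfolding \<gamma>_def by linarith
  interpret \<mu>: prob_space \<mu>
    by (rule prob_space_tree_law)
  have "emeasure (distr (limit_space \<alpha>) borel coord_xi) A = (\<integral>\<^sup>+\<omega>. indicator A (coord_xi \<omega>) \<partial>limit_space \<alpha>)"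
    by (subst nn_integral_indicator[symmetric], simp, subst nn_integral_distr) auto
  also have "\<dots> = ennreal (sqrt 2 / ?\<Phi>) * (\<integral>\<^sup>+s. (\<integral>\<^sup>+y. ennreal (limit_weight \<alpha> s y) *
      (\<integral>\<^sup>+y1. (\<integral>\<^sup>+y2. of_bool (below (s, y, y1, y2)) * indicator A (max 0 s) \<partial>\<mu>) \<partial>\<mu>) \<partial>lborel) \<partial>lborel)"
    by (subst nn_integral_limit_space[where g = "\<lambda>(s, y, y1, y2). indicator A (max 0 s)"]) (auto simp: coords_regular)
  also have "\<dots> = ennreal (sqrt 2 / ?\<Phi>) * (\<integral>\<^sup>+s. indicator A (max 0 s) * slice \<alpha> s \<partial>lborel)"
    unfolding slice_def nn_integral_below[symmetric]
    by (simp add: nn_integral_cmult nn_integral_multc mult.assoc[symmetric] mult.commute[of _ "indicator A _"])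
      (simp add: nn_integral_cmult mult.assoc)
  \<comment> \<open>The interval \<open>(-1, 0]\<close> collapses to the atom at 0, where
    \<open>slice\<close> is constant; below it the weight vanishes.\<close>
  also have "(\<integral>\<^sup>+s. indicator A (max 0 s) * slice \<alpha> s \<partial>lborel) =
      (\<integral>\<^sup>+s. (indicator A 0 * ennreal (- 1 / (sqrt 2 * \<alpha>))) * indicator {-1<..0} s + indicator (A \<inter> {0<..}) s * slice \<alpha> s \<partial>lborel)"
  proof (rule nn_integral_cong)
    fix s :: real
    consider "s \<le> -1" | "-1 < s" "s \<le> 0" | "0 < s"
      by linarith
    then show "indicator A (max 0 s) * slice \<alpha> s =
        (indicator A 0 * ennreal (- 1 / (sqrt 2 * \<alpha>))) * indicator {-1<..0} s + indicator (A \<inter> {0<..}) s * slice \<alpha> s"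
    proof cases
      case 1
      then have "slice \<alpha> s = 0"
        by (simp add: slice_def limit_weight_def)
      with 1 show ?thesis
        by simp
    next
      case 2
      with slice_atom[OF neg 2] show ?thesis
        by simp
    qed (simp add: indicator_def)
  qed
  also have "\<dots> = indicator A 0 * ennreal (- 1 / (sqrt 2 * \<alpha>)) + (\<integral>\<^sup>+s. indicator (A \<inter> {0<..}) s * slice \<alpha> s \<partial>lborel)"
    by (subst nn_integral_add) (auto simp: nn_integral_cmult)
  also have "ennreal (sqrt 2 / ?\<Phi>) * \<dots> = ennreal (sqrt 2 / ?\<Phi>) * ennreal (- 1 / (sqrt 2 * \<alpha>)) * indicator A 0 +
      (\<integral>\<^sup>+s. ennreal (sqrt 2 / ?\<Phi>) * (indicator (A \<inter> {0<..}) s * slice \<alpha> s) \<partial>lborel)"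
    by (subst nn_integral_cmult) (auto simp: distrib_left ac_simps)
  also have "ennreal (sqrt 2 / ?\<Phi>) * ennreal (- 1 / (sqrt 2 * \<alpha>)) = ennreal (1 / (- \<alpha> * ?\<Phi>))"
    using Phi_eq(2)[OF \<alpha>] neg
    by (subst ennreal_mult[symmetric]) (auto simp: divide_nonneg_neg mult_pos_neg divide_le_0_iff mult_le_0_iff)
  also have "(\<integral>\<^sup>+s. ennreal (sqrt 2 / ?\<Phi>) * (indicator (A \<inter> {0<..}) s * slice \<alpha> s) \<partial>lborel) =
    (\<integral>\<^sup>+s\<in>A \<inter> {0<..}. ennreal (sqrt 2 / ?\<Phi> *
       (LINT z|lborel. exp (sqrt 2 * \<alpha> * z + (1 - \<alpha>\<^sup>2) * s) * (max_cdf M L B z s)\<^sup>2)) \<partial>lborel)"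
  proof (rule nn_integral_cong)
    fix s :: real
    show "ennreal (sqrt 2 / ?\<Phi>) * (indicator (A \<inter> {0<..}) s * slice \<alpha> s) =
      ennreal (sqrt 2 / ?\<Phi> * (LINT z|lborel. exp (sqrt 2 * \<alpha> * z + (1 - \<alpha>\<^sup>2) * s) * (max_cdf M L B z s)\<^sup>2)) *
      indicator (A \<inter> {0<..}) s"
    proof (cases "s \<in> A \<inter> {0<..}")
      case True
      then have "(LINT z|lborel. exp (sqrt 2 * \<alpha> * z + (1 - \<alpha>\<^sup>2) * s) * (max_cdf M L B z s)\<^sup>2) = enn2real (slice \<alpha> s)"
        using slice_Bochner[of s \<alpha>] by (simp add: add.commute)
      moreover have "ennreal (sqrt 2 / ?\<Phi> * enn2real (slice \<alpha> s)) = ennreal (sqrt 2 / ?\<Phi>) * slice \<alpha> s"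
      proof -
        have "ennreal (sqrt 2 / ?\<Phi> * enn2real (slice \<alpha> s)) = ennreal (sqrt 2 / ?\<Phi>) * ennreal (enn2real (slice \<alpha> s))"
          using Phi_eq(2)[OF \<alpha>] by (intro ennreal_mult) auto
        then show ?thesis
          using slice_finite[OF \<alpha>, of s] by (simp only: ennreal_enn2real infinity_ennreal_def)
      qed
      ultimately show ?thesis
        using True by simp
    qed simp
  qed
  finally show ?thesis .
qed

text \<open>\<open>E \<ge> a\<close> says that both maxima are at most \<open>y - a\<close>, which
  for \<open>a \<ge> 0\<close> already implies \<open>below\<close>. So the level in the squared
  distribution function is just shifted by \<open>a\<close>.\<close>

lemma nn_integral_E_ge:
  assumes "0 \<le> a" and [measurable]: "Measurable.pred borel p" "Measurable.pred borel q"
  shows "emeasure (limit_space \<alpha>) {\<omega>. p (coord_xi \<omega>) \<and> q (coord_chi \<omega>) \<and> a \<le> coord_E \<omega>} =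
    ennreal (sqrt 2 / \<Phi> M L B \<alpha>) * (\<integral>\<^sup>+s. of_bool (p (max 0 s)) * (\<integral>\<^sup>+y. of_bool (q y) *
      (ennreal (limit_weight \<alpha> s y) * ennreal ((max_cdf M L B (y - a) (max 0 s))\<^sup>2)) \<partial>lborel) \<partial>lborel)"
proof -
  interpret \<mu>: prob_space \<mu>
    by (rule prob_space_tree_law)
  let ?S = "{\<omega>. p (coord_xi \<omega>) \<and> q (coord_chi \<omega>) \<and> a \<le> coord_E \<omega>}"
  let ?g = "\<lambda>(s, y, y1, y2). of_bool (p (max 0 s) \<and> q y \<and> a \<le> y - max (max\<^sub>0 (max 0 s) y1) (max\<^sub>0 (max 0 s) y2)) :: ennreal"
  have [measurable (raw)]: "Measurable.pred N (\<lambda>x. p (f x))" "Measurable.pred N (\<lambda>x. q (f x))"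
    if "f \<in> borel_measurable N" for f and N :: "'n measure"
    using measurable_compose[OF that assms(2)] measurable_compose[OF that assms(3)] by auto
  have [measurable]: "?S \<in> sets (limit_space \<alpha>)"
  proof -
    have "Measurable.pred (limit_space \<alpha>) (\<lambda>\<omega>. p (coord_xi \<omega>) \<and> q (coord_chi \<omega>) \<and> a \<le> coord_E \<omega>)"
      by measurable
    then show ?thesis
      by (simp add: pred_def)
  qed
  have pair: "(\<integral>\<^sup>+y1. (\<integral>\<^sup>+y2. of_bool (below (s, y, y1, y2)) * ?g (s, y, y1, y2) \<partial>\<mu>) \<partial>\<mu>) =
      of_bool (p (max 0 s)) * (of_bool (q y) * ennreal ((max_cdf M L B (y - a) (max 0 s))\<^sup>2))" for s y
  proof -
    have "of_bool (below (s, y, y1, y2)) * ?g (s, y, y1, y2) =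
        of_bool (p (max 0 s)) * (of_bool (q y) * of_bool (below (s, y - a, y1, y2)))" for y1 y2
      using \<open>0 \<le> a\<close> by (auto simp: below_def)
    then show ?thesis
      unfolding nn_integral_below[symmetric] by (simp add: nn_integral_cmult)
  qed
  have "emeasure (limit_space \<alpha>) ?S = (\<integral>\<^sup>+\<omega>. indicator ?S \<omega> \<partial>limit_space \<alpha>)"
    by simp
  also have "\<dots> = ennreal (sqrt 2 / \<Phi> M L B \<alpha>) * (\<integral>\<^sup>+s. (\<integral>\<^sup>+y. ennreal (limit_weight \<alpha> s y) *
      (\<integral>\<^sup>+y1. (\<integral>\<^sup>+y2. of_bool (below (s, y, y1, y2)) * ?g (s, y, y1, y2) \<partial>\<mu>) \<partial>\<mu>) \<partial>lborel) \<partial>lborel)"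
  proof (rule nn_integral_limit_space)
    show "?g \<in> borel_measurable (borel \<Otimes>\<^sub>M (borel \<Otimes>\<^sub>M (borel \<Otimes>\<^sub>M borel)))"
      by measurable
    show "indicator ?S (limit_coords (s, y, y1, y2)) = ?g (s, y, y1, y2)" if "regular y1" "regular y2" for s y y1 y2
      using that by (simp add: coords_regular indicator_def)
  qed measurable
  also have "\<dots> = ennreal (sqrt 2 / \<Phi> M L B \<alpha>) * (\<integral>\<^sup>+s. (\<integral>\<^sup>+y. of_bool (p (max 0 s)) * (of_bool (q y) *
      (ennreal (limit_weight \<alpha> s y) * ennreal ((max_cdf M L B (y - a) (max 0 s))\<^sup>2))) \<partial>lborel) \<partial>lborel)"
    unfolding pair by (rule arg_cong2[where f = times, OF refl], intro nn_integral_cong, simp only: ac_simps)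
  also have "\<dots> = ennreal (sqrt 2 / \<Phi> M L B \<alpha>) * (\<integral>\<^sup>+s. of_bool (p (max 0 s)) * (\<integral>\<^sup>+y. of_bool (q y) *
      (ennreal (limit_weight \<alpha> s y) * ennreal ((max_cdf M L B (y - a) (max 0 s))\<^sup>2)) \<partial>lborel) \<partial>lborel)"
    by (rule arg_cong2[where f = times, OF refl], intro nn_integral_cong nn_integral_cmult, measurable)
  finally show ?thesis .
qed

text \<open>Translating \<open>y\<close> by \<open>a\<close> undoes the shift of the level and
  multiplies the weight by \<open>exp (sqrt 2 * \<alpha> * a)\<close>, independently of
  \<open>s\<close>. This is why \<open>E\<close> is exponential.\<close>

lemma emeasure_E_ge:
  assumes \<alpha>: "\<alpha> < - \<gamma>" and a: "0 \<le> a"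
  shows "emeasure (limit_space \<alpha>) {\<omega>. a \<le> coord_E \<omega>} = ennreal (exp (sqrt 2 * \<alpha> * a))"
proof -
  have lw: "ennreal (limit_weight \<alpha> s (a + y)) = ennreal (exp (sqrt 2 * \<alpha> * a)) * ennreal (limit_weight \<alpha> s y)" for s y
    by (simp add: limit_weight_def ennreal_mult[symmetric] exp_add[symmetric] algebra_simps indicator_def)
  have sl: "(\<integral>\<^sup>+y. (ennreal (limit_weight \<alpha> s y) * ennreal ((max_cdf M L B (y - a) (max 0 s))\<^sup>2)) \<partial>lborel) =
      ennreal (exp (sqrt 2 * \<alpha> * a)) * slice \<alpha> s" for s
  proof -
    have "(\<integral>\<^sup>+y. (ennreal (limit_weight \<alpha> s y) * ennreal ((max_cdf M L B (y - a) (max 0 s))\<^sup>2)) \<partial>lborel) =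
      (\<integral>\<^sup>+y. (ennreal (limit_weight \<alpha> s (a + y)) * ennreal ((max_cdf M L B y (max 0 s))\<^sup>2)) \<partial>lborel)"
      by (subst nn_integral_real_affine[where c = 1 and t = a]) auto
    then show ?thesis
      unfolding slice_def lw by (simp add: nn_integral_cmult mult.assoc)
  qed
  have "emeasure (limit_space \<alpha>) {\<omega>. a \<le> coord_E \<omega>} = ennreal (sqrt 2 / \<Phi> M L B \<alpha>) *
      (\<integral>\<^sup>+s. ennreal (exp (sqrt 2 * \<alpha> * a)) * slice \<alpha> s \<partial>lborel)"
    using nn_integral_E_ge[OF a, of "\<lambda>_. True" "\<lambda>_. True"] by (simp add: sl)
  also have "ennreal (sqrt 2 / \<Phi> M L B \<alpha>) * (\<integral>\<^sup>+s. ennreal (exp (sqrt 2 * \<alpha> * a)) * slice \<alpha> s \<partial>lborel) =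
      ennreal (exp (sqrt 2 * \<alpha> * a)) * (ennreal (sqrt 2 / \<Phi> M L B \<alpha>) * mass \<alpha>)"
    by (subst nn_integral_cmult, measurable, simp only: mass_eq ac_simps)
  finally show ?thesis
    by (simp add: Phi_mass[OF \<alpha>])
qed

lemma distributed_E:
  assumes \<alpha>: "\<alpha> < - \<gamma>"
  shows "distributed (limit_space \<alpha>) lborel coord_E (exponential_density (- sqrt 2 * \<alpha>))"
proof -
  interpret P: prob_space "limit_space \<alpha>"
    by (rule prob_space_limit_space[OF \<alpha>])
  have "1 < sqrt (2 :: real)"
    by simp
  with \<alpha> have neg: "\<alpha> < 0"
    unfolding \<gamma>_def by linarith
  define l where "l = - sqrt 2 * \<alpha>"
  have l: "0 < l"
    using neg by (simp add: l_def mult_pos_neg)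
  have ge: "measure (limit_space \<alpha>) {\<omega>. a \<le> coord_E \<omega>} = exp (- a * l)" if "0 \<le> a" for a
    using emeasure_E_ge[OF \<alpha> that] by (simp add: P.emeasure_eq_measure l_def mult.commute)
  have sets: "{\<omega>. a \<le> coord_E \<omega>} \<in> sets (limit_space \<alpha>)" "{\<omega>. a < coord_E \<omega>} \<in> sets (limit_space \<alpha>)"
    "{\<omega>. coord_E \<omega> \<le> a} \<in> sets (limit_space \<alpha>)" for a
    using borel_measurable_le[of "\<lambda>_. a" "limit_space \<alpha>" coord_E] borel_measurable_less[of "\<lambda>_. a" "limit_space \<alpha>" coord_E]
      borel_measurable_le[of coord_E "limit_space \<alpha>" "\<lambda>_. a"] measurable_coords(3)[of \<alpha>] by auto
  have gt: "measure (limit_space \<alpha>) {\<omega>. a < coord_E \<omega>} = exp (- a * l)" if a: "0 \<le> a" for a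
  proof (rule antisym)
    show "measure (limit_space \<alpha>) {\<omega>. a < coord_E \<omega>} \<le> exp (- a * l)"
      unfolding ge[OF a, symmetric] by (intro P.finite_measure_mono sets) auto
    \<comment> \<open>The distribution function needs the open tail; it is reached from closed tails
      at levels slightly above \<open>a\<close>.\<close>
    have "(\<lambda>n. exp (- (a + 1 / real (Suc n)) * l)) \<longlonglongrightarrow> exp (- (a + 0) * l)"
      by (intro tendsto_intros LIMSEQ_Suc[OF lim_inverse_n'])
    moreover have "exp (- (a + 1 / real (Suc n)) * l) \<le> measure (limit_space \<alpha>) {\<omega>. a < coord_E \<omega>}" for n
    proof -
      have "0 \<le> a + 1 / real (Suc n)"
        using a by simp
      from ge[OF this] have "exp (- (a + 1 / real (Suc n)) * l) = measure (limit_space \<alpha>) {\<omega>. a + 1 / real (Suc n) \<le> coord_E \<omega>}" ..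
      also have "\<dots> \<le> measure (limit_space \<alpha>) {\<omega>. a < coord_E \<omega>}"
      proof (rule P.finite_measure_mono[OF _ sets(2)], clarify)
        fix \<omega> assume "a + 1 / real (Suc n) \<le> coord_E \<omega>"
        then show "a < coord_E \<omega>"
          by (rule less_le_trans[rotated]) simp
      qed
      finally show ?thesis .
    qed
    ultimately show "exp (- a * l) \<le> measure (limit_space \<alpha>) {\<omega>. a < coord_E \<omega>}"
      by (intro LIMSEQ_le_const2[of "\<lambda>n. exp (- (a + 1 / real (Suc n)) * l)"]) auto
  qed
  show ?thesis
    unfolding l_def[symmetric]
  proof (rule exponential_distributedI[OF measurable_coords(3) l])
    fix a :: real assume a: "0 \<le> a"
    have "{\<omega> \<in> space (limit_space \<alpha>). coord_E \<omega> \<le> a} = space (limit_space \<alpha>) - {\<omega>. a < coord_E \<omega>}"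
      by auto
    then have "measure (limit_space \<alpha>) {\<omega> \<in> space (limit_space \<alpha>). coord_E \<omega> \<le> a} = 1 - exp (- a * l)"
      by (simp only: P.prob_compl[OF sets(2)] gt[OF a])
    then show "emeasure (limit_space \<alpha>) {\<omega> \<in> space (limit_space \<alpha>). coord_E \<omega> \<le> a} = 1 - ennreal (exp (- a * l))"
      using a l by (simp add: P.emeasure_eq_measure ennreal_minus[symmetric] del: space_limit_space)
  qed
qed

lemma joint_law_limit:
  assumes \<alpha>: "\<alpha> < - \<gamma>" and x: "0 \<le> x1" "0 \<le> x3"
  shows "measure (limit_space \<alpha>) {\<omega> \<in> space (limit_space \<alpha>). coord_xi \<omega> \<le> x1 \<and> coord_chi \<omega> \<le> x2 \<and> x3 \<le> coord_E \<omega>} =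
    1 / \<Phi> M L B \<alpha> *
      ((if x3 < x2 then LINT z:{x3..x2}|lborel. sqrt 2 * exp (sqrt 2 * \<alpha> * z) else 0) +
       sqrt 2 * (LINT s:{0..x1}|lborel. (LINT z:{..x2 - x3}|lborel.
         exp (sqrt 2 * \<alpha> * (x3 + z) + (1 - \<alpha>\<^sup>2) * s) * (max_cdf M L B z s)\<^sup>2)))"
proof -
  let ?\<Phi> = "\<Phi> M L B \<alpha>"
  have \<Phi>: "0 < ?\<Phi>"
    by (rule Phi_eq(2)[OF \<alpha>])
  interpret P: prob_space "limit_space \<alpha>"
    by (rule prob_space_limit_space[OF \<alpha>])
  let ?S = "{\<omega>. coord_xi \<omega> \<le> x1 \<and> coord_chi \<omega> \<le> x2 \<and> x3 \<le> coord_E \<omega>}"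
  define A where "A s = (\<integral>\<^sup>+z. of_bool (z \<le> x2 - x3) *
      ennreal (exp (sqrt 2 * \<alpha> * (x3 + z) + (1 - \<alpha>\<^sup>2) * s) * (max_cdf M L B z s)\<^sup>2) \<partial>lborel)" for s
  define A0 where "A0 = (\<integral>\<^sup>+z. ennreal (indicator {x3..x2} z * exp (sqrt 2 * \<alpha> * z)) \<partial>lborel)"
  have [measurable]: "A \<in> borel_measurable borel"
    unfolding A_def by measurable
  define I where "I = (\<integral>\<^sup>+s. indicator {0..x1} s * A s \<partial>lborel)"
  have inner: "(\<integral>\<^sup>+y. of_bool (y \<le> x2) * (ennreal (limit_weight \<alpha> s y) * ennreal ((max_cdf M L B (y - x3) (max 0 s))\<^sup>2)) \<partial>lborel) =
      (if s \<le> -1 then 0 else A (max 0 s))" for s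
    unfolding A_def
    by (subst nn_integral_real_affine[where c = 1 and t = x3])
       (auto intro!: nn_integral_cong simp: limit_weight_def ennreal_mult[symmetric] add.commute)
  \<comment> \<open>At time 0 both copies sit at the origin, so the distribution function is the
    indicator of \<open>z \<ge> 0\<close> and the level \<open>x3 + z\<close> runs over
    \<open>[x3, x2]\<close>. The case \<open>x2 \<le> x3\<close> leaves a null set.\<close>
  have "A 0 = A0"
    unfolding A_def A0_def
    by (subst (2) nn_integral_real_affine[where c = 1 and t = x3])
       (auto intro!: nn_integral_cong simp: max_cdf_eq max_tail_0 indicator_def)
  have "emeasure (limit_space \<alpha>) ?S = ennreal (sqrt 2 / ?\<Phi>) *
      (\<integral>\<^sup>+s. of_bool (max 0 s \<le> x1) * (if s \<le> -1 then 0 else A (max 0 s)) \<partial>lborel)"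
    unfolding inner[symmetric] by (rule nn_integral_E_ge[OF x(2)]) measurable
  also have "(\<integral>\<^sup>+s. of_bool (max 0 s \<le> x1) * (if s \<le> -1 then 0 else A (max 0 s)) \<partial>lborel) =
      (\<integral>\<^sup>+s. A0 * indicator {-1<..<0} s + indicator {0..x1} s * A s \<partial>lborel)"
    using x(1) by (intro nn_integral_cong) (auto simp: indicator_def max_def \<open>A 0 = A0\<close>)
  also have "\<dots> = A0 + I"
    unfolding I_def by (subst nn_integral_add) (auto simp: nn_integral_cmult)
  finally have S: "emeasure (limit_space \<alpha>) ?S = ennreal (sqrt 2 / ?\<Phi>) * (A0 + I)" .
  have fin: "A0 < \<infinity>" "I < \<infinity>"
  proof -
    have "ennreal (sqrt 2 / ?\<Phi>) * (A0 + I) < \<infinity>"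
      unfolding S[symmetric] by (simp add: P.emeasure_eq_measure)
    moreover have "ennreal (sqrt 2 / ?\<Phi>) \<noteq> 0"
      using \<Phi> by simp
    ultimately have "A0 + I < \<infinity>"
      by (auto simp: ennreal_mult_less_top)
    then show "A0 < \<infinity>" "I < \<infinity>"
      by auto
  qed
  have A_fin: "A s < \<infinity>" if "0 \<le> s" for s
  proof -
    have "A s = (\<integral>\<^sup>+y. of_bool (y \<le> x2) * (ennreal (limit_weight \<alpha> s y) * ennreal ((max_cdf M L B (y - x3) s)\<^sup>2)) \<partial>lborel)"
      using inner[of s] that by simp
    also have "\<dots> \<le> slice \<alpha> s"
      unfolding slice_def
    proof (intro nn_integral_mono)
      fix y
      have "max_cdf M L B (y - x3) s \<le> max_cdf M L B y s"
        unfolding max_cdf_def max_below_def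
        using x(2) sets_max_below[of y s] by (intro finite_measure_mono) (auto simp: max_below_def)
      then have "(max_cdf M L B (y - x3) s)\<^sup>2 \<le> (max_cdf M L B y (max 0 s))\<^sup>2"
        using that by (intro power_mono) (auto simp: max_cdf_def)
      then show "of_bool (y \<le> x2) * (ennreal (limit_weight \<alpha> s y) * ennreal ((max_cdf M L B (y - x3) s)\<^sup>2)) \<le>
          ennreal (limit_weight \<alpha> s y) * ennreal ((max_cdf M L B y (max 0 s))\<^sup>2)"
        by (auto intro!: mult_left_mono ennreal_leI)
    qed
    also have "\<dots> < \<infinity>"
      by (rule slice_finite[OF \<alpha>])
    finally show ?thesis .
  qed
  have LA: "(LINT z:{..x2 - x3}|lborel. exp (sqrt 2 * \<alpha> * (x3 + z) + (1 - \<alpha>\<^sup>2) * s) * (max_cdf M L B z s)\<^sup>2) = enn2real (A s)" for s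
    unfolding A_def set_lebesgue_integral_def
    by (subst integral_eq_nn_integral) (auto intro!: arg_cong[where f = enn2real] nn_integral_cong simp: indicator_def)
  have "(LINT s:{0..x1}|lborel. (LINT z:{..x2 - x3}|lborel.
      exp (sqrt 2 * \<alpha> * (x3 + z) + (1 - \<alpha>\<^sup>2) * s) * (max_cdf M L B z s)\<^sup>2)) =
      enn2real (\<integral>\<^sup>+s. ennreal (indicator {0..x1} s * enn2real (A s)) \<partial>lborel)"
    unfolding LA unfolding set_lebesgue_integral_def real_scaleR_def by (rule integral_eq_nn_integral) auto
  also have "(\<integral>\<^sup>+s. ennreal (indicator {0..x1} s * enn2real (A s)) \<partial>lborel) = I"
    unfolding I_def using A_fin by (intro nn_integral_cong) (auto simp: indicator_def less_top)
  finally have LI: "(LINT s:{0..x1}|lborel. (LINT z:{..x2 - x3}|lborel.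
      exp (sqrt 2 * \<alpha> * (x3 + z) + (1 - \<alpha>\<^sup>2) * s) * (max_cdf M L B z s)\<^sup>2)) = enn2real I" .
  have L0: "(if x3 < x2 then LINT z:{x3..x2}|lborel. sqrt 2 * exp (sqrt 2 * \<alpha> * z) else 0) = sqrt 2 * enn2real A0"
  proof (cases "x3 < x2")
    case True
    have "(LINT z:{x3..x2}|lborel. sqrt 2 * exp (sqrt 2 * \<alpha> * z)) = sqrt 2 * (LINT z:{x3..x2}|lborel. exp (sqrt 2 * \<alpha> * z))"
      by (rule set_integral_mult_right)
    also have "(LINT z:{x3..x2}|lborel. exp (sqrt 2 * \<alpha> * z)) = enn2real A0"
      unfolding A0_def set_lebesgue_integral_def real_scaleR_def by (rule integral_eq_nn_integral) auto
    finally show ?thesis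
      using True by simp
  next
    case False
    have "A0 = (\<integral>\<^sup>+z. 0 \<partial>(lborel :: real measure))"
      unfolding A0_def
    proof (rule nn_integral_cong_AE)
      show "AE z in lborel. ennreal (indicator {x3..x2} z * exp (sqrt 2 * \<alpha> * z)) = 0"
        using AE_lborel_singleton[of x3] by eventually_elim (use False in \<open>auto simp: indicator_def\<close>)
    qed
    with False show ?thesis
      by simp
  qed
  have "measure (limit_space \<alpha>) ?S = enn2real (ennreal (sqrt 2 / ?\<Phi>) * (A0 + I))"
    unfolding S[symmetric] by (simp add: measure_def)
  also have "\<dots> = sqrt 2 / ?\<Phi> * (enn2real A0 + enn2real I)"
    using \<Phi> fin by (simp add: enn2real_mult enn2real_plus)
  finally show ?thesis
    unfolding LI L0 by (simp add: algebra_simps add_divide_distrib)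
qed

end

lemma pm_max_shift_plus:
  fixes S1 S2 :: "bool list set"
  assumes "finite S1" "S1 \<noteq> {}" "finite S2" "S2 \<noteq> {}"
  shows "pm_max (pm_shift c (pm_of S1 f1 + pm_of S2 f2)) = max (Max (f1 ` S1)) (Max (f2 ` S2)) + c"
proof -
  let ?f = "\<lambda>u. (if hd u then f2 (tl u) else f1 (tl u)) + c"
  have im: "?f ` (Cons False ` S1 \<union> Cons True ` S2) = (\<lambda>z. z + c) ` (f1 ` S1 \<union> f2 ` S2)"
    by (simp add: image_Un image_image)
  have "pm_max (pm_shift c (pm_of S1 f1 + pm_of S2 f2)) = Max (?f ` (Cons False ` S1 \<union> Cons True ` S2))"
    using assms by (simp only: pm_shift_pm_of_plus) (intro pm_max_pm_of, auto)
  also have "\<dots> = Max (f1 ` S1 \<union> f2 ` S2) + c"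
    unfolding im using assms by (intro mono_Max_commute[symmetric]) (auto simp: mono_def)
  also have "Max (f1 ` S1 \<union> f2 ` S2) = max (Max (f1 ` S1)) (Max (f2 ` S2))"
    using assms by (intro Max_Un) auto
  finally show ?thesis .
qed

lemma E_eq_pm_max_coords:
  fixes z
  defines "\<omega> \<equiv> limit_coords z"
  shows "coord_E \<omega> = - pm_max (limit_process (coord_xi \<omega>) (coord_chi \<omega>) (coord_B1 \<omega>) (coord_B2 \<omega>))"
proof -
  obtain s y y1 y2 where z: "z = (s, y, y1, y2)"
    by (cases z) auto
  show ?thesis
  proof (cases "regular y1 \<and> regular y2")
    case False
    then have "limit_coords z = (0, 0, 0, pm_dirac 0, pm_dirac 0)"
      by (simp add: limit_coords_def z del: de_Morgan_conj)
    then show ?thesis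
      unfolding \<omega>_def by (simp add: coord_defs limit_process_def pm_max_pm_dirac)
  next
    case True
    note coords = coords_regular[OF conjunct1[OF True] conjunct2[OF True], of s y, folded z, folded \<omega>_def]
    show ?thesis
    proof (cases "s \<le> 0")
      case s: True
      then show ?thesis
        unfolding coords using True by (simp add: limit_process_def pm_max_pm_dirac max_position_zero)
    next
      case False
      then have "pm_max (pm_shift (- y) (particles s y1 + particles s y2)) = max (max\<^sub>0 s y1) (max\<^sub>0 s y2) + - y"
        using True unfolding max_position_def
        by (intro pm_max_shift_plus finite_alive_regular alive_nonempty_regular) auto
      with False show ?thesis
        unfolding coords by (simp add: limit_process_def)
    qed
  qed
qed

section \<open>Convergence in distribution\<close>

text \<open>The common form of both sides of the convergence: the observed quantities are almost
  surely this function of the branching data, and the limit variables are this function of the limit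
  data. The values for irregular data agree with \<open>limit_coords\<close>, so
  \<open>observables_coords\<close> has no exceptional set.\<close>

definition observables :: "real \<times> real \<times> tree_data \<times> tree_data \<Rightarrow> real \<times> real \<times> real \<times> point_measure" where
  "observables = (\<lambda>(s, y, y1, y2).
     if regular y1 \<and> regular y2
     then (max 0 s, - y, max (max\<^sub>0 (max 0 s) y1) (max\<^sub>0 (max 0 s) y2) - y,
       limit_process (max 0 s) y (particles (max 0 s) y1) (particles (max 0 s) y2))
     else (0, 0, 0, pm_dirac 0))"

lemma observables_max: "observables (max 0 s, y, y1, y2) = observables (s, y, y1, y2)"
  by (simp add: observables_def)

lemma observables_coords:
  fixes z
  defines "\<omega> \<equiv> limit_coords z"
  shows "(coord_xi \<omega>, - coord_chi \<omega>, - coord_E \<omega>,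
    limit_process (coord_xi \<omega>) (coord_chi \<omega>) (coord_B1 \<omega>) (coord_B2 \<omega>)) = observables z"
  unfolding \<omega>_def
  by (auto simp: coord_defs limit_coords_def observables_def limit_process_def case_prod_beta')

text \<open>\<open>measurable_Pair_pm_of\<close> collects the real coordinates in one second
  countable factor; a continuous rearrangement carries the result to the nested product.\<close>

lemma measurable_reorder:
  fixes f :: "'n \<Rightarrow> (real \<times> real \<times> real) \<times> point_measure"
  assumes "f \<in> N \<rightarrow>\<^sub>M borel"
  shows "(\<lambda>x. (fst (fst (f x)), fst (snd (fst (f x))), snd (snd (fst (f x))), snd (f x))) \<in> N \<rightarrow>\<^sub>M borel"
proof -
  have "continuous_on UNIV (\<lambda>p :: (real \<times> real \<times> real) \<times> point_measure.
      (fst (fst p), fst (snd (fst p)), snd (snd (fst p)), snd p))"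
    by (intro continuous_intros)
  from measurable_compose[OF assms borel_measurable_continuous_onI[OF this]] show ?thesis .
qed

lemma measurable_observables [measurable]:
  "observables \<in> (borel \<Otimes>\<^sub>M (borel \<Otimes>\<^sub>M (borel \<Otimes>\<^sub>M borel))) \<rightarrow>\<^sub>M borel"
proof -
  let ?N = "borel \<Otimes>\<^sub>M (borel \<Otimes>\<^sub>M (borel \<Otimes>\<^sub>M borel)) :: (real \<times> real \<times> tree_data \<times> tree_data) measure"
  let ?s = "\<lambda>z::real \<times> real \<times> tree_data \<times> tree_data. fst z" and ?y = "\<lambda>z::real \<times> real \<times> tree_data \<times> tree_data. fst (snd z)"
  let ?y1 = "\<lambda>z::real \<times> real \<times> tree_data \<times> tree_data. fst (snd (snd z))"
  let ?y2 = "\<lambda>z::real \<times> real \<times> tree_data \<times> tree_data. snd (snd (snd z))"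
  let ?sub = "\<lambda>u z. if hd u then ?y2 z else ?y1 z"
  let ?reg = "\<lambda>z. regular (?y1 z) \<and> regular (?y2 z)"
  \<comment> \<open>Labels for the limit configuration. With no remaining time, or for irregular
    data, the single label \<open>[]\<close> represents a unit mass; otherwise the labels come from
    the two subtrees as in \<open>pm_shift_pm_of_plus\<close>.\<close>
  define S where "S z = (if ?reg z \<and> 0 < ?s z
    then Cons False ` alive\<^sub>0 (?s z) (?y1 z) \<union> Cons True ` alive\<^sub>0 (?s z) (?y2 z) else {[]})" for z
  define f where "f z u = (if ?reg z \<and> 0 < ?s z
    then (if hd u then position\<^sub>0 (tl u) (?s z) (?y2 z) else position\<^sub>0 (tl u) (?s z) (?y1 z)) - ?y z
    else if ?reg z then - ?y z else 0)" for z u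
  define g where "g z = (if ?reg z then (max 0 (?s z), - ?y z, max (max\<^sub>0 (max 0 (?s z)) (?y1 z)) (max\<^sub>0 (max 0 (?s z)) (?y2 z)) - ?y z)
     else (0, 0, 0))" for z
  have in_S: "u \<in> S z \<longleftrightarrow> (if ?reg z \<and> 0 < ?s z then u \<noteq> [] \<and> tl u \<in> alive\<^sub>0 (?s z) (?sub u z) else u = [])" for u z
    by (cases u; cases "hd u") (auto simp: S_def)
  have pS: "Measurable.pred ?N (\<lambda>z. u \<in> S z)" for u
    unfolding in_S by (cases "hd u") (simp_all, measurable)
  have "(\<lambda>z. (g z, pm_of (S z) (f z))) \<in> ?N \<rightarrow>\<^sub>M borel"
  proof (rule measurable_Pair_pm_of[OF measurable_eq_set])
    show "{z \<in> space ?N. u \<in> S z} \<in> sets ?N" for u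
      using pS[of u] by (simp add: pred_def)
    show "g \<in> ?N \<rightarrow>\<^sub>M borel"
      unfolding g_def[abs_def] borel_prod[symmetric] by measurable
    have "(\<lambda>z. f z u) \<in> borel_measurable ?N" for u
      unfolding f_def by (cases "hd u") (simp_all, measurable)
    then show "(\<lambda>z. if u \<in> S z then f z u else 0) \<in> borel_measurable ?N" for u
      using pS[of u] by (intro measurable_If) (simp_all add: pred_def)
  qed
  from measurable_reorder[OF this]
  have "(\<lambda>z. (fst (g z), fst (snd (g z)), snd (snd (g z)), pm_of (S z) (f z))) \<in> ?N \<rightarrow>\<^sub>M borel"
    by simp
  moreover have "(fst (g z), fst (snd (g z)), snd (snd (g z)), pm_of (S z) (f z)) = observables z" for z
  proof -
    obtain s y y1 y2 where z: "z = (s, y, y1, y2)"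
      by (cases z) auto
    consider "\<not> (regular y1 \<and> regular y2)" | "regular y1" "regular y2" "s \<le> 0" | "regular y1" "regular y2" "0 < s"
      by linarith
    then show ?thesis
    proof cases
      case 1
      then have "pm_of (S z) (f z) = pm_of {[] :: bool list} (\<lambda>_. 0)" "g z = (0, 0, 0)"
        by (auto simp: S_def z g_def f_def intro!: pm_of_cong)
      with 1 show ?thesis
        by (simp add: observables_def z pm_dirac_eq_pm_of[of _ "[] :: bool list"] del: de_Morgan_conj)
    next
      case 2
      then have "pm_of (S z) (f z) = pm_of {[] :: bool list} (\<lambda>_. - y)"
        by (auto simp: S_def z f_def intro!: pm_of_cong)
      with 2 show ?thesis
        by (simp add: observables_def z g_def limit_process_def pm_dirac_eq_pm_of[of _ "[] :: bool list"])
    next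
      case 3
      have "pm_shift (- y) (particles s y1 + particles s y2) = pm_of (S z) (f z)"
        using 3 by (subst pm_shift_pm_of_plus) (auto simp: finite_alive_regular S_def f_def z intro!: pm_of_cong)
      with 3 show ?thesis
        by (simp add: observables_def z g_def limit_process_def)
    qed
  qed
  ultimately show ?thesis
    by simp
qed

section \<open>The observed quantities as functions of the branching data\<close>

context branching_brownian_motion
begin

definition observed :: "real \<Rightarrow> real \<Rightarrow> 'w \<Rightarrow> real \<times> real \<times> real \<times> point_measure" where
  "observed \<alpha> t \<omega> = (t - min t (first_branching_time L \<omega>),
     position L B [] (min t (first_branching_time L \<omega>)) \<omega> - sqrt 2 * \<alpha> * t,
     max_position L B t \<omega> - sqrt 2 * \<alpha> * t,
     extremal_process L B \<alpha> t \<omega>)"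

lemma measurable_observed:
  assumes t: "0 < t"
  shows "observed \<alpha> t \<in> M \<rightarrow>\<^sub>M borel"
proof -
  let ?Y = "tree_data_of L B" and ?c = "sqrt 2 * \<alpha> * t"
  have [measurable]: "?Y \<in> M \<rightarrow>\<^sub>M borel"
    by (rule measurable_tree_data)
  let ?g = "\<lambda>\<omega>. (t - min t (L [] \<omega>), displacement [] (min t (L [] \<omega>)) (?Y \<omega>) - ?c, max\<^sub>0 t (?Y \<omega>) - ?c)"
  have "(\<lambda>\<omega>. (?g \<omega>, pm_of (alive\<^sub>0 t (?Y \<omega>)) (\<lambda>u. position\<^sub>0 u t (?Y \<omega>) - ?c))) \<in> M \<rightarrow>\<^sub>M borel"
  proof (rule measurable_Pair_pm_of[OF measurable_eq_set])
    show "{\<omega> \<in> space M. u \<in> alive\<^sub>0 t (?Y \<omega>)} \<in> sets M" for u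
      by measurable
    show "?g \<in> M \<rightarrow>\<^sub>M borel"
      unfolding borel_prod[symmetric] by measurable
  qed measurable
  from measurable_reorder[OF this] show ?thesis
  proof (rule measurable_cong[THEN iffD1, rotated])
    fix \<omega> assume \<omega>: "\<omega> \<in> space M"
    have "0 \<le> min t (L [] \<omega>)"
      using t lifetime_pos[OF \<omega>, of "[]"] by simp
    then show "(fst (fst (?g \<omega>, pm_of (alive\<^sub>0 t (?Y \<omega>)) (\<lambda>u. position\<^sub>0 u t (?Y \<omega>) - ?c))),
        fst (snd (fst (?g \<omega>, pm_of (alive\<^sub>0 t (?Y \<omega>)) (\<lambda>u. position\<^sub>0 u t (?Y \<omega>) - ?c)))),
        snd (snd (fst (?g \<omega>, pm_of (alive\<^sub>0 t (?Y \<omega>)) (\<lambda>u. position\<^sub>0 u t (?Y \<omega>) - ?c)))),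
        snd (?g \<omega>, pm_of (alive\<^sub>0 t (?Y \<omega>)) (\<lambda>u. position\<^sub>0 u t (?Y \<omega>) - ?c))) = observed \<alpha> t \<omega>"
      by (simp add: observed_def extremal_process_def first_branching_time_eq[OF \<omega>] position_Nil
          displacement_tree_data[OF \<omega>] max_position_tree_data[OF \<omega>] pm_of_tree_data[OF \<omega>])
  qed
qed

text \<open>Excludes a root that dies exactly at \<open>t\<close>. Two children would then sit at
  the same point, while remaining time 0 is read as a single atom.\<close>

lemma AE_lifetime_neq: "AE \<omega> in M. L u \<omega> \<noteq> t"
proof -
  have "AE x in lborel. x \<noteq> t"
    by (rule AE_lborel_singleton)
  then have "AE x in distr M borel (L u). x \<noteq> t"
    unfolding distr_lifetime by (subst AE_density) (auto elim: eventually_mono)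
  then show ?thesis
    by (rule AE_distrD[rotated]) simp
qed

lemma observed_eq_observables:
  assumes t: "0 < t"
  shows "AE \<omega> in M. observed \<alpha> t \<omega> = observables (branching_data (sqrt 2 * \<alpha> * t) t \<omega>)"
  using AE_regular_tree_data AE_regular_subtree[of False] AE_regular_subtree[of True] AE_space[of M] AE_lifetime_neq[of "[]" t]
proof eventually_elim
  case (elim \<omega>)
  let ?y = "tree_data_of L B \<omega>" and ?c = "sqrt 2 * \<alpha> * t"
  note \<omega> = elim(4)
  have L: "0 < L [] \<omega>"
    by (rule lifetime_pos[OF \<omega>])
  have ext: "extremal_process L B \<alpha> t \<omega> = pm_of (alive\<^sub>0 t ?y) (\<lambda>u. position\<^sub>0 u t ?y - ?c)"
    unfolding extremal_process_def by (rule pm_of_tree_data[OF \<omega>, symmetric])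
  show ?case
  proof (cases "t < L [] \<omega>")
    case True
    then have alive: "alive\<^sub>0 t ?y = {[]}"
      using t lifetime_pos[OF \<omega>] by (intro alive_before_branching) (auto simp: lifetime_tree_data less_imp_le)
    have "pm_of {[]} (\<lambda>u. position\<^sub>0 u t ?y - ?c) = pm_dirac (B [] t \<omega> - ?c)"
      unfolding pm_dirac_eq_pm_of[of _ "[] :: bool list"] using t
      by (intro pm_of_cong) (simp add: position_Nil displacement_tree_data[OF \<omega>])
    moreover have "max_position L B t \<omega> = B [] t \<omega>"
      using max_position_eq_position(1)[of ?y t] elim True t
      by (simp add: lifetime_tree_data displacement_tree_data max_position_tree_data)
    ultimately show ?thesis
      using True elim unfolding observed_def ext alive
      by (simp add: observables_def branching_data_def first_branching_time_eq position_Nil limit_process_def max_position_zero)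
  next
    case False
    with elim have t': "L [] \<omega> < t"
      by simp
    note after = max_position_after_branching[of ?y t, unfolded lifetime_tree_data, OF elim(2,3) less_imp_le[OF t']]
    have "displacement [] (L [] \<omega>) ?y = B [] (L [] \<omega>) \<omega>"
      using L by (intro displacement_tree_data \<omega>) simp
    then show ?thesis
      using t' elim after(1) unfolding observed_def ext after(2)
      by (simp add: observables_def branching_data_def first_branching_time_eq position_Nil limit_process_def
          max_position_tree_data[symmetric] min_def)
  qed
qed

lemma eventually_prob_max_below_pos:
  assumes \<alpha>: "\<alpha> < - \<gamma>"
  shows "\<forall>\<^sub>F t in at_top. 0 < t \<and> 0 < measure M (max_below M L B (sqrt 2 * \<alpha> * t) t)"
proof -
  have "0 < \<Phi> M L B \<alpha> / sqrt 2"
    using Phi_eq(2)[OF \<alpha>] by simp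
  from order_tendstoD(1)[OF prob_max_below_tendsto[OF \<alpha>] this] eventually_gt_at_top[of 0]
  show ?thesis
    by eventually_elim (auto simp: zero_less_mult_iff norming_def zero_less_measure_iff)
qed


text \<open>Adding \<open>K\<close> makes the bounded function \<open>G\<close> nonnegative, so that
  \<open>weighted_convergence\<close> applies. Dividing by the limit of the normalized probability
  of the conditioning event and subtracting \<open>K\<close> gives conditional expectations.\<close>

lemma expectation_branching_data_tendsto:
  fixes G :: "real \<times> real \<times> tree_data \<times> tree_data \<Rightarrow> real"
  assumes \<alpha>: "\<alpha> < - \<gamma>"
    and [measurable]: "G \<in> borel_measurable (borel \<Otimes>\<^sub>M (borel \<Otimes>\<^sub>M (borel \<Otimes>\<^sub>M borel)))"
    and bound: "\<And>z. \<bar>G z\<bar> \<le> K" and G_max: "\<And>s y y1 y2. G (max 0 s, y, y1, y2) = G (s, y, y1, y2)"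
    and Z: "\<And>t. 0 < t \<Longrightarrow> Z t \<in> borel_measurable M"
      "\<And>t. 0 < t \<Longrightarrow> AE \<omega> in M. Z t \<omega> = G (branching_data (sqrt 2 * \<alpha> * t) t \<omega>)"
  shows "((\<lambda>t. \<integral>\<omega>. Z t \<omega> \<partial>given_max_below M L B (sqrt 2 * \<alpha> * t) t) \<longlongrightarrow> (\<integral>z. G z \<partial>limit_data \<alpha>)) at_top"
proof -
  let ?\<Phi> = "\<Phi> M L B \<alpha>" and ?U = "\<lambda>t. given_max_below M L B (sqrt 2 * \<alpha> * t) t"
  let ?A = "\<lambda>t. max_below M L B (sqrt 2 * \<alpha> * t) t"
  let ?n = "\<lambda>t. norming \<alpha> t * measure M (?A t)"
  have \<Phi>: "0 < ?\<Phi>"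
    by (rule Phi_eq(2)[OF \<alpha>])
  have shift: "0 \<le> G z + K" "G z + K \<le> 2 * K" for z
    using bound[of z] by auto
  have K: "0 \<le> K"
    using bound[of undefined] by simp
  define H where "H z = of_bool (below z) * (G z + K)" for z
  have [measurable]: "H \<in> borel_measurable (borel \<Otimes>\<^sub>M (borel \<Otimes>\<^sub>M (borel \<Otimes>\<^sub>M borel)))"
    unfolding H_def by measurable
  interpret Q: prob_space "limit_data \<alpha>"
    by (rule prob_space_limit_data[OF \<alpha>])
  have G_limit: "G \<in> borel_measurable (limit_data \<alpha>)"
    by measurable
  have int_Q: "integrable (limit_data \<alpha>) G"
    using bound by (intro Q.integrable_const_bound[where B = K] G_limit) auto
  have "(\<integral>\<^sup>+z. ennreal (G z + K) \<partial>limit_data \<alpha>) = ennreal (\<integral>z. G z + K \<partial>limit_data \<alpha>)"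
    using shift by (intro nn_integral_eq_integral Bochner_Integration.integrable_add int_Q) auto
  then have lim: "(\<integral>\<^sup>+z. ennreal (G z + K) \<partial>limit_data \<alpha>) = ennreal ((\<integral>z. G z \<partial>limit_data \<alpha>) + K)"
    using int_Q by (simp add: Q.prob_space[simplified])
  have "(\<integral>\<^sup>+(s, y, y1, y2). ennreal (limit_weight \<alpha> s y * H (s, y, y1, y2)) \<partial>joint) =
      (\<integral>\<^sup>+(s, y, y1, y2). ennreal (limit_weight \<alpha> s y) * (of_bool (below (s, y, y1, y2)) * ennreal (G (s, y, y1, y2) + K)) \<partial>joint)"
    by (intro nn_integral_cong) (auto simp: H_def ennreal_mult' limit_weight_def)
  moreover have "ennreal (?\<Phi> / sqrt 2) * ennreal (sqrt 2 / ?\<Phi>) = 1"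
    using \<Phi> by (subst ennreal_mult[symmetric]) auto
  ultimately have H_lim: "(\<integral>\<^sup>+(s, y, y1, y2). ennreal (limit_weight \<alpha> s y * H (s, y, y1, y2)) \<partial>joint) =
      ennreal (?\<Phi> / sqrt 2) * (\<integral>\<^sup>+z. ennreal (G z + K) \<partial>limit_data \<alpha>)"
    by (subst nn_integral_limit_data) (simp_all add: mult.assoc[symmetric])
  have H_t: "(\<integral>\<^sup>+(s, y, y1, y2). ennreal (weight \<alpha> t s y * H (s, y, y1, y2)) \<partial>joint) =
      ennreal (?n t * ((\<integral>\<omega>. Z t \<omega> \<partial>?U t) + K))"
    and bound_t: "0 \<le> (\<integral>\<omega>. Z t \<omega> \<partial>?U t) + K"
    if t: "0 < t" and p: "0 < measure M (?A t)" for t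
  proof -
    have e: "emeasure M (?A t) = ennreal (measure M (?A t))"
      by (rule emeasure_eq_measure)
    have n: "0 \<le> norming \<alpha> t"
      using t by (simp add: norming_def)
    interpret U: prob_space "?U t"
      unfolding given_max_below_def using p by (intro prob_space_uniform_measure) (auto simp: e)
    have Z_U: "Z t \<in> borel_measurable (?U t)"
      using Z(1)[OF t] by (simp add: given_max_below_def)
    have AE_Z: "AE \<omega> in ?U t. \<bar>Z t \<omega>\<bar> \<le> K"
      unfolding given_max_below_def using Z(2)[OF t]
      by (intro AE_uniform_measureI) (auto elim!: eventually_mono simp: bound)
    have int_U: "integrable (?U t) (Z t)"
      using AE_Z by (intro U.integrable_const_bound[where B = K] Z_U) auto
    have "0 \<le> (\<integral>\<omega>. Z t \<omega> + K \<partial>?U t)"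
      using AE_Z by (intro integral_nonneg_AE) (auto elim!: eventually_mono)
    then show nonneg: "0 \<le> (\<integral>\<omega>. Z t \<omega> \<partial>?U t) + K"
      using int_U by (simp add: U.prob_space)
    have "(\<integral>\<^sup>+\<omega>. ennreal (Z t \<omega> + K) \<partial>?U t) = ennreal (\<integral>\<omega>. Z t \<omega> + K \<partial>?U t)"
      using AE_Z by (intro nn_integral_eq_integral Bochner_Integration.integrable_add int_U)
        (auto elim!: eventually_mono)
    then have U_eq: "(\<integral>\<^sup>+\<omega>. ennreal (Z t \<omega> + K) \<partial>?U t) = ennreal ((\<integral>\<omega>. Z t \<omega> \<partial>?U t) + K)"
      using int_U by (simp add: U.prob_space)
    have "(\<integral>\<^sup>+(s, y, y1, y2). ennreal (weight \<alpha> t s y * H (s, y, y1, y2)) \<partial>joint) =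
        (\<integral>\<^sup>+(s, y, y1, y2). ennreal (weight \<alpha> t s y) * (of_bool (below (s, y, y1, y2)) * ennreal (G (max 0 s, y, y1, y2) + K)) \<partial>joint)"
      using shift by (intro nn_integral_cong) (auto simp: H_def ennreal_mult'' G_max)
    also have "\<dots> = ennreal (norming \<alpha> t) *
        (\<integral>\<^sup>+\<omega>. indicator (?A t) \<omega> * ennreal (G (branching_data (sqrt 2 * \<alpha> * t) t \<omega>) + K) \<partial>M)"
      by (rule nn_integral_branching_data[OF t, symmetric]) measurable
    also have "(\<integral>\<^sup>+\<omega>. indicator (?A t) \<omega> * ennreal (G (branching_data (sqrt 2 * \<alpha> * t) t \<omega>) + K) \<partial>M) =
        (\<integral>\<^sup>+\<omega>. ennreal (Z t \<omega> + K) * indicator (?A t) \<omega> \<partial>M)"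
      using Z(2)[OF t] by (intro nn_integral_cong_AE) (auto elim!: eventually_mono simp: mult.commute)
    also have "\<dots> = ennreal (measure M (?A t)) * (\<integral>\<^sup>+\<omega>. ennreal (Z t \<omega> + K) \<partial>?U t)"
    proof -
      have "(\<integral>\<^sup>+\<omega>. ennreal (Z t \<omega> + K) \<partial>?U t) = (\<integral>\<^sup>+\<omega>. ennreal (Z t \<omega> + K) * indicator (?A t) \<omega> \<partial>M) / emeasure M (?A t)"
        unfolding given_max_below_def using Z(1)[OF t] by (intro nn_integral_uniform_measure) auto
      moreover have "I = ennreal (measure M (?A t)) * (I / ennreal (measure M (?A t)))" for I
        using p by (simp only: ennreal_times_divide mult.commute[of _ I]) (simp add: mult_divide_eq_ennreal)
      ultimately show ?thesis
        by (simp only: e)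
    qed
    finally show "(\<integral>\<^sup>+(s, y, y1, y2). ennreal (weight \<alpha> t s y * H (s, y, y1, y2)) \<partial>joint) =
        ennreal (?n t * ((\<integral>\<omega>. Z t \<omega> \<partial>?U t) + K))"
      using nonneg n unfolding U_eq by (simp only: ennreal_mult measure_nonneg mult_nonneg_nonneg mult.assoc)
  qed
  have conv: "((\<lambda>t. \<integral>\<^sup>+(s, y, y1, y2). ennreal (weight \<alpha> t s y * H (s, y, y1, y2)) \<partial>joint) \<longlongrightarrow>
      (\<integral>\<^sup>+(s, y, y1, y2). ennreal (limit_weight \<alpha> s y * H (s, y, y1, y2)) \<partial>joint)) at_top"
    by (rule weighted_convergence[OF \<alpha>, where K = "2 * K"]) (use shift K in \<open>auto simp: H_def\<close>)
  have L: "(\<integral>\<^sup>+(s, y, y1, y2). ennreal (limit_weight \<alpha> s y * H (s, y, y1, y2)) \<partial>joint) =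
      ennreal (?\<Phi> / sqrt 2 * ((\<integral>z. G z \<partial>limit_data \<alpha>) + K))"
    unfolding H_lim lim using \<Phi> by (intro ennreal_mult'[symmetric]) simp
  have ev: "\<forall>\<^sub>F t in at_top. (\<integral>\<^sup>+(s, y, y1, y2). ennreal (weight \<alpha> t s y * H (s, y, y1, y2)) \<partial>joint) =
      ennreal (?n t * ((\<integral>\<omega>. Z t \<omega> \<partial>?U t) + K))"
    using eventually_prob_max_below_pos[OF \<alpha>] by (rule eventually_mono) (use H_t in blast)
  from Lim_transform_eventually[OF conv ev] have "((\<lambda>t. ennreal (?n t * ((\<integral>\<omega>. Z t \<omega> \<partial>?U t) + K))) \<longlongrightarrow>
      ennreal (?\<Phi> / sqrt 2 * ((\<integral>z. G z \<partial>limit_data \<alpha>) + K))) at_top"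
    by (simp only: L)
  then have "((\<lambda>t. ?n t * ((\<integral>\<omega>. Z t \<omega> \<partial>?U t) + K)) \<longlongrightarrow> ?\<Phi> / sqrt 2 * ((\<integral>z. G z \<partial>limit_data \<alpha>) + K)) at_top"
  proof (subst (asm) tendsto_ennreal_iff)
    show "\<forall>\<^sub>F t in at_top. 0 \<le> ?n t * ((\<integral>\<omega>. Z t \<omega> \<partial>?U t) + K)"
      using eventually_prob_max_below_pos[OF \<alpha>]
      by (rule eventually_mono) (use bound_t in \<open>auto simp: norming_def\<close>)
    have "0 \<le> (\<integral>z. G z + K \<partial>limit_data \<alpha>)"
      using shift by (intro integral_nonneg_AE) auto
    then show "0 \<le> ?\<Phi> / sqrt 2 * ((\<integral>z. G z \<partial>limit_data \<alpha>) + K)"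
      using \<Phi> int_Q by (simp add: Q.prob_space[simplified])
  qed
  then have "((\<lambda>t. ?n t * ((\<integral>\<omega>. Z t \<omega> \<partial>?U t) + K) / ?n t - K) \<longlongrightarrow>
      ?\<Phi> / sqrt 2 * ((\<integral>z. G z \<partial>limit_data \<alpha>) + K) / (?\<Phi> / sqrt 2) - K) at_top"
    using \<Phi> by (intro tendsto_diff[OF tendsto_divide[OF _ prob_max_below_tendsto[OF \<alpha>]] tendsto_const]) auto
  then have "((\<lambda>t. ?n t * ((\<integral>\<omega>. Z t \<omega> \<partial>?U t) + K) / ?n t - K) \<longlongrightarrow> (\<integral>z. G z \<partial>limit_data \<alpha>)) at_top"
    using \<Phi> by simp
  then show ?thesis
  proof (rule Lim_transform_eventually)
    show "\<forall>\<^sub>F t in at_top. ?n t * ((\<integral>\<omega>. Z t \<omega> \<partial>?U t) + K) / ?n t - K = (\<integral>\<omega>. Z t \<omega> \<partial>?U t)"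
      using eventually_prob_max_below_pos[OF \<alpha>] by (rule eventually_mono) (auto simp: norming_def)
  qed
qed


text \<open>Stated for a general continuous \<open>\<pi>\<close> in order to obtain both
  convergences from one proof, on the same limit space: \<open>\<pi>\<close> is either the identity
  or the projection that forgets the point process.\<close>

lemma observed_converges:
  fixes \<pi> :: "real \<times> real \<times> real \<times> point_measure \<Rightarrow> 'c::topological_space"
  assumes \<alpha>: "\<alpha> < - \<gamma>" and \<pi>: "continuous_on UNIV \<pi>"
  shows "converges_in_distribution (\<lambda>t. given_max_below M L B (sqrt 2 * \<alpha> * t) t) (\<lambda>t \<omega>. \<pi> (observed \<alpha> t \<omega>))
    (limit_space \<alpha>) (\<lambda>\<omega>. \<pi> (coord_xi \<omega>, - coord_chi \<omega>, - coord_E \<omega>,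
       limit_process (coord_xi \<omega>) (coord_chi \<omega>) (coord_B1 \<omega>) (coord_B2 \<omega>))) at_top"
  unfolding converges_in_distribution_def
proof (intro conjI allI impI)
  let ?U = "\<lambda>t. given_max_below M L B (sqrt 2 * \<alpha> * t) t"
  let ?Y = "\<lambda>\<omega>. (coord_xi \<omega>, - coord_chi \<omega>, - coord_E \<omega>,
       limit_process (coord_xi \<omega>) (coord_chi \<omega>) (coord_B1 \<omega>) (coord_B2 \<omega>))"
  have \<pi>_borel: "\<pi> \<in> borel \<rightarrow>\<^sub>M borel"
    by (rule borel_measurable_continuous_onI[OF \<pi>])
  have sets_U: "X \<in> ?U t \<rightarrow>\<^sub>M N \<longleftrightarrow> X \<in> M \<rightarrow>\<^sub>M N" for X :: "'w \<Rightarrow> 'n" and N t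
    by (subst measurable_cong_sets[of "?U t" M N N]) (simp_all add: given_max_below_def)
  show "\<forall>\<^sub>F t in at_top. prob_space (?U t) \<and> (\<lambda>\<omega>. \<pi> (observed \<alpha> t \<omega>)) \<in> ?U t \<rightarrow>\<^sub>M borel"
    using eventually_prob_max_below_pos[OF \<alpha>]
  proof (rule eventually_mono)
    fix t :: real assume t: "0 < t \<and> 0 < measure M (max_below M L B (sqrt 2 * \<alpha> * t) t)"
    then have "(\<lambda>\<omega>. \<pi> (observed \<alpha> t \<omega>)) \<in> M \<rightarrow>\<^sub>M borel"
      by (intro measurable_compose[OF measurable_observed \<pi>_borel]) simp
    moreover have "prob_space (?U t)"
      using t unfolding given_max_below_def by (intro prob_space_uniform_measure) (auto simp: emeasure_eq_measure)
    ultimately show "prob_space (?U t) \<and> (\<lambda>\<omega>. \<pi> (observed \<alpha> t \<omega>)) \<in> ?U t \<rightarrow>\<^sub>M borel"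
      by (simp only: sets_U simp_thms)
  qed
  show "prob_space (limit_space \<alpha>)"
    by (rule prob_space_limit_space[OF \<alpha>])
  have \<pi>_observables: "(\<lambda>z. \<pi> (observables z)) \<in> borel \<Otimes>\<^sub>M (borel \<Otimes>\<^sub>M (borel \<Otimes>\<^sub>M borel)) \<rightarrow>\<^sub>M borel"
    by (rule measurable_compose[OF measurable_observables \<pi>_borel])
  then have observables_limit: "(\<lambda>z. \<pi> (observables z)) \<in> limit_data \<alpha> \<rightarrow>\<^sub>M borel"
    by (simp only: measurable_cong_sets[OF sets_limit_data refl])
  show Y: "(\<lambda>\<omega>. \<pi> (?Y \<omega>)) \<in> limit_space \<alpha> \<rightarrow>\<^sub>M borel"
    unfolding limit_space_def
    by (rule measurable_final_measure) (simp_all only: observables_coords observables_limit space_borel)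
  fix f :: "'c \<Rightarrow> real" assume "continuous_on UNIV f \<and> bounded (range f)"
  then obtain K where f: "continuous_on UNIV f" and K: "\<And>x. \<bar>f x\<bar> \<le> K"
    by (auto simp: bounded_iff)
  have f_borel: "f \<in> borel_measurable borel"
    by (rule borel_measurable_continuous_onI[OF f])
  have "(\<integral>\<omega>. f (\<pi> (?Y \<omega>)) \<partial>limit_space \<alpha>) = (\<integral>z. f (\<pi> (?Y (limit_coords z))) \<partial>limit_data \<alpha>)"
    using measurable_compose[OF Y f_borel] unfolding limit_space_def final_measure_def
    by (intro integral_distr measurable_final_algebra) simp
  then have lim: "(\<integral>\<omega>. f (\<pi> (?Y \<omega>)) \<partial>limit_space \<alpha>) = (\<integral>z. f (\<pi> (observables z)) \<partial>limit_data \<alpha>)"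
    by (simp only: observables_coords)
  show "((\<lambda>t. \<integral>\<omega>. f (\<pi> (observed \<alpha> t \<omega>)) \<partial>?U t) \<longlongrightarrow> (\<integral>\<omega>. f (\<pi> (?Y \<omega>)) \<partial>limit_space \<alpha>)) at_top"
    unfolding lim
  proof (rule expectation_branching_data_tendsto[OF \<alpha>])
    show "(\<lambda>z. f (\<pi> (observables z))) \<in> borel_measurable (borel \<Otimes>\<^sub>M (borel \<Otimes>\<^sub>M (borel \<Otimes>\<^sub>M borel)))"
      by (rule measurable_compose[OF \<pi>_observables f_borel])
    show "(\<lambda>\<omega>. f (\<pi> (observed \<alpha> t \<omega>))) \<in> borel_measurable M" if "0 < t" for t
      by (rule measurable_compose[OF measurable_compose[OF measurable_observed[OF that] \<pi>_borel] f_borel])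
    show "AE \<omega> in M. f (\<pi> (observed \<alpha> t \<omega>)) = f (\<pi> (observables (branching_data (sqrt 2 * \<alpha> * t) t \<omega>)))"
      if "0 < t" for t
      using observed_eq_observables[OF that, of \<alpha>] by eventually_elim simp
  qed (rule K, simp only: observables_max)
qed


section \<open>Conditional law of the two point processes\<close>

definition hit :: "point_measure set \<Rightarrow> real \<Rightarrow> real \<Rightarrow> real" where
  "hit C s x = measure \<mu> {y. max\<^sub>0 s y \<le> x \<and> particles s y \<in> C}"

lemma pred_hit:
  assumes C: "C \<in> sets borel" and [measurable]: "f \<in> borel_measurable N" "g \<in> borel_measurable N" "h \<in> N \<rightarrow>\<^sub>M borel"
  shows "Measurable.pred N (\<lambda>z. max\<^sub>0 (f z) (h z) \<le> g z \<and> particles (f z) (h z) \<in> C)"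
proof -
  have "(\<lambda>z. particles (f z) (h z)) \<in> N \<rightarrow>\<^sub>M borel"
    by (rule measurable_particles) measurable
  from pred_sets2[OF C this] have [measurable]: "Measurable.pred N (\<lambda>z. particles (f z) (h z) \<in> C)" .
  show ?thesis
    by measurable
qed

lemma nn_integral_hit:
  assumes "C \<in> sets borel"
  shows "(\<integral>\<^sup>+y. of_bool (max\<^sub>0 s y \<le> x \<and> particles s y \<in> C) \<partial>\<mu>) = ennreal (hit C s x)"
proof -
  interpret \<mu>: prob_space \<mu>
    by (rule prob_space_tree_law)
  let ?A = "{y. max\<^sub>0 s y \<le> x \<and> particles s y \<in> C}"
  have "?A \<in> sets \<mu>"
    using pred_hit[OF assms, of "\<lambda>_. s" \<mu> "\<lambda>_. x" "\<lambda>y. y"] by (simp add: pred_def)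
  moreover have "(\<integral>\<^sup>+y. of_bool (max\<^sub>0 s y \<le> x \<and> particles s y \<in> C) \<partial>\<mu>) = (\<integral>\<^sup>+y. indicator ?A y \<partial>\<mu>)"
    by (intro nn_integral_cong) (simp add: indicator_def)
  ultimately show ?thesis
    by (simp add: hit_def \<mu>.emeasure_eq_measure)
qed

lemma measurable_hit:
  assumes C: "C \<in> sets borel" and [measurable]: "f \<in> borel_measurable N" "g \<in> borel_measurable N"
  shows "(\<lambda>z. hit C (f z) (g z)) \<in> borel_measurable N"
proof -
  interpret \<mu>: prob_space \<mu>
    by (rule prob_space_tree_law)
  have [measurable]: "Measurable.pred (N \<Otimes>\<^sub>M \<mu>) (\<lambda>p. max\<^sub>0 (f (fst p)) (snd p) \<le> g (fst p) \<and> particles (f (fst p)) (snd p) \<in> C)"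
    by (rule pred_hit[OF C]) measurable
  have "hit C s x = enn2real (\<integral>\<^sup>+y. of_bool (max\<^sub>0 s y \<le> x \<and> particles s y \<in> C) \<partial>\<mu>)" for s x
    unfolding nn_integral_hit[OF C] by (simp add: hit_def)
  moreover have "(\<lambda>z. \<integral>\<^sup>+y. of_bool (max\<^sub>0 (f z) y \<le> g z \<and> particles (f z) y \<in> C) \<partial>\<mu>) \<in> borel_measurable N"
    by (rule \<mu>.borel_measurable_nn_integral) (simp add: split_beta')
  ultimately show ?thesis
    by simp
qed

lemma measure_hit:
  assumes "C \<in> sets borel"
  shows "measure M (max_below M L B x s \<inter> {\<omega> \<in> space M. pm_of (alive L s \<omega>) (\<lambda>u. position L B u s \<omega>) \<in> C}) = hit C s x"
proof -
  have Y: "tree_data_of L B \<in> M \<rightarrow>\<^sub>M borel"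
    by (rule measurable_tree_data)
  have "{y. max\<^sub>0 s y \<le> x \<and> particles s y \<in> C} \<in> sets borel"
    using pred_hit[OF assms, of "\<lambda>_. s" borel "\<lambda>_. x" "\<lambda>y. y"] by (simp add: pred_def)
  then have "hit C s x = measure M (tree_data_of L B -` {y. max\<^sub>0 s y \<le> x \<and> particles s y \<in> C} \<inter> space M)"
    unfolding hit_def tree_law_def by (rule measure_distr[OF Y])
  also have "tree_data_of L B -` {y. max\<^sub>0 s y \<le> x \<and> particles s y \<in> C} \<inter> space M =
      max_below M L B x s \<inter> {\<omega> \<in> space M. pm_of (alive L s \<omega>) (\<lambda>u. position L B u s \<omega>) \<in> C}"
    using pm_of_tree_data[of _ s 0] by (auto simp: max_below_def max_position_tree_data)
  finally show ?thesis ..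
qed

lemma hit_le_max_cdf: "C \<in> sets borel \<Longrightarrow> hit C s x \<le> max_cdf M L B x s"
  unfolding measure_hit[symmetric] max_cdf_def by (intro finite_measure_mono) auto

lemma measure_conditioned_law:
  assumes C: "C \<in> sets borel"
  shows "measure (conditioned_law M L B s x) C = hit C s x / max_cdf M L B x s"
proof -
  let ?X = "\<lambda>\<omega>. pm_of (alive L s \<omega>) (\<lambda>u. position L B u s \<omega>)" and ?A = "max_below M L B x s"
  have "(\<lambda>\<omega>. particles s (tree_data_of L B \<omega>)) \<in> M \<rightarrow>\<^sub>M borel"
    by (intro measurable_particles measurable_tree_data) simp
  then have X: "?X \<in> M \<rightarrow>\<^sub>M borel"
    by (rule measurable_cong[THEN iffD1, rotated]) (use pm_of_tree_data[of _ s 0] in simp)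
  have "measure (conditioned_law M L B s x) C = measure (uniform_measure M ?A) (?X -` C \<inter> space M)"
    unfolding conditioned_law_def given_max_below_def using X C by (subst measure_distr) simp_all
  also have "\<dots> = enn2real (emeasure M (?A \<inter> (?X -` C \<inter> space M)) / emeasure M ?A)"
    using measurable_sets[OF X C] by (simp add: measure_def)
  also have "?A \<inter> (?X -` C \<inter> space M) = ?A \<inter> {\<omega> \<in> space M. ?X \<omega> \<in> C}"
    by auto
  also have "enn2real (emeasure M \<dots> / emeasure M ?A) = enn2real (ennreal (hit C s x) / ennreal (max_cdf M L B x s))"
    by (simp only: emeasure_eq_measure measure_hit[OF C] max_cdf_def)
  also have "\<dots> = hit C s x / max_cdf M L B x s"
  \<comment> \<open>If the conditioning event is null, both sides are 0, by the conventions for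
    division by 0 in \<open>ennreal\<close> and in the reals.\<close>
  proof (cases "max_cdf M L B x s = 0")
    case True
    then have "hit C s x = 0"
      using hit_le_max_cdf[OF C, of s x] by (simp add: hit_def measure_le_0_iff)
    then show ?thesis
      by simp
  next
    case False
    then have "0 < max_cdf M L B x s"
      by (simp add: max_cdf_def zero_less_measure_iff)
    then show ?thesis
      by (simp add: divide_ennreal hit_def)
  qed
  finally show ?thesis .
qed

text \<open>Independence of the two copies factorizes the integral. Normalizing each factor by
  \<open>max_cdf\<close> produces the conditioned laws and leaves the squared distribution function,
  which is the weight of \<open>(s, y)\<close> itself; if it vanishes, so do both sides.\<close>

lemma nn_integral_hit_pair:
  assumes C: "C \<in> sets borel" and D: "D \<in> sets borel"
  shows "(\<integral>\<^sup>+y1. (\<integral>\<^sup>+y2. of_bool (below (s, y, y1, y2)) * of_bool (particles (max 0 s) y1 \<in> C \<and> particles (max 0 s) y2 \<in> D) \<partial>\<mu>) \<partial>\<mu>) =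
    ennreal ((max_cdf M L B y (max 0 s))\<^sup>2) *
    ennreal (measure (conditioned_law M L B (max 0 s) y) C * measure (conditioned_law M L B (max 0 s) y) D)"
proof -
  let ?p = "\<lambda>C y1. max\<^sub>0 (max 0 s) y1 \<le> y \<and> particles (max 0 s) y1 \<in> C"
  have m: "Measurable.pred \<mu> (?p C)" if "C \<in> sets borel" for C
    by (rule pred_hit[OF that]) measurable
  note [measurable] = m[OF C] m[OF D]
  have "(\<integral>\<^sup>+y1. (\<integral>\<^sup>+y2. of_bool (below (s, y, y1, y2)) * of_bool (particles (max 0 s) y1 \<in> C \<and> particles (max 0 s) y2 \<in> D) \<partial>\<mu>) \<partial>\<mu>) =
      (\<integral>\<^sup>+y1. (\<integral>\<^sup>+y2. of_bool (?p C y1) * of_bool (?p D y2) \<partial>\<mu>) \<partial>\<mu>)"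
    by (intro nn_integral_cong) (auto simp: below_def)
  also have "\<dots> = (\<integral>\<^sup>+y1. of_bool (?p C y1) \<partial>\<mu>) * (\<integral>\<^sup>+y2. of_bool (?p D y2) \<partial>\<mu>)"
    by (subst nn_integral_cmult, measurable) (subst nn_integral_multc, measurable)
  also have "\<dots> = ennreal (hit C (max 0 s) y * hit D (max 0 s) y)"
    unfolding nn_integral_hit[OF C] nn_integral_hit[OF D] by (simp add: ennreal_mult hit_def)
  also have "hit C (max 0 s) y * hit D (max 0 s) y = (max_cdf M L B y (max 0 s))\<^sup>2 *
      (measure (conditioned_law M L B (max 0 s) y) C * measure (conditioned_law M L B (max 0 s) y) D)"
  proof (cases "max_cdf M L B y (max 0 s) = 0")
    case True
    then show ?thesis
      using hit_le_max_cdf[OF C, of "max 0 s" y] by (simp add: hit_def measure_le_0_iff)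
  next
    case False
    then show ?thesis
      by (simp add: measure_conditioned_law C D power2_eq_square)
  qed
  finally show ?thesis
    by (simp add: ennreal_mult)
qed


text \<open>By the characterization of conditional expectations it suffices to compare integrals
  over events of \<open>(xi, chi)\<close>. Once the two copies are integrated out, both integrands
  coincide for every \<open>(s, y)\<close> by \<open>nn_integral_hit_pair\<close>.\<close>

lemma conditionally_iid_pair_limit:
  assumes \<alpha>: "\<alpha> < - \<gamma>"
  shows "conditionally_iid_pair (limit_space \<alpha>) coord_xi coord_chi (conditioned_law M L B) coord_B1 coord_B2"
  unfolding conditionally_iid_pair_def
proof (intro conjI ballI)
  let ?P = "limit_space \<alpha>"
  interpret P: prob_space ?P
    by (rule prob_space_limit_space[OF \<alpha>])
  show "coord_B1 \<in> ?P \<rightarrow>\<^sub>M borel" "coord_B2 \<in> ?P \<rightarrow>\<^sub>M borel"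
    by measurable
  fix C D :: "point_measure set" assume C: "C \<in> sets borel" and D: "D \<in> sets borel"
  let ?F = "vimage_algebra (space ?P) (\<lambda>\<omega>. (coord_xi \<omega>, coord_chi \<omega>)) borel"
  let ?S = "{\<omega> \<in> space ?P. coord_B1 \<omega> \<in> C \<and> coord_B2 \<omega> \<in> D}"
  define k where "k = (\<lambda>(s, x). measure (conditioned_law M L B s x) C * measure (conditioned_law M L B s x) D)"
  have k: "0 \<le> k p" "k p \<le> 1" for p
  proof -
    have "measure (conditioned_law M L B s x) C' \<le> 1" if "C' \<in> sets borel" for C' s x
      unfolding measure_conditioned_law[OF that]
      using hit_le_max_cdf[OF that, of s x] by (simp add: hit_def max_cdf_def divide_le_eq_1 measure_le_0_iff zero_less_measure_iff)
    then show "0 \<le> k p" "k p \<le> 1"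
      using C D by (auto simp: k_def split_beta' intro!: mult_le_one)
  qed
  \<comment> \<open>Written as a quotient of \<open>hit\<close> and \<open>max_cdf\<close>, the
    conditioned law of a fixed set is jointly measurable in time and level.\<close>
  have k_borel [measurable]: "k \<in> borel_measurable (borel \<Otimes>\<^sub>M borel)"
    unfolding k_def measure_conditioned_law[OF C] measure_conditioned_law[OF D] split_beta'
    by (intro borel_measurable_times borel_measurable_divide measurable_hit C D measurable_max_cdf) measurable
  have coords: "(\<lambda>\<omega>. (coord_xi \<omega>, coord_chi \<omega>)) \<in> ?P \<rightarrow>\<^sub>M borel"
    unfolding borel_prod[symmetric] by measurable
  have sets_F: "sets ?F = {(\<lambda>\<omega>. (coord_xi \<omega>, coord_chi \<omega>)) -` H \<inter> space ?P | H. H \<in> sets borel}"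
    by (rule sets_vimage_algebra2) simp
  have "subalgebra ?P ?F"
    unfolding subalgebra_def sets_F using measurable_sets[OF coords] by auto
  then interpret finite_measure_subalgebra ?P ?F
    by unfold_locales
  have S [measurable]: "?S \<in> sets ?P"
  proof -
    have "coord_B1 -` C \<inter> space ?P \<inter> (coord_B2 -` D \<inter> space ?P) \<in> sets ?P"
      using C D by (intro sets.Int measurable_sets[OF measurable_coords(4)] measurable_sets[OF measurable_coords(5)])
    moreover have "?S = coord_B1 -` C \<inter> space ?P \<inter> (coord_B2 -` D \<inter> space ?P)"
      by auto
    ultimately show ?thesis
      by (simp only:)
  qed
  have k_F: "(\<lambda>\<omega>. k (coord_xi \<omega>, coord_chi \<omega>)) \<in> borel_measurable ?F"
    using k_borel unfolding borel_prod
    by (intro measurable_compose[OF measurable_vimage_algebra1]) auto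
  have k_P [measurable]: "(\<lambda>\<omega>. k (coord_xi \<omega>, coord_chi \<omega>)) \<in> borel_measurable ?P"
    by measurable
  have "AE \<omega> in ?P. real_cond_exp ?P ?F (indicator ?S) \<omega> = k (coord_xi \<omega>, coord_chi \<omega>)"
  proof (rule real_cond_exp_charact)
    fix A assume "A \<in> sets ?F"
    then obtain H where H: "H \<in> sets borel" and A: "A = {\<omega>. (coord_xi \<omega>, coord_chi \<omega>) \<in> H}"
      unfolding sets_F by auto
    have H': "Measurable.pred (borel \<Otimes>\<^sub>M borel) (\<lambda>p. p \<in> H)"
      using H by (simp add: borel_prod)
    have [measurable]: "Measurable.pred N (\<lambda>z. (f z, g z) \<in> H)"
      if [measurable]: "f \<in> borel_measurable N" "g \<in> borel_measurable N" for N :: "'n measure" and f g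
      by (rule measurable_compose[OF _ H']) measurable
    have A_P [measurable]: "A \<in> sets ?P"
      using measurable_sets[OF coords H] by (simp add: A vimage_def)
    let ?hit = "\<lambda>(s, y, y1, y2). of_bool ((max 0 s, y) \<in> H) *
      of_bool (particles (max 0 s) y1 \<in> C \<and> particles (max 0 s) y2 \<in> D) :: ennreal"
    let ?k = "\<lambda>(s, y, y1 :: tree_data, y2 :: tree_data). of_bool ((max 0 s, y) \<in> H) * ennreal (k (max 0 s, y))"
    let ?B = "borel \<Otimes>\<^sub>M (borel \<Otimes>\<^sub>M (borel \<Otimes>\<^sub>M borel)) :: (real \<times> real \<times> tree_data \<times> tree_data) measure"
    have [measurable]: "Measurable.pred ?B (\<lambda>z. particles (max 0 (fst z)) (fst (snd (snd z))) \<in> C)"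
      by (rule pred_sets2[OF C]) (rule measurable_particles; measurable)
    have [measurable]: "Measurable.pred ?B (\<lambda>z. particles (max 0 (fst z)) (snd (snd (snd z))) \<in> D)"
      by (rule pred_sets2[OF D]) (rule measurable_particles; measurable)
    have inner_hit: "(\<integral>\<^sup>+y1. (\<integral>\<^sup>+y2. of_bool (below (s, y, y1, y2)) * ?hit (s, y, y1, y2) \<partial>\<mu>) \<partial>\<mu>) =
        of_bool ((max 0 s, y) \<in> H) * (ennreal ((max_cdf M L B y (max 0 s))\<^sup>2) * ennreal (k (max 0 s, y)))" for s y
      using nn_integral_hit_pair[OF C D, of s y] by (cases "(max 0 s, y) \<in> H") (simp_all add: k_def)
    have inner_k: "(\<integral>\<^sup>+y1. (\<integral>\<^sup>+y2. of_bool (below (s, y, y1, y2)) * ?k (s, y, y1, y2) \<partial>\<mu>) \<partial>\<mu>) =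
        of_bool ((max 0 s, y) \<in> H) * (ennreal ((max_cdf M L B y (max 0 s))\<^sup>2) * ennreal (k (max 0 s, y)))" for s y
    proof -
      interpret \<mu>: prob_space \<mu>
        by (rule prob_space_tree_law)
      show ?thesis
        unfolding nn_integral_below[symmetric] by (simp add: nn_integral_cmult mult_ac)
    qed
    have "(\<integral>\<^sup>+\<omega>. ennreal (indicator A \<omega> * indicator ?S \<omega>) \<partial>?P) = ennreal (sqrt 2 / \<Phi> M L B \<alpha>) *
      (\<integral>\<^sup>+s. (\<integral>\<^sup>+y. ennreal (limit_weight \<alpha> s y) *
        (\<integral>\<^sup>+y1. (\<integral>\<^sup>+y2. of_bool (below (s, y, y1, y2)) * ?hit (s, y, y1, y2) \<partial>\<mu>) \<partial>\<mu>) \<partial>lborel) \<partial>lborel)"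
      by (rule nn_integral_limit_space) (measurable, auto simp: A coords_regular indicator_def split_beta')
    also have "\<dots> = ennreal (sqrt 2 / \<Phi> M L B \<alpha>) *
      (\<integral>\<^sup>+s. (\<integral>\<^sup>+y. ennreal (limit_weight \<alpha> s y) *
        (\<integral>\<^sup>+y1. (\<integral>\<^sup>+y2. of_bool (below (s, y, y1, y2)) * ?k (s, y, y1, y2) \<partial>\<mu>) \<partial>\<mu>) \<partial>lborel) \<partial>lborel)"
      unfolding inner_hit inner_k ..
    also have "\<dots> = (\<integral>\<^sup>+\<omega>. ennreal (indicator A \<omega> * k (coord_xi \<omega>, coord_chi \<omega>)) \<partial>?P)"
      by (rule nn_integral_limit_space[symmetric]) (measurable, auto simp: A coords_regular indicator_def split_beta')
    finally show "(\<integral>\<omega>\<in>A. indicator ?S \<omega> \<partial>?P) = (\<integral>\<omega>\<in>A. k (coord_xi \<omega>, coord_chi \<omega>) \<partial>?P)"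
      unfolding set_lebesgue_integral_def real_scaleR_def using k(1)
      by (subst (1 2) integral_eq_nn_integral) auto
  next
    show "integrable ?P (indicator ?S :: _ \<Rightarrow> real)"
      by (intro P.integrable_const_bound[where B = 1]) auto
    show "integrable ?P (\<lambda>\<omega>. k (coord_xi \<omega>, coord_chi \<omega>))"
      using k by (intro P.integrable_const_bound[where B = 1]) auto
  qed (rule k_F)
  then show "AE \<omega> in ?P. real_cond_exp ?P ?F (indicator ?S) \<omega> =
      measure (conditioned_law M L B (coord_xi \<omega>) (coord_chi \<omega>)) C * measure (conditioned_law M L B (coord_xi \<omega>) (coord_chi \<omega>)) D"
    by (simp add: k_def)
qed

end

theorem theorem1p4:
  fixes M :: "'w measure" and L :: "bool list \<Rightarrow> 'w \<Rightarrow> real"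
    and B :: "bool list \<Rightarrow> real \<Rightarrow> 'w \<Rightarrow> real" and \<alpha> :: real
  assumes bbm: "branching_brownian_motion M L B"
    and \<alpha>: "\<alpha> < - \<gamma>"
  shows
    "(\<lambda>t. measure M (max_below M L B (sqrt 2 * \<alpha> * t) t)) \<sim>[at_top]
       (\<lambda>t. \<Phi> M L B \<alpha> / sqrt (4 * pi) * t powr (- 1 / 2) * exp (- (1 + \<alpha>\<^sup>2) * t)) \<and>
     (\<exists>(P :: (real \<times> real \<times> real \<times> point_measure \<times> point_measure) measure) xi chi E B1 B2.
       prob_space P \<and>
       xi \<in> borel_measurable P \<and> chi \<in> borel_measurable P \<and> E \<in> borel_measurable P \<and>
       (\<forall>A\<in>sets borel. emeasure (distr P borel xi) A =
          ennreal (1 / (- \<alpha> * \<Phi> M L B \<alpha>)) * indicator A 0 +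
          (\<integral>\<^sup>+s\<in>A \<inter> {0<..}. ennreal (sqrt 2 / \<Phi> M L B \<alpha> *
             (LINT z|lborel. exp (sqrt 2 * \<alpha> * z + (1 - \<alpha>\<^sup>2) * s) * (max_cdf M L B z s)\<^sup>2)) \<partial>lborel)) \<and>
       distributed P lborel E (exponential_density (- sqrt 2 * \<alpha>)) \<and>
       (\<forall>x1 x2 x3. 0 \<le> x1 \<and> 0 \<le> x3 \<longrightarrow>
          measure P {\<omega> \<in> space P. xi \<omega> \<le> x1 \<and> chi \<omega> \<le> x2 \<and> x3 \<le> E \<omega>} =
          1 / \<Phi> M L B \<alpha> *
            ((if x3 < x2 then LINT z:{x3..x2}|lborel. sqrt 2 * exp (sqrt 2 * \<alpha> * z) else 0) +
             sqrt 2 * (LINT s:{0..x1}|lborel. (LINT z:{..x2 - x3}|lborel.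
               exp (sqrt 2 * \<alpha> * (x3 + z) + (1 - \<alpha>\<^sup>2) * s) * (max_cdf M L B z s)\<^sup>2)))) \<and>
       conditionally_iid_pair P xi chi (conditioned_law M L B) B1 B2 \<and>
       (AE \<omega> in P. E \<omega> = - pm_max (limit_process (xi \<omega>) (chi \<omega>) (B1 \<omega>) (B2 \<omega>))) \<and>
       converges_in_distribution
         (\<lambda>t. given_max_below M L B (sqrt 2 * \<alpha> * t) t)
         (\<lambda>t \<omega>. (t - min t (first_branching_time L \<omega>),
                 position L B [] (min t (first_branching_time L \<omega>)) \<omega> - sqrt 2 * \<alpha> * t,
                 max_position L B t \<omega> - sqrt 2 * \<alpha> * t))
         P (\<lambda>\<omega>. (xi \<omega>, - chi \<omega>, - E \<omega>)) at_top \<and>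
       converges_in_distribution
         (\<lambda>t. given_max_below M L B (sqrt 2 * \<alpha> * t) t)
         (\<lambda>t \<omega>. (t - min t (first_branching_time L \<omega>),
                 position L B [] (min t (first_branching_time L \<omega>)) \<omega> - sqrt 2 * \<alpha> * t,
                 max_position L B t \<omega> - sqrt 2 * \<alpha> * t,
                 extremal_process L B \<alpha> t \<omega>))
         P (\<lambda>\<omega>. (xi \<omega>, - chi \<omega>, - E \<omega>, limit_process (xi \<omega>) (chi \<omega>) (B1 \<omega>) (B2 \<omega>))) at_top)"
proof -
  interpret branching_brownian_motion M L B
    by (rule bbm)
  have "continuous_on UNIV (\<lambda>(a :: real, b :: real, c :: real, d :: point_measure). (a, b, c))"
    unfolding split_beta' by (intro continuous_intros)
  from observed_converges[OF \<alpha> this] observed_converges[OF \<alpha> continuous_on_id]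
  have conv: "converges_in_distribution
      (\<lambda>t. given_max_below M L B (sqrt 2 * \<alpha> * t) t)
      (\<lambda>t \<omega>. (t - min t (first_branching_time L \<omega>),
              position L B [] (min t (first_branching_time L \<omega>)) \<omega> - sqrt 2 * \<alpha> * t,
              max_position L B t \<omega> - sqrt 2 * \<alpha> * t))
      (limit_space \<alpha>) (\<lambda>\<omega>. (coord_xi \<omega>, - coord_chi \<omega>, - coord_E \<omega>)) at_top"
    "converges_in_distribution
      (\<lambda>t. given_max_below M L B (sqrt 2 * \<alpha> * t) t)
      (\<lambda>t \<omega>. (t - min t (first_branching_time L \<omega>),
              position L B [] (min t (first_branching_time L \<omega>)) \<omega> - sqrt 2 * \<alpha> * t,
              max_position L B t \<omega> - sqrt 2 * \<alpha> * t,
              extremal_process L B \<alpha> t \<omega>))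
      (limit_space \<alpha>) (\<lambda>\<omega>. (coord_xi \<omega>, - coord_chi \<omega>, - coord_E \<omega>,
         limit_process (coord_xi \<omega>) (coord_chi \<omega>) (coord_B1 \<omega>) (coord_B2 \<omega>))) at_top"
    by (simp_all add: observed_def[abs_def])
  have "AE \<omega> in limit_space \<alpha>. coord_E \<omega> =
      - pm_max (limit_process (coord_xi \<omega>) (coord_chi \<omega>) (coord_B1 \<omega>) (coord_B2 \<omega>))"
    unfolding limit_space_def by (rule AE_final_measure, rule E_eq_pm_max_coords)
  with conv \<alpha> show ?thesis
    by (intro conjI prob_max_below_asymp exI[of _ "limit_space \<alpha>"] exI[of _ coord_xi] exI[of _ coord_chi]
        exI[of _ coord_E] exI[of _ coord_B1] exI[of _ coord_B2] ballI allI impI prob_space_limit_space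
        measurable_coords emeasure_xi distributed_E joint_law_limit conditionally_iid_pair_limit) auto
qed

end
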